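(* Let $d\ge 1$ and let $\mathcal H$ be a Hilbert space which is continuously embedded in $\mathscr S'(\mathbb R^d)$ and norm preserved under translations and modulations, i.e. for every $f\in\mathcal H$ and every $x,\xi\in\mathbb R^d$ the distributions $f(\cdot-x)$ and $e^{i\langle\cdot,\xi\rangle}f$ belong to $\mathcal H$ and $$\|f(\cdot-x)\|_{\mathcal H}=\|f\|_{\mathcal H},\qquad \|e^{i\langle\cdot,\xi\rangle}f\|_{\mathcal H}=\|f\|_{\mathcal H}.$$ If $\mathcal H\neq\{0\}$, then $\mathcal H=L^2(\mathbb R^d)$, and there is a constant $C>0$ such that $$\|f\|_{\mathcal H}=C\|f\|_{L^2(\mathbb R^d)},\qquad f\in\mathcal H=L^2(\mathbb R^d).$$
   Context: $\mathscr S'(\mathbb R^d)$ denotes the space of tempered distributions on $\mathbb R^d$, and $\langle\cdot,\cdot\rangle$ the standard inner product on $\mathbb R^d$. *)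

theory Defs
  imports "HOL-Analysis.Analysis"
begin

text \<open>Functions on R^d are modelled on an arbitrary Euclidean space 'a (dimension DIM('a) \<ge> 1).
  Partial derivatives along basis vectors; iterated partial derivatives indexed by lists of basis vectors.\<close>

definition dirderiv :: "'a::euclidean_space \<Rightarrow> ('a \<Rightarrow> complex) \<Rightarrow> 'a \<Rightarrow> complex" where
  "dirderiv b f x = vector_derivative (\<lambda>t::real. f (x + t *\<^sub>R b)) (at 0)"

fun pderivs :: "'a::euclidean_space list \<Rightarrow> ('a \<Rightarrow> complex) \<Rightarrow> 'a \<Rightarrow> complex" where
  "pderivs [] f = f"
| "pderivs (b # bs) f = dirderiv b (pderivs bs f)"

definition smooth_fun :: "('a::euclidean_space \<Rightarrow> complex) \<Rightarrow> bool" where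
  "smooth_fun f \<longleftrightarrow> (\<forall>bs \<in> lists Basis. continuous_on UNIV (pderivs bs f) \<and>
      (\<forall>b\<in>Basis. \<forall>x. (\<lambda>t::real. pderivs bs f (x + t *\<^sub>R b)) differentiable (at 0)))"

definition schwartz :: "('a::euclidean_space \<Rightarrow> complex) \<Rightarrow> bool" where
  "schwartz f \<longleftrightarrow> smooth_fun f \<and>
     (\<forall>k::nat. \<forall>bs \<in> lists Basis. bounded (range (\<lambda>x. (1 + norm x) ^ k * norm (pderivs bs f x))))"

definition schwartz_seminorm :: "nat \<Rightarrow> 'a::euclidean_space list \<Rightarrow> ('a \<Rightarrow> complex) \<Rightarrow> real" where
  "schwartz_seminorm k bs f = (SUP x. (1 + norm x) ^ k * norm (pderivs bs f x))"

text \<open>Tempered distributions: continuous linear functionals on the Schwartz space,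
  normalised to be 0 outside the Schwartz space (so HOL equality is equality of distributions).\<close>
definition tempered :: "(('a::euclidean_space \<Rightarrow> complex) \<Rightarrow> complex) \<Rightarrow> bool" where
  "tempered T \<longleftrightarrow>
     (\<forall>f g. schwartz f \<longrightarrow> schwartz g \<longrightarrow> T (\<lambda>x. f x + g x) = T f + T g) \<and>
     (\<forall>c f. schwartz f \<longrightarrow> T (\<lambda>x. c * f x) = c * T f) \<and>
     (\<forall>f. \<not> schwartz f \<longrightarrow> T f = 0) \<and>
     (\<exists>C M. \<forall>f. schwartz f \<longrightarrow>
        norm (T f) \<le> C * (\<Sum>k\<le>M. \<Sum>bs\<in>{bs. set bs \<subseteq> Basis \<and> length bs \<le> M}. schwartz_seminorm k bs f))"

definition dtranslate :: "'a::euclidean_space \<Rightarrow> (('a \<Rightarrow> complex) \<Rightarrow> complex) \<Rightarrow> (('a \<Rightarrow> complex) \<Rightarrow> complex)" where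
  "dtranslate x T = (\<lambda>\<phi>. T (\<lambda>y. \<phi> (y + x)))"

definition dmodulate :: "'a::euclidean_space \<Rightarrow> (('a \<Rightarrow> complex) \<Rightarrow> complex) \<Rightarrow> (('a \<Rightarrow> complex) \<Rightarrow> complex)" where
  "dmodulate \<xi> T = (\<lambda>\<phi>. T (\<lambda>y. exp (\<i> * complex_of_real (y \<bullet> \<xi>)) * \<phi> y))"

definition square_integrable :: "('a::euclidean_space \<Rightarrow> complex) \<Rightarrow> bool" where
  "square_integrable f \<longleftrightarrow> f \<in> borel_measurable lebesgue \<and> integrable lebesgue (\<lambda>x. (cmod (f x))\<^sup>2)"

definition L2_norm_fun :: "('a::euclidean_space \<Rightarrow> complex) \<Rightarrow> real" where
  "L2_norm_fun f = sqrt (LINT x|lebesgue. (cmod (f x))\<^sup>2)"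

definition dist_of :: "('a::euclidean_space \<Rightarrow> complex) \<Rightarrow> (('a \<Rightarrow> complex) \<Rightarrow> complex)" where
  "dist_of f = (\<lambda>\<phi>. if schwartz \<phi> then (LINT x|lebesgue. f x * \<phi> x) else 0)"

text \<open>A Hilbert space (V, N) of tempered distributions: a complex subspace V with a complete norm N
  satisfying the parallelogram law (hence induced by a complex inner product), such that the inclusion
  into S' is continuous (each evaluation T \<mapsto> T \<phi> is bounded).\<close>
definition hilbert_in_S' :: "(('a::euclidean_space \<Rightarrow> complex) \<Rightarrow> complex) set \<Rightarrow> ((('a \<Rightarrow> complex) \<Rightarrow> complex) \<Rightarrow> real) \<Rightarrow> bool" where
  "hilbert_in_S' V N \<longleftrightarrow>
     (\<forall>T\<in>V. tempered T) \<and>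
     (\<lambda>\<phi>. 0) \<in> V \<and>
     (\<forall>S\<in>V. \<forall>T\<in>V. (\<lambda>\<phi>. S \<phi> + T \<phi>) \<in> V) \<and>
     (\<forall>c. \<forall>T\<in>V. (\<lambda>\<phi>. c * T \<phi>) \<in> V) \<and>
     (\<forall>S\<in>V. \<forall>T\<in>V. N (\<lambda>\<phi>. S \<phi> + T \<phi>) \<le> N S + N T) \<and>
     (\<forall>c. \<forall>T\<in>V. N (\<lambda>\<phi>. c * T \<phi>) = cmod c * N T) \<and>
     (\<forall>T\<in>V. N T = 0 \<longrightarrow> T = (\<lambda>\<phi>. 0)) \<and>
     (\<forall>S\<in>V. \<forall>T\<in>V. (N (\<lambda>\<phi>. S \<phi> + T \<phi>))\<^sup>2 + (N (\<lambda>\<phi>. S \<phi> - T \<phi>))\<^sup>2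
                      = 2 * (N S)\<^sup>2 + 2 * (N T)\<^sup>2) \<and>
     (\<forall>u::nat \<Rightarrow> (('a \<Rightarrow> complex) \<Rightarrow> complex). (\<forall>n. u n \<in> V) \<longrightarrow>
        (\<forall>e>0. \<exists>M. \<forall>m\<ge>M. \<forall>n\<ge>M. N (\<lambda>\<phi>. u m \<phi> - u n \<phi>) < e) \<longrightarrow>
        (\<exists>T\<in>V. (\<lambda>n. N (\<lambda>\<phi>. u n \<phi> - T \<phi>)) \<longlonglongrightarrow> 0)) \<and>
     (\<forall>\<phi>. schwartz \<phi> \<longrightarrow> (\<exists>C. \<forall>T\<in>V. cmod (T \<phi>) \<le> C * N T))"

end

theory Submission
  imports Defs "HOL-Probability.Probability" "HOL-Library.Function_Algebras"
begin

text \<open>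
  By the parallelogram law and completeness, evaluation at a Schwartz function \<open>\<phi>\<close> is
  represented by a vector \<open>rep \<phi>\<close> of the Hilbert space, and \<open>rep \<psi> \<phi>\<close> is a positive
  hermitian form on the Schwartz space that is invariant under simultaneous translations and
  modulations of its arguments. Gaussians are superpositions of characters, so by modulation
  invariance a Gaussian factor can be moved from one argument to the other; hence on two Gaussians
  the form depends only on their product, and by translation invariance only on the width of that
  product. Evaluating the form on a convolution of two Gaussians in two ways determines the
  dependence on the width up to a factor. So on Gaussians the form is a multiple of the
  \<open>L\<^sup>2\<close> inner product. Two tempered distributions that agree on all Gaussians are equal (mollify
  the test function), which extends this to all Schwartz functions, and completeness of both spaces
  finishes the proof.
\<close>

section \<open>Hilbert spaces given by a norm on a carrier set\<close>

text \<open>Nothing guarantees at the outset that a Schwartz function, read as a distribution, lies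
  in \<open>V\<close>; the form is therefore studied on the representers \<open>rep \<phi>\<close>,
  which lie in \<open>V\<close> by construction. Gaussians suit this because they are closed under
  products, stable under translation up to a scalar factor (hence the real linear term
  \<open>b\<close>), and have an explicit Fourier representation with a rapidly decreasing weight.
  Moving a superposition through the form means interchanging a distribution with an integral; a
  tempered distribution is controlled only by seminorms, which forces quantitative estimates for
  test functions depending on a parameter. No dilation invariance is assumed, so the dependence on
  the width must come from an identity between different widths; commutativity of convolution
  supplies it. The form is antilinear in the argument of \<open>rep\<close>, so
  \<open>rep \<phi>\<close> is c times the conjugate of \<open>\<phi>\<close>; since its norm is
  sqrt c times the L2 norm of \<open>\<phi>\<close>, the final constant is 1 / sqrt c.\<close>

lemma additive_bounded_linear:
  fixes f :: "real \<Rightarrow> real"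
  assumes add: "\<And>s t. f (s + t) = f s + f t" and bd: "\<And>t. \<bar>f t\<bar> \<le> C * \<bar>t\<bar>"
  shows "f t = t * f 1"
proof -
  \<comment> \<open>Subtracting the linear part leaves an additive function that vanishes at the
    integers. It thus has period 1, is bounded by its bound on \<open>frac t\<close>, and
    \<open>g (real n * t) = real n * g t\<close> then leaves only 0.\<close>
  define g where "g t = f t - t * f 1" for t
  have g_add: "g (s + t) = g s + g t" for s t
    by (simp add: g_def add algebra_simps)
  have g_nat: "g (real n * t) = real n * g t" for n t
  proof (induction n)
    case 0 show ?case using g_add[of 0 0] by simp
  next
    case (Suc n) then show ?case using g_add[of "real n * t" t] by (simp add: algebra_simps)
  qed
  have g_neg: "g (- t) = - g t" for t using g_add[of t "-t"] g_add[of 0 0] by simp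
  have g_int: "g (of_int n) = 0" for n
  proof -
    have 1: "g (real m) = 0" for m using g_nat[of m 1] by (simp add: g_def)
    show ?thesis using 1[of "nat n"] 1[of "nat (-n)"] g_neg[of "of_int n"]
      by (cases "n \<ge> 0") auto
  qed
  have g_bd: "\<bar>g t\<bar> \<le> C + \<bar>f 1\<bar>" for t
  proof -
    have C: "0 \<le> C" using bd[of 1] by simp
    have "g t = g (frac t)" using g_add[of "of_int \<lfloor>t\<rfloor>" "frac t"] g_int by (simp add: frac_def)
    also have "\<bar>g (frac t)\<bar> \<le> \<bar>f (frac t)\<bar> + \<bar>frac t * f 1\<bar>" by (simp add: g_def)
    also have "\<dots> \<le> C * frac t + frac t * \<bar>f 1\<bar>" using bd[of "frac t"] by (simp add: abs_mult)
    also have "\<dots> \<le> C * 1 + 1 * \<bar>f 1\<bar>"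
      using frac_lt_1[of t] C by (intro add_mono mult_mono) auto
    finally show ?thesis by simp
  qed
  have "g t = 0"
  proof (rule ccontr)
    assume ne: "g t \<noteq> 0"
    obtain n where "(C + \<bar>f 1\<bar>) / \<bar>g t\<bar> < real n" using reals_Archimedean2 by blast
    then have "C + \<bar>f 1\<bar> < real n * \<bar>g t\<bar>" using ne by (simp add: field_simps)
    then show False using g_bd[of "real n * t"] by (simp add: g_nat abs_mult)
  qed
  then show ?thesis by (simp add: g_def)
qed

text \<open>The space is only a subset of a type of functionals: addition comes from the type, the
  scalar action is a parameter, and \<open>N\<close> is meaningful on \<open>V\<close> alone. The
  inner product is not data; it is recovered from the parallelogram law.\<close>

locale hilbert_carrier = module sc for sc :: "complex \<Rightarrow> 'x::ab_group_add \<Rightarrow> 'x" +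
  fixes V :: "'x set" and N :: "'x \<Rightarrow> real"
  assumes zero_V: "0 \<in> V"
    and add_V: "S \<in> V \<Longrightarrow> T \<in> V \<Longrightarrow> S + T \<in> V"
    and sc_V: "T \<in> V \<Longrightarrow> sc c T \<in> V"
    and N_triangle: "S \<in> V \<Longrightarrow> T \<in> V \<Longrightarrow> N (S + T) \<le> N S + N T"
    and N_sc: "T \<in> V \<Longrightarrow> N (sc c T) = cmod c * N T"
    and N_eq_0: "T \<in> V \<Longrightarrow> N T = 0 \<Longrightarrow> T = 0"
    and parallelogram: "S \<in> V \<Longrightarrow> T \<in> V \<Longrightarrow> (N (S + T))\<^sup>2 + (N (S - T))\<^sup>2 = 2 * (N S)\<^sup>2 + 2 * (N T)\<^sup>2"
    and N_complete: "(\<And>n::nat. u n \<in> V) \<Longrightarrow> \<forall>e>0. \<exists>M. \<forall>m\<ge>M. \<forall>n\<ge>M. N (u m - u n) < e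
        \<Longrightarrow> \<exists>T\<in>V. (\<lambda>n. N (u n - T)) \<longlonglongrightarrow> 0"
begin

text \<open>Polarization: the real part of the inner product. The real part suffices because
  evaluating a distribution at \<open>\<i>\<close> times \<open>\<phi>\<close> gives access to the
  imaginary part of its value at \<open>\<phi>\<close>.\<close>

definition R :: "'x \<Rightarrow> 'x \<Rightarrow> real" where
  "R S T = ((N (S + T))\<^sup>2 - (N (S - T))\<^sup>2) / 4"

lemma sc_neg1: "sc (-1) T = - T"
  by (simp add: scale_minus_left)

lemma uminus_V: "T \<in> V \<Longrightarrow> - T \<in> V"
  using sc_V[of T "-1"] by (simp add: sc_neg1)

lemma diff_V: "S \<in> V \<Longrightarrow> T \<in> V \<Longrightarrow> S - T \<in> V"
  using add_V[of S "-T"] uminus_V by simp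

lemma N_zero: "N 0 = 0"
  using N_sc[OF zero_V, of 0] by simp

lemma N_minus: "T \<in> V \<Longrightarrow> N (- T) = N T"
  using N_sc[of T "-1"] by (simp add: sc_neg1)

lemma N_nonneg: assumes "T \<in> V" shows "0 \<le> N T"
  using N_triangle[OF assms uminus_V[OF assms]] N_minus[OF assms] N_zero by simp

lemma N_diff_commute: "S \<in> V \<Longrightarrow> T \<in> V \<Longrightarrow> N (S - T) = N (T - S)"
  using N_minus[OF diff_V, of S T] by simp

lemma N_diff_ge: assumes "S \<in> V" "T \<in> V" shows "\<bar>N S - N T\<bar> \<le> N (S - T)"
  using N_triangle[OF diff_V[OF assms] assms(2)] N_triangle[OF diff_V[OF assms(2,1)] assms(1)]
    N_diff_commute[OF assms] by simp

lemma N_two: "T \<in> V \<Longrightarrow> N (T + T) = 2 * N T"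
  using N_sc[of T 2] scale_left_distrib[of 1 1 T] by simp

lemma R_commute: "S \<in> V \<Longrightarrow> T \<in> V \<Longrightarrow> R S T = R T S"
  by (simp add: R_def add.commute N_diff_commute)

lemma R_self: "T \<in> V \<Longrightarrow> R T T = (N T)\<^sup>2"
  by (simp add: R_def N_two N_zero power2_eq_square)

lemma R_zero_left: "T \<in> V \<Longrightarrow> R 0 T = 0"
  by (simp add: R_def N_minus)

text \<open>The Jordan-von Neumann argument: the parallelogram law for \<open>x + T\<close>,
  \<open>z + T\<close> and for \<open>x - T\<close>, \<open>z - T\<close> produces the same term
  \<open>N (x - z)\<close>, which cancels on subtraction.\<close>

lemma R_add_left:
  assumes S: "S \<in> V" and S': "S' \<in> V" and T: "T \<in> V"
  shows "R (S + S') T = R S T + R S' T"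
proof -
  have half: "R x T + R z T = R (x + z) (T + T) / 2" if x: "x \<in> V" and z: "z \<in> V" for x z
  proof -
    have "(N (x + T))\<^sup>2 + (N (z + T))\<^sup>2 = ((N (x + z + (T + T)))\<^sup>2 + (N (x - z))\<^sup>2) / 2"
      using parallelogram[of "x + T" "z + T"] x z T by (simp add: add_V algebra_simps)
    moreover have "(N (x - T))\<^sup>2 + (N (z - T))\<^sup>2 = ((N (x + z - (T + T)))\<^sup>2 + (N (x - z))\<^sup>2) / 2"
      using parallelogram[of "x - T" "z - T"] x z T by (simp add: diff_V algebra_simps)
    ultimately show ?thesis unfolding R_def by (simp add: field_simps)
  qed
  \<comment> \<open>The case \<open>z = 0\<close> of \<open>half\<close> removes the doubled second
    argument.\<close>
  have "R (S + S') T = R (S + S') (T + T) / 2"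
    using half[of "S + S'" 0] S S' T by (simp add: zero_V add_V R_zero_left)
  then show ?thesis using half[OF S S'] by simp
qed

text \<open>Squaring the triangle inequality and its reverse gives
  \<open>(N S + N T)\<^sup>2 - (N S - N T)\<^sup>2 = 4 * N S * N T\<close> as a bound, with no
  appeal to linearity of \<open>R\<close>. Homogeneity is in turn derived from this bound.\<close>

lemma R_bound:
  assumes S: "S \<in> V" and T: "T \<in> V"
  shows "\<bar>R S T\<bar> \<le> N S * N T"
proof -
  have up: "(N (S + X))\<^sup>2 \<le> (N S + N X)\<^sup>2" if "X \<in> V" for X
    by (intro power_mono N_triangle N_nonneg add_V S that)
  have lo: "(N S - N X)\<^sup>2 \<le> (N (S - X))\<^sup>2" if "X \<in> V" for X
    using N_diff_ge[OF S that] by (metis abs_le_square_iff abs_of_nonneg N_nonneg diff_V S that)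
  have 1: "R S T \<le> N S * N T"
    using up[OF T] lo[OF T] unfolding R_def by (simp add: power2_eq_square algebra_simps)
  have 2: "- R S T \<le> N S * N T"
    using up[OF uminus_V[OF T]] lo[OF uminus_V[OF T]] N_minus[OF T]
    unfolding R_def by (simp add: power2_eq_square field_simps)
  from 1 2 show ?thesis by simp
qed

lemma R_scale_left:
  assumes S: "S \<in> V" and T: "T \<in> V"
  shows "R (sc (of_real t) S) T = t * R S T"
proof -
  have "R (sc (of_real t) S) T = t * R (sc (of_real 1) S) T"
  proof (rule additive_bounded_linear[where f="\<lambda>t. R (sc (of_real t) S) T" and C="N S * N T"])
    show "R (sc (of_real (s + t)) S) T = R (sc (of_real s) S) T + R (sc (of_real t) S) T" for s t
      by (simp add: scale_left_distrib R_add_left sc_V S T)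
    show "\<bar>R (sc (of_real t) S) T\<bar> \<le> N S * N T * \<bar>t\<bar>" for t
      using R_bound[OF sc_V[OF S] T, of "of_real t"] by (simp add: N_sc S mult_ac)
  qed
  then show ?thesis by simp
qed

text \<open>Multiplication by \<open>\<i>\<close> is an isometry and
  \<open>sc \<i> S + T = sc \<i> (S - sc \<i> T)\<close>, so the two terms of \<open>R\<close> trade
  places.\<close>

lemma R_ii_left:
  assumes S: "S \<in> V" and T: "T \<in> V"
  shows "R (sc \<i> S) T = - R S (sc \<i> T)"
proof -
  have iso: "N (sc \<i> X) = N X" if "X \<in> V" for X using N_sc[OF that] by simp
  have 1: "sc \<i> S + T = sc \<i> (S - sc \<i> T)" "sc \<i> S - T = sc \<i> (S + sc \<i> T)"
    by (simp_all add: scale_right_distrib scale_right_diff_distrib scale_minus_left)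
  show ?thesis unfolding R_def 1 using S T by (simp add: iso add_V diff_V sc_V diff_divide_distrib)
qed

lemma R_diff_left:
  assumes "S \<in> V" "S' \<in> V" "T \<in> V"
  shows "R (S - S') T = R S T - R S' T"
  using R_add_left[of "S - S'" S' T] assms by (simp add: diff_V)

lemma N_add_scaled_sq:
  assumes S: "S \<in> V" and T: "T \<in> V"
  shows "(N (S + sc (of_real t) T))\<^sup>2 = (N S)\<^sup>2 + 2 * t * R S T + t\<^sup>2 * (N T)\<^sup>2"
proof -
  let ?X = "sc (of_real t) T"
  have X: "?X \<in> V" using T by (rule sc_V)
  have "(N (S + ?X))\<^sup>2 = R (S + ?X) (S + ?X)" by (simp add: R_self add_V S X)
  also have "\<dots> = R S (S + ?X) + R ?X (S + ?X)" by (rule R_add_left[OF S X add_V[OF S X]])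
  also have "R S (S + ?X) = R S S + R ?X S"
    using R_commute[OF S add_V[OF S X]] R_add_left[OF S X S] by simp
  also have "R ?X (S + ?X) = R S ?X + R ?X ?X"
    using R_commute[OF X add_V[OF S X]] R_add_left[OF S X X] by simp
  also have "R S ?X = R ?X S" by (rule R_commute[OF S X])
  also have "R ?X S = t * R S T" using R_scale_left[OF T S, of t] R_commute[OF S T] by simp
  also have "R ?X ?X = t\<^sup>2 * (N T)\<^sup>2" by (simp add: R_self X N_sc T power_mult_distrib)
  also have "R S S = (N S)\<^sup>2" by (rule R_self[OF S])
  finally have "(N (S + ?X))\<^sup>2 = (N S)\<^sup>2 + t * R S T + (t * R S T + t\<^sup>2 * (N T)\<^sup>2)" .
  then show ?thesis by simp
qed

lemma R_eq_0_imp: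
  assumes "T \<in> V" "R T T = 0" shows "T = 0"
  using N_eq_0[OF assms(1)] assms R_self by simp

lemma R_tendsto:
  assumes u: "\<And>n. u n \<in> V" and S: "S \<in> V" and T: "T \<in> V" and lim: "(\<lambda>n. N (u n - S)) \<longlonglongrightarrow> 0"
  shows "(\<lambda>n. R (u n) T) \<longlonglongrightarrow> R S T"
proof -
  have "(\<lambda>n. R (u n) T - R S T) \<longlonglongrightarrow> 0"
  proof (rule Lim_null_comparison)
    show "\<forall>\<^sub>F n in sequentially. norm (R (u n) T - R S T) \<le> N (u n - S) * N T"
      using R_bound[OF diff_V[OF u S] T] by (simp add: R_diff_left u S T)
    show "(\<lambda>n. N (u n - S) * N T) \<longlonglongrightarrow> 0" using tendsto_mult_left_zero[OF lim] by simp
  qed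
  then show ?thesis by (rule LIM_zero_cancel)
qed

lemma N_tendsto:
  assumes u: "\<And>n. u n \<in> V" and S: "S \<in> V" and lim: "(\<lambda>n. N (u n - S)) \<longlonglongrightarrow> 0"
  shows "(\<lambda>n. N (u n)) \<longlonglongrightarrow> N S"
proof -
  have "(\<lambda>n. N (u n) - N S) \<longlonglongrightarrow> 0"
    by (rule Lim_null_comparison[OF _ lim]) (simp add: N_diff_ge u S)
  then show ?thesis by (rule LIM_zero_cancel)
qed

text \<open>The representing vector is the limit of a minimising sequence of \<open>N P ^ 2 - 2 L P\<close>,
  which is Cauchy by the parallelogram law.\<close>

lemma riesz_dense:
  assumes D: "D \<subseteq> V" "D \<noteq> {}"
    and D_add: "\<And>P Q. P \<in> D \<Longrightarrow> Q \<in> D \<Longrightarrow> P + Q \<in> D"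
    and D_sc: "\<And>P t. P \<in> D \<Longrightarrow> sc (of_real t) P \<in> D"
    and L_add: "\<And>P Q. P \<in> D \<Longrightarrow> Q \<in> D \<Longrightarrow> L (P + Q) = L P + L Q"
    and L_sc: "\<And>P t. P \<in> D \<Longrightarrow> L (sc (of_real t) P) = t * L P"
    and L_bd: "\<And>P. P \<in> D \<Longrightarrow> L P \<le> M * N P"
  obtains S u where "S \<in> V" "\<And>n::nat. u n \<in> D" "(\<lambda>n. N (u n - S)) \<longlonglongrightarrow> 0"
    "\<And>P. P \<in> D \<Longrightarrow> R S P = L P"
proof -
  define J where "J P = (N P)\<^sup>2 - 2 * L P" for P
  define m where "m = Inf (J ` D)"
  have DV: "P \<in> D \<Longrightarrow> P \<in> V" for P using D by blast
  have J_lower: "- M\<^sup>2 \<le> J P" if "P \<in> D" for P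
  proof -
    have "0 \<le> (N P - M)\<^sup>2" by simp
    then show ?thesis using L_bd[OF that] unfolding J_def by (simp add: power2_eq_square algebra_simps)
  qed
  have bdd: "bdd_below (J ` D)" by (rule bdd_belowI[of _ "- M\<^sup>2"]) (use J_lower in auto)
  have m_le: "m \<le> J P" if "P \<in> D" for P unfolding m_def by (rule cInf_lower) (use bdd that in auto)
  have "\<exists>P\<in>D. J P < m + 1 / real (Suc n)" for n
  proof -
    have "Inf (J ` D) < m + 1 / real (Suc n)" by (simp add: m_def)
    then show ?thesis using D bdd by (subst (asm) cInf_less_iff) auto
  qed
  then obtain u where uD: "\<And>n. u n \<in> D" and uJ: "\<And>n. J (u n) < m + 1 / real (Suc n)"
    by metis
  have uV: "u n \<in> V" for n using uD DV by blast
  \<comment> \<open>The midpoint of \<open>u i\<close> and \<open>u j\<close> lies in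
    \<open>D\<close>, so its \<open>J\<close> value is at least \<open>m\<close>; the parallelogram
    law converts this into a bound on the distance.\<close>
  have dist: "(N (u i - u j))\<^sup>2 \<le> 2 / real (Suc i) + 2 / real (Suc j)" for i j
  proof -
    define h where "h = sc (of_real (1/2)) (u i + u j)"
    have hD: "h \<in> D" unfolding h_def by (intro D_sc D_add uD)
    have "N h = N (u i + u j) / 2" unfolding h_def using N_sc[OF add_V[OF uV uV]] by (simp add: norm_divide)
    moreover have "L h = (L (u i) + L (u j)) / 2" unfolding h_def L_sc[OF D_add[OF uD uD]] L_add[OF uD uD] by simp
    ultimately have "4 * J h = (N (u i + u j))\<^sup>2 - 4 * (L (u i) + L (u j))"
      by (simp only: J_def) (simp add: power_divide field_simps)
    with parallelogram[OF uV uV, of i j] m_le[OF hD] uJ[of i] uJ[of j] show ?thesis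
      by (simp add: J_def)
  qed
  have cauchy: "\<forall>e>0. \<exists>M. \<forall>m\<ge>M. \<forall>n\<ge>M. N (u m - u n) < e"
  proof (intro allI impI)
    fix e :: real assume e: "e > 0"
    obtain K where K: "4 / e\<^sup>2 < real K" using reals_Archimedean2 by blast
    have "N (u i - u j) < e" if ij: "i \<ge> K" "j \<ge> K" for i j
    proof -
      have "2 / real (Suc i) \<le> 2 / real (Suc K)" "2 / real (Suc j) \<le> 2 / real (Suc K)"
        using ij by (auto intro!: divide_left_mono)
      then have "(N (u i - u j))\<^sup>2 \<le> 4 / real (Suc K)" using dist[of i j] by simp
      also have "\<dots> < e\<^sup>2"
      proof -
        have "4 < real (Suc K) * e\<^sup>2" using K e by (simp add: field_simps) (smt (verit) zero_less_power)
        then show ?thesis by (simp add: field_simps)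
      qed
      finally show ?thesis using e by (rule_tac power2_less_imp_less) auto
    qed
    then show "\<exists>M. \<forall>m\<ge>M. \<forall>n\<ge>M. N (u m - u n) < e" by blast
  qed
  obtain S where S: "S \<in> V" and lim: "(\<lambda>n. N (u n - S)) \<longlonglongrightarrow> 0"
    using N_complete[OF uV cauchy] by blast
  have "R S P = L P" if P: "P \<in> D" for P
  proof -
    \<comment> \<open>Perturbing the minimising sequence by a multiple of \<open>P\<close> and
      passing to the limit gives a quadratic in \<open>t\<close> that is nonnegative for every
      \<open>t\<close>; its linear coefficient must then vanish.\<close>
    have var: "0 \<le> 2 * t * (R S P - L P) + t\<^sup>2 * (N P)\<^sup>2" for t
    proof -
      have "- (1 / real (Suc n)) \<le> 2 * t * (R (u n) P - L P) + t\<^sup>2 * (N P)\<^sup>2" for n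
      proof -
        have "m \<le> J (u n + sc (of_real t) P)" by (intro m_le D_add D_sc uD P)
        also have "\<dots> = J (u n) + 2 * t * (R (u n) P - L P) + t\<^sup>2 * (N P)\<^sup>2"
          unfolding J_def using N_add_scaled_sq[OF uV DV[OF P]] L_add[OF uD D_sc[OF P]] L_sc[OF P]
          by (simp add: algebra_simps)
        finally show ?thesis using uJ[of n] by simp
      qed
      moreover have "(\<lambda>n. - (1 / real (Suc n))) \<longlonglongrightarrow> - 0"
        by (intro tendsto_minus) (use LIMSEQ_inverse_real_of_nat in \<open>simp add: inverse_eq_divide\<close>)
      moreover have "(\<lambda>n. 2 * t * (R (u n) P - L P) + t\<^sup>2 * (N P)\<^sup>2)
          \<longlonglongrightarrow> 2 * t * (R S P - L P) + t\<^sup>2 * (N P)\<^sup>2"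
        by (intro tendsto_intros R_tendsto uV S DV P lim)
      ultimately show ?thesis using LIMSEQ_le[of "\<lambda>n. - (1 / real (Suc n))" "- 0"] by auto
    qed
    let ?x = "R S P - L P" and ?n = "(N P)\<^sup>2"
    \<comment> \<open>The denominator \<open>?n + 1\<close> in place of \<open>?n\<close> keeps the
      choice of \<open>t\<close> legitimate when \<open>N P = 0\<close>.\<close>
    have pos: "0 < ?n + 1" by (smt (verit) zero_le_power2)
    have "0 \<le> 2 * (- ?x / (?n + 1)) * ?x + (- ?x / (?n + 1))\<^sup>2 * ?n" using var by blast
    also have "\<dots> \<le> 2 * (- ?x / (?n + 1)) * ?x + (- ?x / (?n + 1))\<^sup>2 * (?n + 1)"
      by (intro add_left_mono mult_left_mono) auto
    also have "\<dots> = - (?x\<^sup>2 / (?n + 1))"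
      using pos by (simp add: power2_eq_square divide_simps) (simp add: algebra_simps)
    finally have "?x\<^sup>2 \<le> 0" using pos by (simp add: field_simps zero_le_divide_iff)
    then show ?thesis by simp
  qed
  with S uD lim show ?thesis by (rule_tac that)
qed

end

section \<open>Schwartz functions\<close>

abbreviation wt :: "'a::real_normed_vector \<Rightarrow> real" where "wt x \<equiv> 1 + norm x"

lemma dirderiv_eqI:
  assumes "\<And>x. ((\<lambda>t::real. g (x + t *\<^sub>R b)) has_vector_derivative h x) (at 0)"
  shows "dirderiv b g = h"
  using assms unfolding dirderiv_def by (auto intro!: vector_derivative_at)

text \<open>Coinduction: a class of functions closed under partial derivatives contains all iterated
  derivatives of its members, so continuity and decay need checking only on the class. The index
  names the derivative: a polynomial factor for Gaussians, an integrand for parameter integrals, a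
  pair for sums.\<close>

lemma schwartz_coinduct:
  assumes Q: "Q i"
    and cont: "\<And>i. Q i \<Longrightarrow> continuous_on UNIV (F i)"
    and bd: "\<And>i k. Q i \<Longrightarrow> \<exists>C. \<forall>x. wt x ^ k * norm (F i x) \<le> C"
    and step: "\<And>i b. Q i \<Longrightarrow> b \<in> Basis \<Longrightarrow>
      \<exists>j. Q j \<and> (\<forall>x. ((\<lambda>t::real. F i (x + t *\<^sub>R b)) has_vector_derivative F j x) (at 0))"
  shows "schwartz (F i)"
proof -
  have P: "\<exists>j. Q j \<and> pderivs bs (F i) = F j" if "bs \<in> lists Basis" for bs
    using that
  proof (induction bs)
    case Nil
    then show ?case using Q by auto
  next
    case (Cons b bs)
    then obtain j where j: "Q j" "pderivs bs (F i) = F j" by auto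
    have b: "b \<in> Basis" using Cons by simp
    obtain l where "Q l" "\<And>x. ((\<lambda>t::real. F j (x + t *\<^sub>R b)) has_vector_derivative F l x) (at 0)"
      using step[OF j(1) b] by blast
    then show ?case using j(2) dirderiv_eqI[of "F j" b "F l"] by auto
  qed
  have "continuous_on UNIV (pderivs bs (F i)) \<and>
      (\<forall>b\<in>Basis. \<forall>x. (\<lambda>t::real. pderivs bs (F i) (x + t *\<^sub>R b)) differentiable (at 0)) \<and>
      (\<forall>k. bounded (range (\<lambda>x. wt x ^ k * norm (pderivs bs (F i) x))))" if bs: "bs \<in> lists Basis" for bs
  proof -
    obtain j where j: "Q j" "pderivs bs (F i) = F j" using P[OF bs] by blast
    have "bounded (range (\<lambda>x. wt x ^ k * norm (F j x)))" for k
    proof -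
      obtain C where "\<And>x. wt x ^ k * norm (F j x) \<le> C" using bd[OF j(1)] by blast
      then show ?thesis by (auto intro!: boundedI[of _ C])
    qed
    moreover have "(\<lambda>t::real. F j (x + t *\<^sub>R b)) differentiable (at 0)" if "b \<in> Basis" for b x
      using step[OF j(1) that] by (blast intro: differentiableI_vector)
    ultimately show ?thesis unfolding j(2) using cont[OF j(1)] by blast
  qed
  then show ?thesis unfolding schwartz_def smooth_fun_def by blast
qed

lemma pderivs_append: "pderivs (bs @ cs) f = pderivs bs (pderivs cs f)"
  by (induction bs) auto

lemma schwartz_continuous: "schwartz f \<Longrightarrow> continuous_on UNIV f"
  unfolding schwartz_def smooth_fun_def by (metis lists.Nil pderivs.simps(1))

lemma schwartz_measurable: "schwartz f \<Longrightarrow> f \<in> borel_measurable borel"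
  by (intro borel_measurable_continuous_onI schwartz_continuous)

lemma schwartz_pderivs:
  assumes f: "schwartz f" and bs: "bs \<in> lists Basis"
  shows "schwartz (pderivs bs f)"
proof -
  have "cs @ bs \<in> lists Basis" if "cs \<in> lists Basis" for cs using that bs by simp
  then show ?thesis
    using f unfolding schwartz_def smooth_fun_def pderivs_append[symmetric] by blast
qed

lemma schwartz_dirderiv: "schwartz f \<Longrightarrow> b \<in> Basis \<Longrightarrow> schwartz (dirderiv b f)"
  using schwartz_pderivs[of f "[b]"] by simp

lemma schwartz_decay:
  assumes "schwartz f"
  obtains C where "C \<ge> 0" "\<And>x. wt x ^ k * norm (f x) \<le> C"
proof -
  have "bounded (range (\<lambda>x. wt x ^ k * norm (pderivs [] f x)))"
    using assms unfolding schwartz_def by blast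
  then obtain C where C: "\<And>x. norm (wt x ^ k * norm (f x)) \<le> C" by (auto simp: bounded_iff)
  have "wt x ^ k * norm (f x) \<le> C" for x using C[of x] by simp
  moreover have "C \<ge> 0" using C[of 0] norm_ge_zero order_trans by blast
  ultimately show ?thesis using that by blast
qed

lemma schwartz_has_dirderiv0:
  assumes "schwartz f" "b \<in> Basis"
  shows "((\<lambda>t::real. f (x + t *\<^sub>R b)) has_vector_derivative dirderiv b f x) (at 0)"
proof -
  have "(\<lambda>t::real. pderivs [] f (x + t *\<^sub>R b)) differentiable (at 0)"
    using assms unfolding schwartz_def smooth_fun_def by blast
  then show ?thesis unfolding dirderiv_def by (simp add: vector_derivative_works)
qed

text \<open>\<open>dirderiv\<close> speaks of the derivative at parameter 0 only; mean value
  estimates need it at every point of the line.\<close>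

lemma has_dirderiv_shift:
  fixes f h :: "'a::real_normed_vector \<Rightarrow> 'b::real_normed_vector"
  assumes "\<And>x. ((\<lambda>t::real. f (x + t *\<^sub>R b)) has_vector_derivative h x) (at 0)"
  shows "((\<lambda>t::real. f (x + t *\<^sub>R b)) has_vector_derivative h (x + s *\<^sub>R b)) (at s)"
proof -
  have "((\<lambda>t::real. f ((x + s *\<^sub>R b) + t *\<^sub>R b)) has_vector_derivative h (x + s *\<^sub>R b)) (at (- s + s))"
    using assms by simp
  then have "(((\<lambda>t::real. f ((x + s *\<^sub>R b) + t *\<^sub>R b)) \<circ> (\<lambda>t. t - s)) has_vector_derivative 1 *\<^sub>R h (x + s *\<^sub>R b)) (at s)"
    by (intro vector_diff_chain_at) (auto intro!: derivative_eq_intros)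
  moreover have "(\<lambda>t::real. f ((x + s *\<^sub>R b) + t *\<^sub>R b)) \<circ> (\<lambda>t. t - s) = (\<lambda>t. f (x + t *\<^sub>R b))"
    by (simp add: fun_eq_iff scaleR_left_diff_distrib)
  ultimately show ?thesis by simp
qed

lemma schwartz_add:
  fixes f g :: "'a::euclidean_space \<Rightarrow> complex"
  assumes "schwartz f" "schwartz g"
  shows "schwartz (\<lambda>x. f x + g x)"
proof -
  define F where "F p x = fst p x + snd p x" for p :: "('a \<Rightarrow> complex) \<times> ('a \<Rightarrow> complex)" and x
  have "schwartz (F (f, g))"
  proof (rule schwartz_coinduct[where Q="\<lambda>p. schwartz (fst p) \<and> schwartz (snd p)"])
    fix p :: "('a \<Rightarrow> complex) \<times> ('a \<Rightarrow> complex)" assume p: "schwartz (fst p) \<and> schwartz (snd p)"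
    show "continuous_on UNIV (F p)"
      unfolding F_def using p by (intro continuous_on_add schwartz_continuous) auto
    show "\<exists>C. \<forall>x. wt x ^ k * norm (F p x) \<le> C" for k
    proof -
      obtain C D where "\<And>x. wt x ^ k * norm (fst p x) \<le> C" "\<And>x. wt x ^ k * norm (snd p x) \<le> D"
        by (metis schwartz_decay p)
      moreover have "wt x ^ k * norm (F p x) \<le> wt x ^ k * norm (fst p x) + wt x ^ k * norm (snd p x)" for x
        unfolding distrib_left[symmetric] F_def by (intro mult_left_mono norm_triangle_ineq) auto
      ultimately have "wt x ^ k * norm (F p x) \<le> C + D" for x by (meson add_mono order_trans)
      then show ?thesis by blast
    qed
    show "\<exists>q. (schwartz (fst q) \<and> schwartz (snd q)) \<and>
        (\<forall>x. ((\<lambda>t::real. F p (x + t *\<^sub>R b)) has_vector_derivative F q x) (at 0))" if "b \<in> Basis" for b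
      unfolding F_def using p that
      by (intro exI[of _ "(dirderiv b (fst p), dirderiv b (snd p))"])
        (auto intro!: schwartz_dirderiv has_vector_derivative_add schwartz_has_dirderiv0)
  qed (use assms in simp)
  moreover have "F (f, g) = (\<lambda>x. f x + g x)" by (simp add: F_def fun_eq_iff)
  ultimately show ?thesis by simp
qed

lemma schwartz_cmult:
  assumes f: "schwartz f" shows "schwartz (\<lambda>x. c * f x)"
proof (rule schwartz_coinduct[where F="\<lambda>f x. c * f x"])
  fix f :: "'a \<Rightarrow> complex" assume f: "schwartz f"
  show "continuous_on UNIV (\<lambda>x. c * f x)" by (intro continuous_on_mult_left schwartz_continuous f)
  show "\<exists>C. \<forall>x. wt x ^ k * norm (c * f x) \<le> C" for k
  proof -
    obtain C where C: "\<And>x. wt x ^ k * norm (f x) \<le> C" by (metis schwartz_decay f)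
    have "wt x ^ k * norm (c * f x) \<le> norm c * C" for x
      using mult_left_mono[OF C[of x], of "norm c"] by (simp add: norm_mult mult_ac)
    then show ?thesis by blast
  qed
  show "\<exists>g. schwartz g \<and> (\<forall>x. ((\<lambda>t::real. c * f (x + t *\<^sub>R b)) has_vector_derivative c * g x) (at 0))" if "b \<in> Basis" for b
    using f that
    by (intro exI[of _ "dirderiv b f"]) (auto intro!: schwartz_dirderiv has_vector_derivative_mult_right schwartz_has_dirderiv0)
qed (rule f)

lemma schwartz_diff: "schwartz f \<Longrightarrow> schwartz g \<Longrightarrow> schwartz (\<lambda>x. f x - g x)"
  using schwartz_add[of f "\<lambda>x. (-1) * g x"] schwartz_cmult[of g "-1"] by simp

lemma schwartz_zero: "schwartz (\<lambda>x. 0)"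
  by (rule schwartz_coinduct[where Q="\<lambda>_::unit. True" and F="\<lambda>_ _. 0"]) auto

lemma schwartz_sum:
  "finite I \<Longrightarrow> (\<And>i. i \<in> I \<Longrightarrow> schwartz (f i)) \<Longrightarrow> schwartz (\<lambda>x. \<Sum>i\<in>I. f i x)"
  by (induction I rule: finite_induct) (auto simp: schwartz_zero intro!: schwartz_add)

lemma pderivs_translate: "pderivs bs (\<lambda>y. f (y + x)) = (\<lambda>y. pderivs bs f (y + x))"
  by (induction bs) (auto simp: dirderiv_def fun_eq_iff add_ac)

text \<open>Allows a weight at \<open>y\<close> to be moved to a translate of \<open>y\<close> at
  the price of a polynomial in the translation.\<close>

lemma weight_submult: "1 + norm (x + y) \<le> wt x * wt (y::'a::real_normed_vector)"
proof -
  have "norm (x + y) \<le> norm x + norm y" by (rule norm_triangle_ineq)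
  also have "\<dots> \<le> norm x + norm y + norm x * norm y" by simp
  finally show ?thesis by (simp add: algebra_simps)
qed

lemma weight_submult_power:
  "wt (x + y) ^ k \<le> wt x ^ k * wt (y::'a::real_normed_vector) ^ k"
  unfolding power_mult_distrib[symmetric] by (intro power_mono weight_submult) auto

lemma schwartz_translate:
  assumes f: "schwartz f" shows "schwartz (\<lambda>y. f (y + x))"
proof (rule schwartz_coinduct[where F="\<lambda>f y. f (y + x)"])
  fix f :: "'a \<Rightarrow> complex" assume f: "schwartz f"
  show "continuous_on UNIV (\<lambda>y. f (y + x))"
    by (intro continuous_on_compose2[OF schwartz_continuous[OF f]] continuous_intros) auto
  show "\<exists>C. \<forall>y. wt y ^ k * norm (f (y + x)) \<le> C" for k
  proof -
    obtain C where C: "\<And>x. wt x ^ k * norm (f x) \<le> C" by (metis schwartz_decay f)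
    have "wt y ^ k * norm (f (y + x)) \<le> wt x ^ k * C" for y
    proof -
      have "wt y ^ k * norm (f (y + x)) \<le> (wt (y + x) ^ k * wt (- x) ^ k) * norm (f (y + x))"
        using weight_submult_power[of "y + x" "-x" k] by (intro mult_right_mono) auto
      also have "\<dots> = wt x ^ k * (wt (y + x) ^ k * norm (f (y + x)))" by simp
      also have "\<dots> \<le> wt x ^ k * C" by (intro mult_left_mono C) auto
      finally show ?thesis .
    qed
    then show ?thesis by blast
  qed
  show "\<exists>g. schwartz g \<and> (\<forall>y. ((\<lambda>t::real. f (y + t *\<^sub>R b + x)) has_vector_derivative g (y + x)) (at 0))" if b: "b \<in> Basis" for b
  proof -
    have "((\<lambda>t. f (y + t *\<^sub>R b + x)) has_vector_derivative dirderiv b f (y + x)) (at 0)" for y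
      using schwartz_has_dirderiv0[OF f b, of "y + x"] by (simp add: add_ac)
    then show ?thesis using schwartz_dirderiv[OF f b] by blast
  qed
qed (rule f)

lemma pderivs_add:
  assumes "bs \<in> lists Basis" and f: "schwartz f" and g: "schwartz g"
  shows "pderivs bs (\<lambda>x. f x + g x) = (\<lambda>x. pderivs bs f x + pderivs bs g x)"
  using assms(1)
proof (induction bs)
  case (Cons b bs)
  then have "bs \<in> lists Basis" "b \<in> Basis" by auto
  with Cons show ?case
    by (auto intro!: dirderiv_eqI has_vector_derivative_add schwartz_has_dirderiv0 schwartz_pderivs f g)
qed simp

lemma pderivs_cmult:
  assumes "bs \<in> lists Basis" and f: "schwartz f"
  shows "pderivs bs (\<lambda>x. c * f x) = (\<lambda>x. c * pderivs bs f x)"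
  using assms(1)
proof (induction bs)
  case (Cons b bs)
  then have "bs \<in> lists Basis" "b \<in> Basis" by auto
  with Cons show ?case
    by (auto intro!: dirderiv_eqI has_vector_derivative_mult_right schwartz_has_dirderiv0 schwartz_pderivs f)
qed simp

lemma pderivs_diff:
  assumes "bs \<in> lists Basis" and f: "schwartz f" and g: "schwartz g"
  shows "pderivs bs (\<lambda>x. f x - g x) = (\<lambda>x. pderivs bs f x - pderivs bs g x)"
  using pderivs_add[OF assms(1) f schwartz_cmult[OF g, of "-1"]] pderivs_cmult[OF assms(1) g, of "-1"] by simp

section \<open>Integrals of families of Schwartz functions\<close>

text \<open>In quotient form a derivative is a limit along sequences, to which dominated convergence
  applies.\<close>

lemma has_vector_derivative_iff_quotient:
  fixes f :: "real \<Rightarrow> 'b::real_normed_vector"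
  shows "(f has_vector_derivative D) (at 0) \<longleftrightarrow> ((\<lambda>t. (f t - f 0) /\<^sub>R t) \<longlongrightarrow> D) (at 0)"
proof -
  have eq: "norm (f t - f 0 - t *\<^sub>R D) / \<bar>t\<bar> = norm ((f t - f 0) /\<^sub>R t - D)" if "t \<noteq> 0" for t
  proof -
    have "(f t - f 0) /\<^sub>R t - D = (f t - f 0 - t *\<^sub>R D) /\<^sub>R t" using that by (simp add: scaleR_diff_right)
    then show ?thesis by (simp add: divide_inverse mult.commute)
  qed
  have "(f has_vector_derivative D) (at 0) \<longleftrightarrow> ((\<lambda>t. norm (f t - f 0 - t *\<^sub>R D) / \<bar>t\<bar>) \<longlongrightarrow> 0) (at 0)"
    unfolding has_vector_derivative_def has_derivative_iff_norm
    by (simp add: bounded_linear_scaleR_left)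
  also have "\<dots> \<longleftrightarrow> ((\<lambda>t. norm ((f t - f 0) /\<^sub>R t - D)) \<longlongrightarrow> 0) (at 0)"
    by (rule Lim_cong_within) (auto simp: eq)
  also have "\<dots> \<longleftrightarrow> ((\<lambda>t. (f t - f 0) /\<^sub>R t) \<longlongrightarrow> D) (at 0)"
    by (simp only: tendsto_norm_zero_iff LIM_zero_iff)
  finally show ?thesis .
qed

lemma vector_derivative_bound:
  fixes f :: "real \<Rightarrow> 'b::real_normed_vector"
  assumes d: "\<And>t. (f has_vector_derivative f' t) (at t)" and B: "\<And>t. \<bar>t\<bar> \<le> \<bar>r\<bar> \<Longrightarrow> norm (f' t) \<le> B"
  shows "norm (f r - f 0) \<le> B * \<bar>r\<bar>"
proof -
  have "norm (f r - f 0) \<le> B * norm (r - 0)"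
  proof (rule differentiable_bound[of "cball 0 \<bar>r\<bar>"])
    show "(f has_derivative (\<lambda>h. h *\<^sub>R f' t)) (at t within cball 0 \<bar>r\<bar>)" for t
      using d has_vector_derivative_at_within unfolding has_vector_derivative_def by blast
    show "onorm (\<lambda>h. h *\<^sub>R f' t) \<le> B" if "t \<in> cball 0 \<bar>r\<bar>" for t
      using B[of t] that by (simp add: onorm_scaleR_left onorm_id[where 'a=real])
  qed auto
  then show ?thesis by simp
qed

text \<open>These are the hypotheses for differentiating under the integral sign, imposed on all
  derivatives and all weights at once. This makes the notion stable under derivatives, as
  \<open>schwartz_coinduct\<close> requires.\<close>

definition integrable_family :: "'c measure \<Rightarrow> ('c \<Rightarrow> 'a::euclidean_space \<Rightarrow> complex) \<Rightarrow> bool" where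
  "integrable_family M G \<longleftrightarrow> (\<forall>z. schwartz (G z)) \<and>
    (\<forall>bs\<in>lists Basis. (\<forall>y. (\<lambda>z. pderivs bs (G z) y) \<in> borel_measurable M) \<and>
      (\<forall>k. \<exists>H. integrable M H \<and> (\<forall>z y. wt y ^ k * norm (pderivs bs (G z) y) \<le> H z)))"

lemma integrable_familyD:
  assumes "integrable_family M G"
  shows "schwartz (G z)" "(\<lambda>z. G z y) \<in> borel_measurable M"
    "\<exists>H. integrable M H \<and> (\<forall>z y. wt y ^ k * norm (G z y) \<le> H z)"
    "integrable M (\<lambda>z. G z y)"
proof -
  show "schwartz (G z)" using assms unfolding integrable_family_def by blast
  have *: "(\<forall>y. (\<lambda>z. pderivs [] (G z) y) \<in> borel_measurable M) \<and>
      (\<forall>k. \<exists>H. integrable M H \<and> (\<forall>z y. wt y ^ k * norm (pderivs [] (G z) y) \<le> H z))"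
    using assms unfolding integrable_family_def by blast
  then show m: "(\<lambda>z. G z y) \<in> borel_measurable M"
    and "\<exists>H. integrable M H \<and> (\<forall>z y. wt y ^ k * norm (G z y) \<le> H z)" by simp_all
  from * obtain H where "integrable M H" "\<And>z y. wt y ^ 0 * norm (G z y) \<le> H z"
    unfolding pderivs.simps by blast
  then show "integrable M (\<lambda>z. G z y)"
    by (intro Bochner_Integration.integrable_bound[OF _ m, of H]) (auto intro!: AE_I2 order_trans[OF _ abs_ge_self])
qed

lemma integrable_family_pderivs:
  assumes I: "integrable_family M G" and cs: "cs \<in> lists Basis"
  shows "integrable_family M (\<lambda>z. pderivs cs (G z))"
proof -
  have "bs @ cs \<in> lists Basis" if "bs \<in> lists Basis" for bs using that cs by simp
  then show ?thesis
    using I schwartz_pderivs[OF _ cs] unfolding integrable_family_def pderivs_append[symmetric] by blast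
qed

lemma integrable_family_dirderiv:
  assumes "integrable_family M G" "b \<in> Basis"
  shows "integrable_family M (\<lambda>z. dirderiv b (G z))"
  using integrable_family_pderivs[of M G "[b]"] assms by simp

lemma integral_family_continuous:
  assumes I: "integrable_family M G"
  shows "continuous_on UNIV (\<lambda>y. \<integral>z. G z y \<partial>M)"
proof -
  obtain H where H: "integrable M H" "\<And>z y. wt y ^ 0 * norm (G z y) \<le> H z"
    using integrable_familyD(3)[OF I] by blast
  have "isCont (\<lambda>y. \<integral>z. G z y \<partial>M) a" for a
  proof (rule continuous_at_sequentiallyI)
    fix u assume u: "u \<longlonglongrightarrow> a"
    show "(\<lambda>n. \<integral>z. G z (u n) \<partial>M) \<longlonglongrightarrow> (\<integral>z. G z a \<partial>M)"
    proof (rule integral_dominated_convergence[where w=H])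
      show "AE z in M. (\<lambda>n. G z (u n)) \<longlonglongrightarrow> G z a"
        using schwartz_continuous[OF integrable_familyD(1)[OF I]] u
        by (auto intro!: AE_I2 simp: continuous_on_eq_continuous_at isCont_tendsto_compose)
    qed (use H integrable_familyD(2)[OF I] in auto)
  qed
  then show ?thesis by (simp add: continuous_on_eq_continuous_at)
qed

lemma integral_family_decay:
  fixes G :: "'c \<Rightarrow> 'a::real_normed_vector \<Rightarrow> complex"
  assumes H: "integrable M H" and bd: "\<And>z y. wt y ^ k * norm (G z y) \<le> H z"
    and i: "integrable M (\<lambda>z. G z y)"
  shows "wt y ^ k * norm (\<integral>z. G z y \<partial>M) \<le> (\<integral>z. H z \<partial>M)"
proof -
  have "wt y ^ k * norm (\<integral>z. G z y \<partial>M) \<le> wt y ^ k * (\<integral>z. norm (G z y) \<partial>M)"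
    by (intro mult_left_mono integral_norm_bound) auto
  also have "\<dots> = (\<integral>z. wt y ^ k * norm (G z y) \<partial>M)" by simp
  also have "\<dots> \<le> (\<integral>z. H z \<partial>M)" using H i bd by (intro integral_mono) auto
  finally show ?thesis .
qed

text \<open>The mean value inequality bounds the difference quotients by the same integrable
  \<open>H\<close> that dominates the derivative, so dominated convergence applies.\<close>

lemma integral_family_has_dirderiv:
  assumes I: "integrable_family M G" and b: "b \<in> Basis"
  shows "((\<lambda>t::real. \<integral>z. G z (x + t *\<^sub>R b) \<partial>M) has_vector_derivative (\<integral>z. dirderiv b (G z) x \<partial>M)) (at 0)"
  unfolding has_vector_derivative_iff_quotient tendsto_at_iff_sequentially
proof (intro allI impI)
  fix X :: "nat \<Rightarrow> real" assume X: "\<forall>i. X i \<in> UNIV - {0}" and lim: "X \<longlonglongrightarrow> 0"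
  note S = integrable_familyD(1)[OF I]
  note D = integrable_family_dirderiv[OF I b]
  obtain H where H: "integrable M H" "\<And>z y. wt y ^ 0 * norm (dirderiv b (G z) y) \<le> H z"
    using integrable_familyD(3)[OF D] by blast
  have meas: "(\<lambda>z. G z y) \<in> borel_measurable M" for y by (rule integrable_familyD(2)[OF I])
  have int: "integrable M (\<lambda>z. G z y)" for y by (rule integrable_familyD(4)[OF I])
  have "(\<lambda>n. \<integral>z. (G z (x + X n *\<^sub>R b) - G z x) /\<^sub>R X n \<partial>M) \<longlonglongrightarrow> (\<integral>z. dirderiv b (G z) x \<partial>M)"
  proof (rule integral_dominated_convergence[where w=H])
    show "(\<lambda>z. dirderiv b (G z) x) \<in> borel_measurable M" by (rule integrable_familyD(2)[OF D])
    show "(\<lambda>z. (G z (x + X n *\<^sub>R b) - G z x) /\<^sub>R X n) \<in> borel_measurable M" for n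
      using meas by measurable
    show "AE z in M. (\<lambda>n. (G z (x + X n *\<^sub>R b) - G z x) /\<^sub>R X n) \<longlonglongrightarrow> dirderiv b (G z) x"
    proof (rule AE_I2)
      fix z
      have "((\<lambda>t. (G z (x + t *\<^sub>R b) - G z (x + 0 *\<^sub>R b)) /\<^sub>R t) \<longlongrightarrow> dirderiv b (G z) x) (at 0)"
        using schwartz_has_dirderiv0[OF S b, of z x] unfolding has_vector_derivative_iff_quotient .
      then show "(\<lambda>n. (G z (x + X n *\<^sub>R b) - G z x) /\<^sub>R X n) \<longlonglongrightarrow> dirderiv b (G z) x"
        unfolding tendsto_at_iff_sequentially using X lim by (auto simp: o_def)
    qed
    show "AE z in M. norm ((G z (x + X n *\<^sub>R b) - G z x) /\<^sub>R X n) \<le> H z" for n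
    proof (rule AE_I2)
      fix z
      have "norm (G z (x + X n *\<^sub>R b) - G z (x + 0 *\<^sub>R b)) \<le> H z * \<bar>X n\<bar>"
        by (rule vector_derivative_bound[OF has_dirderiv_shift[OF schwartz_has_dirderiv0[OF S b]]])
          (use H(2) in simp)
      moreover have "X n \<noteq> 0" using X by simp
      ultimately show "norm ((G z (x + X n *\<^sub>R b) - G z x) /\<^sub>R X n) \<le> H z"
        by (simp add: divide_inverse[symmetric] mult.commute[of "inverse _"] pos_divide_le_eq)
    qed
  qed (rule H(1))
  moreover have "(\<integral>z. (G z (x + X n *\<^sub>R b) - G z x) /\<^sub>R X n \<partial>M) =
      ((\<integral>z. G z (x + X n *\<^sub>R b) \<partial>M) - (\<integral>z. G z x \<partial>M)) /\<^sub>R X n" for n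
    using int by simp
  ultimately have "(\<lambda>n. ((\<integral>z. G z (x + X n *\<^sub>R b) \<partial>M) - (\<integral>z. G z x \<partial>M)) /\<^sub>R X n)
      \<longlonglongrightarrow> (\<integral>z. dirderiv b (G z) x \<partial>M)" by (simp only:)
  then show "((\<lambda>t. ((\<integral>z. G z (x + t *\<^sub>R b) \<partial>M) - (\<integral>z. G z (x + 0 *\<^sub>R b) \<partial>M)) /\<^sub>R t) \<circ> X)
      \<longlonglongrightarrow> (\<integral>z. dirderiv b (G z) x \<partial>M)" by (simp add: o_def)
qed

lemma schwartz_integral_family:
  fixes G :: "'c \<Rightarrow> 'a::euclidean_space \<Rightarrow> complex"
  assumes I: "integrable_family M G"
  shows "schwartz (\<lambda>y. \<integral>z. G z y \<partial>M)"
proof (rule schwartz_coinduct[where F="\<lambda>G y. \<integral>z. G z y \<partial>M"])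
  fix G :: "'c \<Rightarrow> 'a \<Rightarrow> complex" assume I: "integrable_family M G"
  show "continuous_on UNIV (\<lambda>y. \<integral>z. G z y \<partial>M)" by (rule integral_family_continuous[OF I])
  show "\<exists>C. \<forall>y. wt y ^ k * norm (\<integral>z. G z y \<partial>M) \<le> C" for k
  proof -
    obtain H where "integrable M H" "\<And>z y. wt y ^ k * norm (G z y) \<le> H z"
      using integrable_familyD(3)[OF I] by blast
    then show ?thesis using integral_family_decay integrable_familyD(4)[OF I] by blast
  qed
  show "\<exists>G'. integrable_family M G' \<and>
      (\<forall>x. ((\<lambda>t::real. \<integral>z. G z (x + t *\<^sub>R b) \<partial>M) has_vector_derivative (\<integral>z. G' z x \<partial>M)) (at 0))" if b: "b \<in> Basis" for b
    by (intro exI[of _ "\<lambda>z. dirderiv b (G z)"] conjI allI integrable_family_dirderiv[OF I b]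
        integral_family_has_dirderiv[OF I b])
qed (rule I)

lemma pderivs_integral_family:
  assumes I: "integrable_family M G" and bs: "bs \<in> lists Basis"
  shows "pderivs bs (\<lambda>y. \<integral>z. G z y \<partial>M) = (\<lambda>y. \<integral>z. pderivs bs (G z) y \<partial>M)"
  using bs
proof (induction bs)
  case (Cons b bs)
  then have bs: "bs \<in> lists Basis" and b: "b \<in> Basis" by auto
  have "pderivs (b # bs) (\<lambda>y. \<integral>z. G z y \<partial>M) = dirderiv b (\<lambda>y. \<integral>z. pderivs bs (G z) y \<partial>M)"
    using Cons.IH bs by simp
  also have "\<dots> = (\<lambda>y. \<integral>z. dirderiv b (pderivs bs (G z)) y \<partial>M)"
    by (rule dirderiv_eqI) (rule integral_family_has_dirderiv[OF integrable_family_pderivs[OF I bs] b])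
  finally show ?case by simp
qed simp

section \<open>Tempered distributions: linearity, seminorm bounds, sequential continuity\<close>

lemma schwartz_seminorm_le:
  assumes "\<And>y. wt y ^ k * norm (pderivs bs f y) \<le> C"
  shows "schwartz_seminorm k bs f \<le> C"
  unfolding schwartz_seminorm_def using assms by (intro cSUP_least) auto

lemma schwartz_seminorm_nonneg:
  assumes "schwartz f" "bs \<in> lists Basis"
  shows "0 \<le> schwartz_seminorm k bs f"
proof -
  have "bdd_above (range (\<lambda>x. wt x ^ k * norm (pderivs bs f x)))"
    using assms unfolding schwartz_def by (intro bounded_imp_bdd_above) blast
  then show ?thesis unfolding schwartz_seminorm_def
    by (rule cSUP_upper2[of _ _ 0]) auto
qed

lemma tempered_add: "tempered T \<Longrightarrow> schwartz f \<Longrightarrow> schwartz g \<Longrightarrow> T (\<lambda>x. f x + g x) = T f + T g"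
  and tempered_cmult: "tempered T \<Longrightarrow> schwartz f \<Longrightarrow> T (\<lambda>x. c * f x) = c * T f"
  and tempered_outside: "tempered T \<Longrightarrow> \<not> schwartz f \<Longrightarrow> T f = 0"
  unfolding tempered_def by blast+

lemma tempered_zero: "tempered T \<Longrightarrow> T (\<lambda>x. 0) = 0"
  using tempered_cmult[of T "\<lambda>x. 0" 0] schwartz_zero by simp

lemma tempered_diff:
  assumes "tempered T" "schwartz f" "schwartz g"
  shows "T (\<lambda>x. f x - g x) = T f - T g"
  using tempered_add[OF assms(1,2) schwartz_cmult[OF assms(3), of "-1"]]
    tempered_cmult[OF assms(1,3), of "-1"] by simp

lemma tempered_sum:
  assumes T: "tempered T" and "finite I" "\<And>i. i \<in> I \<Longrightarrow> schwartz (f i)"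
  shows "T (\<lambda>x. \<Sum>i\<in>I. f i x) = (\<Sum>i\<in>I. T (f i))"
  using assms(2,3)
  by (induction I rule: finite_induct) (auto simp: tempered_zero[OF T] tempered_add[OF T] schwartz_sum)

lemma finite_multiindices: "finite {bs. set bs \<subseteq> (Basis::'a::euclidean_space set) \<and> length bs \<le> M}"
  by (rule finite_lists_length_le) simp

lemma tempered_bound:
  assumes "tempered T"
  obtains C M where "C \<ge> 0" "\<And>f. schwartz f \<Longrightarrow> norm (T f) \<le>
    C * (\<Sum>k\<le>M. \<Sum>bs\<in>{bs. set bs \<subseteq> Basis \<and> length bs \<le> M}. schwartz_seminorm k bs f)"
proof -
  obtain C M where C: "\<And>f. schwartz f \<Longrightarrow> norm (T f) \<le>
    C * (\<Sum>k\<le>M. \<Sum>bs\<in>{bs. set bs \<subseteq> Basis \<and> length bs \<le> M}. schwartz_seminorm k bs f)"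
    using assms unfolding tempered_def by blast
  show ?thesis
  proof (rule that[of "\<bar>C\<bar>" M])
    fix f :: "'a \<Rightarrow> complex" assume f: "schwartz f"
    have "0 \<le> (\<Sum>k\<le>M. \<Sum>bs\<in>{bs. set bs \<subseteq> Basis \<and> length bs \<le> M}. schwartz_seminorm k bs f)"
      by (intro sum_nonneg schwartz_seminorm_nonneg[OF f]) auto
    then show "norm (T f) \<le> \<bar>C\<bar> * (\<Sum>k\<le>M. \<Sum>bs\<in>{bs. set bs \<subseteq> Basis \<and> length bs \<le> M}. schwartz_seminorm k bs f)"
      by (intro order_trans[OF C[OF f]] mult_right_mono) auto
  qed simp
qed

text \<open>Finitely many seminorms control \<open>T\<close>, so convergence may be checked for each
  \<open>k\<close> and \<open>bs\<close> separately, without uniformity.\<close>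

lemma tempered_tendsto:
  assumes T: "tempered T" and f: "schwartz f" and u: "\<And>n. schwartz (u n)"
    and bd: "\<And>k bs n y. bs \<in> lists Basis \<Longrightarrow> wt y ^ k * norm (pderivs bs (u n) y - pderivs bs f y) \<le> e k bs n"
    and e: "\<And>k bs. bs \<in> lists Basis \<Longrightarrow> (\<lambda>n. e k bs n) \<longlonglongrightarrow> 0"
  shows "(\<lambda>n. T (u n)) \<longlonglongrightarrow> T f"
proof -
  obtain C M where C: "C \<ge> 0" "\<And>f. schwartz f \<Longrightarrow> norm (T f) \<le>
    C * (\<Sum>k\<le>M. \<Sum>bs\<in>{bs. set bs \<subseteq> Basis \<and> length bs \<le> M}. schwartz_seminorm k bs f)"
    using tempered_bound[OF T] by blast
  have "(\<lambda>n. T (u n) - T f) \<longlonglongrightarrow> 0"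
  proof (rule Lim_null_comparison[where g="\<lambda>n. C * (\<Sum>k\<le>M. \<Sum>bs\<in>{bs. set bs \<subseteq> Basis \<and> length bs \<le> M}. e k bs n)"],
      intro always_eventually allI)
    fix n
    have "norm (T (u n) - T f) = norm (T (\<lambda>x. u n x - f x))" by (simp add: tempered_diff[OF T u f])
    also have "\<dots> \<le> C * (\<Sum>k\<le>M. \<Sum>bs\<in>{bs. set bs \<subseteq> Basis \<and> length bs \<le> M}. schwartz_seminorm k bs (\<lambda>x. u n x - f x))"
      by (intro C schwartz_diff u f)
    also have "\<dots> \<le> C * (\<Sum>k\<le>M. \<Sum>bs\<in>{bs. set bs \<subseteq> Basis \<and> length bs \<le> M}. e k bs n)"
    proof (intro mult_left_mono sum_mono C)
      fix k bs assume "bs \<in> {bs. set bs \<subseteq> (Basis::'a set) \<and> length bs \<le> M}"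
      then have bs: "bs \<in> lists Basis" by auto
      show "schwartz_seminorm k bs (\<lambda>x. u n x - f x) \<le> e k bs n"
        by (rule schwartz_seminorm_le) (simp add: pderivs_diff[OF bs u f] bd[OF bs])
    qed
    finally show "norm (T (u n) - T f) \<le> C * (\<Sum>k\<le>M. \<Sum>bs\<in>{bs. set bs \<subseteq> Basis \<and> length bs \<le> M}. e k bs n)" .
  next
    have "(\<lambda>n. C * (\<Sum>k\<le>M. \<Sum>bs\<in>{bs. set bs \<subseteq> (Basis::'a set) \<and> length bs \<le> M}. e k bs n))
      \<longlonglongrightarrow> C * (\<Sum>k\<le>M. \<Sum>bs\<in>{bs. set bs \<subseteq> (Basis::'a set) \<and> length bs \<le> M}. 0)"
      by (intro tendsto_intros e) auto
    then show "(\<lambda>n. C * (\<Sum>k\<le>M. \<Sum>bs\<in>{bs. set bs \<subseteq> (Basis::'a set) \<and> length bs \<le> M}. e k bs n)) \<longlonglongrightarrow> 0" by simp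
  qed
  then show ?thesis by (rule LIM_zero_cancel)
qed

text \<open>Applying the hypothesis to \<open>\<i>\<close> times \<open>\<phi>\<close> also gives
  the imaginary parts. This is what makes the real form \<open>R\<close> sufficient.\<close>

lemma tempered_eq_of_Re_eq:
  fixes S T :: "('a::euclidean_space \<Rightarrow> complex) \<Rightarrow> complex"
  assumes S: "tempered S" and T: "tempered T" and eq: "\<And>\<phi>. schwartz \<phi> \<Longrightarrow> Re (S \<phi>) = Re (T \<phi>)"
  shows "S = T"
proof
  fix \<phi> :: "'a \<Rightarrow> complex"
  show "S \<phi> = T \<phi>"
  proof (cases "schwartz \<phi>")
    case True
    then show ?thesis
      using eq[OF True] eq[OF schwartz_cmult[OF True, of \<i>]] tempered_cmult[OF S True, of \<i>] tempered_cmult[OF T True, of \<i>]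
      by (simp add: complex_eq_iff)
  qed (simp add: tempered_outside[OF S] tempered_outside[OF T])
qed

section \<open>Superpositions of test functions with polynomial dependence on a parameter\<close>

text \<open>Polynomial growth in \<open>z\<close> makes integrals against a rapid weight converge in
  every seminorm; the Lipschitz bound with polynomial constants controls the replacement of
  \<open>z\<close> by a simple function.\<close>

definition tame :: "('b::euclidean_space \<Rightarrow> 'a::euclidean_space \<Rightarrow> complex) \<Rightarrow> bool" where
  "tame F \<longleftrightarrow> (\<forall>k. \<exists>C K. C \<ge> 0 \<and> (\<forall>z y. wt y ^ k * norm (F z y) \<le> C * wt z ^ K) \<and>
     (\<forall>z v y. wt y ^ k * norm (F z y - F v y) \<le> C * norm (z - v) * (1 + norm z + norm v) ^ K))"

definition schwartz_family :: "('b::euclidean_space \<Rightarrow> 'a::euclidean_space \<Rightarrow> complex) \<Rightarrow> bool" where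
  "schwartz_family F \<longleftrightarrow> (\<forall>z. schwartz (F z)) \<and> (\<forall>bs\<in>lists Basis. tame (\<lambda>z. pderivs bs (F z)))"

definition rapid :: "('b::euclidean_space \<Rightarrow> complex) \<Rightarrow> bool" where
  "rapid w \<longleftrightarrow> w \<in> borel_measurable borel \<and> (\<forall>K. integrable lborel (\<lambda>z. wt z ^ K * norm (w z)))"

lemma rapid_integrable: "rapid w \<Longrightarrow> integrable lborel w"
proof -
  assume w: "rapid w"
  then have "integrable lborel (\<lambda>z. wt z ^ 0 * norm (w z))" unfolding rapid_def by blast
  then show ?thesis using w by (simp add: rapid_def integrable_norm_iff)
qed

lemma tame_continuous:
  assumes "tame F" shows "continuous_on UNIV (\<lambda>z. F z y)"
proof -
  obtain C K where C: "C \<ge> 0" "\<And>z v y. wt y ^ 0 * norm (F z y - F v y) \<le> C * norm (z - v) * (1 + norm z + norm v) ^ K"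
    using assms unfolding tame_def by blast
  have "isCont (\<lambda>z. F z y) a" for a
  proof (rule continuous_at_sequentiallyI)
    fix u assume u: "u \<longlonglongrightarrow> a"
    have "(\<lambda>n. F (u n) y - F a y) \<longlonglongrightarrow> 0"
    proof (rule Lim_null_comparison)
      show "\<forall>\<^sub>F n in sequentially. norm (F (u n) y - F a y) \<le> C * norm (u n - a) * (1 + norm (u n) + norm a) ^ K"
        using C(2)[of y "u _" a] by simp
      have "(\<lambda>n. C * norm (u n - a) * (1 + norm (u n) + norm a) ^ K) \<longlonglongrightarrow> C * norm (a - a) * (1 + norm a + norm a) ^ K"
        by (intro tendsto_intros u)
      then show "(\<lambda>n. C * norm (u n - a) * (1 + norm (u n) + norm a) ^ K) \<longlonglongrightarrow> 0" by simp
    qed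
    then show "(\<lambda>n. F (u n) y) \<longlonglongrightarrow> F a y" by (rule LIM_zero_cancel)
  qed
  then show ?thesis by (simp add: continuous_on_eq_continuous_at)
qed

text \<open>The map \<open>s\<close> is meant to be either the identity or a simple approximation of
  it; the bound by \<open>2 * norm z\<close> preserves the polynomial domination up to the factor
  \<open>2 ^ K\<close>.\<close>

lemma integrable_family_weighted:
  fixes F :: "'b::euclidean_space \<Rightarrow> 'a::euclidean_space \<Rightarrow> complex"
  assumes w: "rapid w" and F: "schwartz_family F"
    and s: "s \<in> borel_measurable borel" and sb: "\<And>z. norm (s z) \<le> 2 * norm z"
  shows "integrable_family lborel (\<lambda>z y. w z * F (s z) y)"
proof -
  have S: "schwartz (F z)" for z using F unfolding schwartz_family_def by blast
  have wm: "w \<in> borel_measurable borel" using w by (simp add: rapid_def)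
  show ?thesis unfolding integrable_family_def
  proof (intro conjI allI ballI)
    show "schwartz (\<lambda>y. w z * F (s z) y)" for z by (intro schwartz_cmult S)
  next
    fix bs :: "'a list" and y assume bs: "bs \<in> lists Basis"
    then have t: "tame (\<lambda>z. pderivs bs (F z))" using F unfolding schwartz_family_def by blast
    have "(\<lambda>z. pderivs bs (F z) y) \<in> borel_measurable borel"
      by (intro borel_measurable_continuous_onI tame_continuous[OF t])
    from measurable_compose[OF s this] wm
    show "(\<lambda>z. pderivs bs (\<lambda>y. w z * F (s z) y) y) \<in> borel_measurable lborel"
      unfolding pderivs_cmult[OF bs S] by simp
  next
    fix bs :: "'a list" and k assume bs: "bs \<in> lists Basis"
    then have t: "tame (\<lambda>z. pderivs bs (F z))" using F unfolding schwartz_family_def by blast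
    then obtain C K where C: "C \<ge> 0" "\<And>z y. wt y ^ k * norm (pderivs bs (F z) y) \<le> C * wt z ^ K"
      unfolding tame_def by blast
    have "wt y ^ k * norm (w z * pderivs bs (F (s z)) y) \<le> (C * 2 ^ K) * (wt z ^ K * norm (w z))" for z y
    proof -
      have "wt y ^ k * norm (w z * pderivs bs (F (s z)) y)
          = norm (w z) * (wt y ^ k * norm (pderivs bs (F (s z)) y))" by (simp add: norm_mult)
      also have "\<dots> \<le> norm (w z) * (C * wt (s z) ^ K)" by (intro mult_left_mono C) auto
      also have "\<dots> \<le> norm (w z) * (C * (2 * wt z) ^ K)"
        using sb[of z] C(1) by (intro mult_left_mono power_mono) auto
      finally show ?thesis unfolding power_mult_distrib by (simp add: mult_ac)
    qed
    moreover have "integrable lborel (\<lambda>z. (C * 2 ^ K) * (wt z ^ K * norm (w z)))"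
      using w unfolding rapid_def by (intro integrable_mult_right) auto
    ultimately show "\<exists>H. integrable lborel H \<and> (\<forall>z y. wt y ^ k * norm (pderivs bs (\<lambda>y. w z * F (s z) y) y) \<le> H z)"
      unfolding pderivs_cmult[OF bs S] by blast
  qed
qed

lemma schwartz_family_integral:
  fixes F :: "'b::euclidean_space \<Rightarrow> 'a::euclidean_space \<Rightarrow> complex"
  assumes w: "rapid w" and F: "schwartz_family F"
  shows "schwartz (\<lambda>y. \<integral>z. w z * F z y \<partial>lborel)"
  by (intro schwartz_integral_family integrable_family_weighted[OF w F, where s="\<lambda>z. z"]) auto

lemma tempered_family_continuous:
  fixes F :: "'b::euclidean_space \<Rightarrow> 'a::euclidean_space \<Rightarrow> complex"
  assumes T: "tempered T" and F: "schwartz_family F"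
  shows "continuous_on UNIV (\<lambda>z. T (F z))"
proof -
  have S: "schwartz (F z)" for z using F unfolding schwartz_family_def by blast
  have "\<forall>k. \<forall>bs\<in>lists Basis. \<exists>C K. \<forall>z v y. wt y ^ k * norm (pderivs bs (F z) y - pderivs bs (F v) y)
      \<le> C * norm (z - v) * (1 + norm z + norm v) ^ K"
    using F unfolding schwartz_family_def tame_def by meson
  then obtain C K where C: "\<And>k bs z v y. bs \<in> lists Basis \<Longrightarrow> wt y ^ k * norm (pderivs bs (F z) y - pderivs bs (F v) y)
      \<le> C k bs * norm (z - v) * (1 + norm z + norm v) ^ K k bs"
    by metis
  have "isCont (\<lambda>z. T (F z)) a" for a
  proof (rule continuous_at_sequentiallyI)
    fix u assume u: "u \<longlonglongrightarrow> a"
    show "(\<lambda>n. T (F (u n))) \<longlonglongrightarrow> T (F a)"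
    proof (rule tempered_tendsto[OF T S S])
      show "wt y ^ k * norm (pderivs bs (F (u n)) y - pderivs bs (F a) y)
        \<le> C k bs * norm (u n - a) * (1 + norm (u n) + norm a) ^ K k bs" if "bs \<in> lists Basis" for k bs n y
        by (rule C[OF that])
      have "(\<lambda>n. C k bs * norm (u n - a) * (1 + norm (u n) + norm a) ^ K k bs)
          \<longlonglongrightarrow> C k bs * norm (a - a) * (1 + norm a + norm a) ^ K k bs" for k bs
        by (intro tendsto_intros u)
      then show "(\<lambda>n. C k bs * norm (u n - a) * (1 + norm (u n) + norm a) ^ K k bs) \<longlonglongrightarrow> 0" for k bs by simp
    qed
  qed
  then show ?thesis by (simp add: continuous_on_eq_continuous_at)
qed

lemma tempered_family_growth:
  fixes F :: "'b::euclidean_space \<Rightarrow> 'a::euclidean_space \<Rightarrow> complex"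
  assumes T: "tempered T" and F: "schwartz_family F"
  obtains C K where "C \<ge> 0" "\<And>z. norm (T (F z)) \<le> C * wt z ^ K"
proof -
  have S: "schwartz (F z)" for z using F unfolding schwartz_family_def by blast
  have "\<forall>k. \<forall>bs\<in>lists Basis. \<exists>C K. C \<ge> 0 \<and> (\<forall>z y. wt y ^ k * norm (pderivs bs (F z) y) \<le> C * wt z ^ K)"
    using F unfolding schwartz_family_def tame_def by meson
  then obtain C K where C0: "\<And>k bs. bs \<in> lists Basis \<Longrightarrow> C k bs \<ge> 0"
    and C: "\<And>k bs z y. bs \<in> lists Basis \<Longrightarrow> wt y ^ k * norm (pderivs bs (F z) y) \<le> C k bs * wt z ^ K k bs"
    by metis
  obtain D M where D: "D \<ge> 0" "\<And>f. schwartz f \<Longrightarrow> norm (T f) \<le>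
    D * (\<Sum>k\<le>M. \<Sum>bs\<in>{bs. set bs \<subseteq> Basis \<and> length bs \<le> M}. schwartz_seminorm k bs f)"
    using tempered_bound[OF T] by blast
  let ?B = "{bs. set bs \<subseteq> (Basis::'a set) \<and> length bs \<le> M}"
  \<comment> \<open>The sum of all exponents is a crude common bound for the finitely many of
    them.\<close>
  define L where "L = (\<Sum>k\<le>M. \<Sum>bs\<in>?B. K k bs)"
  have K_le: "K k bs \<le> L" if "k \<le> M" "bs \<in> ?B" for k bs
  proof -
    have "K k bs \<le> (\<Sum>bs\<in>?B. K k bs)" using that finite_multiindices by (intro member_le_sum) auto
    also have "\<dots> \<le> L" unfolding L_def using that by (intro member_le_sum[of k "{..M}" "\<lambda>k. \<Sum>bs\<in>?B. K k bs"]) auto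
    finally show ?thesis .
  qed
  show ?thesis
  proof (rule that[of "D * (\<Sum>k\<le>M. \<Sum>bs\<in>?B. C k bs)" L])
    show "0 \<le> D * (\<Sum>k\<le>M. \<Sum>bs\<in>?B. C k bs)" using D(1) C0 by (intro mult_nonneg_nonneg sum_nonneg) auto
    fix z
    have "norm (T (F z)) \<le> D * (\<Sum>k\<le>M. \<Sum>bs\<in>?B. schwartz_seminorm k bs (F z))" by (intro D S)
    also have "\<dots> \<le> D * (\<Sum>k\<le>M. \<Sum>bs\<in>?B. C k bs * wt z ^ L)"
    proof (intro mult_left_mono sum_mono D)
      fix k bs assume k: "k \<in> {..M}" and b: "bs \<in> ?B"
      then have bs: "bs \<in> lists Basis" by auto
      have "schwartz_seminorm k bs (F z) \<le> C k bs * wt z ^ K k bs"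
        by (rule schwartz_seminorm_le) (rule C[OF bs])
      also have "\<dots> \<le> C k bs * wt z ^ L"
        using K_le[of k bs] k b C0[OF bs] by (intro mult_left_mono power_increasing) auto
      finally show "schwartz_seminorm k bs (F z) \<le> C k bs * wt z ^ L" .
    qed
    finally show "norm (T (F z)) \<le> D * (\<Sum>k\<le>M. \<Sum>bs\<in>?B. C k bs) * wt z ^ L"
      by (simp add: sum_distrib_right mult.assoc)
  qed
qed

lemma rapid_mult_integrable:
  assumes w: "rapid w" and m: "g \<in> borel_measurable borel" and g: "\<And>z. norm (g z) \<le> C * wt z ^ K"
  shows "integrable lborel (\<lambda>z. w z * g z)"
proof (rule Bochner_Integration.integrable_bound)
  show "integrable lborel (\<lambda>z. C * (wt z ^ K * norm (w z)))"
    using w unfolding rapid_def by (intro integrable_mult_right) auto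
  show "(\<lambda>z. w z * g z) \<in> borel_measurable lborel" using w m unfolding rapid_def by (auto intro!: borel_measurable_times)
  show "AE z in lborel. norm (w z * g z) \<le> norm (C * (wt z ^ K * norm (w z)))"
  proof (rule AE_I2)
    fix z
    have "norm (w z * g z) \<le> norm (w z) * (C * wt z ^ K)"
      unfolding norm_mult by (intro mult_left_mono g) auto
    then show "norm (w z * g z) \<le> norm (C * (wt z ^ K * norm (w z)))" by (simp add: mult_ac)
  qed
qed

lemma integral_simple_weight:
  fixes w g :: "_ \<Rightarrow> complex"
  assumes w: "integrable M w" and s: "simple_function M s" and sp: "space M = UNIV"
  shows "(\<integral>z. w z * g (s z) \<partial>M) = (\<Sum>v\<in>range s. (\<integral>z. indicator (s -` {v}) z * w z \<partial>M) * g v)"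
proof -
  have fin: "finite (range s)" using s sp by (simp add: simple_function_def)
  have m: "s -` {v} \<in> sets M" for v
    using simple_functionD(2)[OF s, of "{v}"] sp by simp
  have i: "integrable M (\<lambda>z. indicator (s -` {v}) z * w z)" for v
    using integrable_mult_indicator[OF m[of v] w] by (rule Bochner_Integration.integrable_cong[THEN iffD1, rotated -1]) (auto simp: indicator_def)
  have "w z * g (s z) = (\<Sum>v\<in>range s. (indicator (s -` {v}) z * w z) * g v)" for z
  proof -
    have "(\<Sum>v\<in>range s. (indicator (s -` {v}) z * w z) * g v) = (\<Sum>v\<in>range s. if v = s z then w z * g v else 0)"
      by (intro sum.cong) auto
    then show ?thesis using fin by simp
  qed
  then show ?thesis using i by simp
qed

text \<open>Replacing \<open>z\<close> by simple functions \<open>s n z\<close> turns both sides into finite sums.\<close>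

lemma tempered_integral_exchange:
  fixes F :: "'b::euclidean_space \<Rightarrow> 'a::euclidean_space \<Rightarrow> complex"
  assumes T: "tempered T" and w: "rapid w" and F: "schwartz_family F"
  shows "T (\<lambda>y. \<integral>z. w z * F z y \<partial>lborel) = (\<integral>z. w z * T (F z) \<partial>lborel)"
proof -
  have S: "schwartz (F z)" for z using F unfolding schwartz_family_def by blast
  \<comment> \<open>Taking 0 as the base point of the approximation yields the bound by
    \<open>2 * norm z\<close> for all \<open>n\<close> at once, which domination requires.\<close>
  obtain s :: "nat \<Rightarrow> 'b \<Rightarrow> 'b" where s: "\<And>n. simple_function lborel (s n)"
    and s_lim: "\<And>z. (\<lambda>n. s n z) \<longlonglongrightarrow> z" and s_bd: "\<And>n z. norm (s n z) \<le> 2 * norm z"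
    using borel_measurable_implies_sequence_metric[of "\<lambda>z::'b. z" lborel 0] by auto
  have sm: "s n \<in> borel_measurable borel" for n
    using borel_measurable_simple_function[OF s[of n]] by simp
  note wi = rapid_integrable[OF w]
  have wm: "w \<in> borel_measurable borel" using w by (simp add: rapid_def)
  define f where "f = (\<lambda>y. \<integral>z. w z * F z y \<partial>lborel)"
  define u where "u n = (\<lambda>y. \<integral>z. w z * F (s n z) y \<partial>lborel)" for n
  note If = integrable_family_weighted[OF w F, where s="\<lambda>z. z", simplified]
  note Iu = integrable_family_weighted[OF w F sm s_bd]
  have Sf: "schwartz f" unfolding f_def by (rule schwartz_integral_family[OF If])
  have Su: "schwartz (u n)" for n unfolding u_def by (rule schwartz_integral_family[OF Iu])
  have "\<forall>k. \<forall>bs\<in>lists Basis. \<exists>C K. C \<ge> 0 \<and> (\<forall>z v y. wt y ^ k * norm (pderivs bs (F z) y - pderivs bs (F v) y)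
      \<le> C * norm (z - v) * (1 + norm z + norm v) ^ K)"
    using F unfolding schwartz_family_def tame_def by meson
  then obtain C K where C0: "\<And>k bs. bs \<in> lists Basis \<Longrightarrow> C k bs \<ge> 0" and
    C: "\<And>k bs z v y. bs \<in> lists Basis \<Longrightarrow> wt y ^ k * norm (pderivs bs (F z) y - pderivs bs (F v) y)
      \<le> C k bs * norm (z - v) * (1 + norm z + norm v) ^ K k bs"
    by metis
  \<comment> \<open>\<open>H\<close> bounds the integrand of a seminorm of \<open>u n - f\<close>
    and tends to 0 pointwise; \<open>W\<close> dominates it. The constant 3 is 2 + 1, from
    \<open>norm (s n z) \<le> 2 * norm z\<close>.\<close>
  define H where "H k bs n z = norm (w z) * (C k bs * norm (s n z - z) * (1 + norm (s n z) + norm z) ^ K k bs)" for k bs n z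
  define W where "W k bs z = (3 * C k bs * 3 ^ K k bs) * (wt z ^ Suc (K k bs) * norm (w z))" for k bs z
  have Wi: "integrable lborel (W k bs)" for k bs
    using w[unfolded rapid_def, THEN conjunct2, rule_format, of "Suc (K k bs)"] unfolding W_def by (intro integrable_mult_right)
  have HW: "norm (H k bs n z) \<le> W k bs z" if bs: "bs \<in> lists Basis" for k bs n z
  proof -
    have 1: "norm (s n z - z) \<le> 3 * wt z"
      using norm_triangle_ineq4[of "s n z" z] s_bd[of n z] norm_ge_zero[of z] unfolding distrib_left by simp
    have 2: "(1 + norm (s n z) + norm z) ^ K k bs \<le> (3 * wt z) ^ K k bs"
      using s_bd[of n z] by (intro power_mono) auto
    have "H k bs n z \<le> norm (w z) * (C k bs * (3 * wt z) * (3 * wt z) ^ K k bs)"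
      unfolding H_def using C0[OF bs, of k] by (intro mult_left_mono mult_mono 1 2) auto
    also have "\<dots> = W k bs z" unfolding W_def power_mult_distrib by (simp add: mult_ac)
    finally show ?thesis using C0[OF bs, of k] by (simp add: H_def)
  qed
  have Hm: "H k bs n \<in> borel_measurable lborel" for k bs n
    unfolding H_def using sm wm by measurable
  have Hi: "integrable lborel (H k bs n)" if bs: "bs \<in> lists Basis" for k bs n
    by (rule Bochner_Integration.integrable_bound[OF Wi[of k bs] Hm])
      (auto intro!: AE_I2 order_trans[OF HW[OF bs, unfolded real_norm_def]] simp: abs_ge_self)
  have "(\<lambda>n. T (u n)) \<longlonglongrightarrow> T f"
  proof (rule tempered_tendsto[OF T Sf Su])
    show "wt y ^ k * norm (pderivs bs (u n) y - pderivs bs f y) \<le> (\<integral>z. H k bs n z \<partial>lborel)"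
      if bs: "bs \<in> lists Basis" for k bs n y
    proof -
      let ?D = "\<lambda>z y. w z * pderivs bs (F (s n z)) y - w z * pderivs bs (F z) y"
      have i: "integrable lborel (\<lambda>z. w z * pderivs bs (F (s n z)) y)" "integrable lborel (\<lambda>z. w z * pderivs bs (F z) y)" for y
        using integrable_familyD(4)[OF integrable_family_pderivs[OF Iu bs], of n y]
          integrable_familyD(4)[OF integrable_family_pderivs[OF If bs], of y] by (simp_all add: pderivs_cmult[OF bs S])
      have "pderivs bs (u n) y - pderivs bs f y = (\<integral>z. ?D z y \<partial>lborel)"
        unfolding u_def f_def pderivs_integral_family[OF Iu bs] pderivs_integral_family[OF If bs] pderivs_cmult[OF bs S]
        using i by simp
      moreover have "wt y ^ k * norm (\<integral>z. ?D z y \<partial>lborel) \<le> (\<integral>z. H k bs n z \<partial>lborel)"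
      proof (rule integral_family_decay[OF Hi[OF bs]])
        show "wt y ^ k * norm (?D z y) \<le> H k bs n z" for z y
        proof -
          have "wt y ^ k * norm (?D z y) = norm (w z) * (wt y ^ k * norm (pderivs bs (F (s n z)) y - pderivs bs (F z) y))"
            unfolding right_diff_distrib[symmetric] norm_mult by (simp add: mult_ac)
          also have "\<dots> \<le> H k bs n z" unfolding H_def by (intro mult_left_mono C[OF bs]) auto
          finally show ?thesis .
        qed
      qed (use i in auto)
      ultimately show ?thesis by simp
    qed
    show "(\<lambda>n. \<integral>z. H k bs n z \<partial>lborel) \<longlonglongrightarrow> 0" if bs: "bs \<in> lists Basis" for k bs
    proof -
      have "(\<lambda>n. \<integral>z. H k bs n z \<partial>lborel) \<longlonglongrightarrow> (\<integral>z. 0 \<partial>(lborel::'b measure))"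
      proof (rule integral_dominated_convergence[OF _ Hm Wi])
        show "AE z in lborel. (\<lambda>n. H k bs n z) \<longlonglongrightarrow> 0"
        proof (rule AE_I2)
          fix z :: 'b
          have "(\<lambda>n. H k bs n z) \<longlonglongrightarrow> norm (w z) * (C k bs * norm (z - z) * (1 + norm z + norm z) ^ K k bs)"
            unfolding H_def by (intro tendsto_intros s_lim)
          then show "(\<lambda>n. H k bs n z) \<longlonglongrightarrow> 0" by simp
        qed
        show "AE z in lborel. norm (H k bs n z) \<le> W k bs z" for n by (intro AE_I2 HW[OF bs])
      qed simp
      then show ?thesis by simp
    qed
  qed
  moreover have "T (u n) = (\<integral>z. w z * T (F (s n z)) \<partial>lborel)" for n
  proof -
    have fin: "finite (range (s n))" using s[of n] by (simp add: simple_function_def)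
    have "T (u n) = T (\<lambda>y. \<Sum>v\<in>range (s n). (\<integral>z. indicator (s n -` {v}) z * w z \<partial>lborel) * F v y)"
      unfolding u_def by (subst integral_simple_weight[OF wi s]) auto
    also have "\<dots> = (\<Sum>v\<in>range (s n). (\<integral>z. indicator (s n -` {v}) z * w z \<partial>lborel) * T (F v))"
      by (simp add: tempered_sum[OF T fin] schwartz_cmult S tempered_cmult[OF T])
    also have "\<dots> = (\<integral>z. w z * T (F (s n z)) \<partial>lborel)"
      by (subst integral_simple_weight[OF wi s]) auto
    finally show ?thesis .
  qed
  moreover have "(\<lambda>n. \<integral>z. w z * T (F (s n z)) \<partial>lborel) \<longlonglongrightarrow> (\<integral>z. w z * T (F z) \<partial>lborel)"
  proof -
    obtain D L where D: "D \<ge> 0" "\<And>z. norm (T (F z)) \<le> D * wt z ^ L"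
      using tempered_family_growth[OF T F] by blast
    note cont = tempered_family_continuous[OF T F]
    have Tm: "(\<lambda>z. T (F z)) \<in> borel_measurable borel" by (rule borel_measurable_continuous_onI[OF cont])
    show ?thesis
    proof (rule integral_dominated_convergence[where w="\<lambda>z. (D * 2 ^ L) * (wt z ^ L * norm (w z))"])
      show "(\<lambda>z. w z * T (F z)) \<in> borel_measurable lborel" using wm Tm by simp
      show "(\<lambda>z. w z * T (F (s n z))) \<in> borel_measurable lborel" for n
        using wm measurable_compose[OF sm Tm] by simp
      show "integrable lborel (\<lambda>z. (D * 2 ^ L) * (wt z ^ L * norm (w z)))"
        using w unfolding rapid_def by (intro integrable_mult_right) auto
      show "AE z in lborel. (\<lambda>n. w z * T (F (s n z))) \<longlonglongrightarrow> w z * T (F z)"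
      proof (intro AE_I2 tendsto_mult tendsto_const)
        show "(\<lambda>n. T (F (s n z))) \<longlonglongrightarrow> T (F z)" for z
          using cont by (intro isCont_tendsto_compose[OF _ s_lim, where g="\<lambda>z. T (F z)"]) (simp add: continuous_on_eq_continuous_at)
      qed
      show "AE z in lborel. norm (w z * T (F (s n z))) \<le> (D * 2 ^ L) * (wt z ^ L * norm (w z))" for n
      proof (rule AE_I2)
        fix z
        have "norm (w z * T (F (s n z))) \<le> norm (w z) * (D * wt (s n z) ^ L)"
          unfolding norm_mult by (intro mult_left_mono D) auto
        also have "\<dots> \<le> norm (w z) * (D * (2 * wt z) ^ L)"
          using s_bd[of n z] D(1) by (intro mult_left_mono power_mono) auto
        finally show "norm (w z * T (F (s n z))) \<le> (D * 2 ^ L) * (wt z ^ L * norm (w z))"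
          unfolding power_mult_distrib by (simp add: mult_ac)
      qed
    qed
  qed
  ultimately have "T f = (\<integral>z. w z * T (F z) \<partial>lborel)" using LIMSEQ_unique by simp
  then show ?thesis by (simp add: f_def)
qed

section \<open>Families of translates and modulates\<close>

text \<open>Derivatives are available along basis vectors only, so the increment is built one
  coordinate at a time. Every intermediate displacement is bounded by the sum of the coordinates in
  modulus, hence by \<open>R\<close>.\<close>

lemma schwartz_increment_bound:
  assumes f: "schwartz f" and A: "finite A" "A \<subseteq> Basis"
    and B: "\<And>b w. b \<in> Basis \<Longrightarrow> norm w \<le> R \<Longrightarrow> norm (dirderiv b f (z + w)) \<le> B"
    and R: "(\<Sum>b\<in>A. \<bar>h \<bullet> b\<bar>) \<le> R"
  shows "norm (f (z + (\<Sum>b\<in>A. (h \<bullet> b) *\<^sub>R b)) - f z) \<le> B * (\<Sum>b\<in>A. \<bar>h \<bullet> b\<bar>)"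
  using A R
proof (induction A rule: finite_induct)
  case (insert c A)
  let ?v = "\<Sum>b\<in>A. (h \<bullet> b) *\<^sub>R b"
  have c: "c \<in> Basis" using insert by simp
  have R: "(\<Sum>b\<in>A. \<bar>h \<bullet> b\<bar>) + \<bar>h \<bullet> c\<bar> \<le> R" using insert by simp
  have v: "norm ?v \<le> (\<Sum>b\<in>A. \<bar>h \<bullet> b\<bar>)"
    by (rule order_trans[OF norm_sum]) (use insert in \<open>auto intro!: sum_mono\<close>)
  have "norm (f (z + ?v + (h \<bullet> c) *\<^sub>R c) - f (z + ?v + 0 *\<^sub>R c)) \<le> B * \<bar>h \<bullet> c\<bar>"
  proof (rule vector_derivative_bound[OF has_dirderiv_shift[OF schwartz_has_dirderiv0[OF f c]]])
    fix t assume t: "\<bar>t\<bar> \<le> \<bar>h \<bullet> c\<bar>"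
    have "norm (?v + t *\<^sub>R c) \<le> norm ?v + \<bar>t\<bar>"
      using norm_triangle_ineq[of ?v "t *\<^sub>R c"] c by simp
    then have "norm (?v + t *\<^sub>R c) \<le> R" using v R t by linarith
    then show "norm (dirderiv c f (z + ?v + t *\<^sub>R c)) \<le> B" using B[OF c] by (simp add: add.assoc)
  qed
  moreover have "norm (f (z + ?v) - f z) \<le> B * (\<Sum>b\<in>A. \<bar>h \<bullet> b\<bar>)"
    using insert by (intro insert.IH) auto
  moreover have eq: "z + (\<Sum>b\<in>insert c A. (h \<bullet> b) *\<^sub>R b) = z + ?v + (h \<bullet> c) *\<^sub>R c"
    and sm: "(\<Sum>b\<in>insert c A. \<bar>h \<bullet> b\<bar>) = \<bar>h \<bullet> c\<bar> + (\<Sum>b\<in>A. \<bar>h \<bullet> b\<bar>)"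
    using insert by (simp_all add: add_ac)
  ultimately show ?case unfolding eq sm distrib_left
    using norm_triangle_ineq[of "f (z + ?v + (h \<bullet> c) *\<^sub>R c) - f (z + ?v)" "f (z + ?v) - f z"]
    by simp
qed simp

lemma tame_translate:
  fixes f :: "'a::euclidean_space \<Rightarrow> complex"
  assumes f: "schwartz f"
  shows "tame (\<lambda>x y. f (y - x))"
  unfolding tame_def
proof
  fix k
  obtain C where C0: "C \<ge> 0" and C: "\<And>x. wt x ^ k * norm (f x) \<le> C" using schwartz_decay[OF f] by blast
  have "\<forall>b\<in>Basis. \<exists>D. D \<ge> 0 \<and> (\<forall>x. wt x ^ k * norm (dirderiv b f x) \<le> D)"
    using schwartz_decay[OF schwartz_dirderiv[OF f]] by metis
  then obtain D where D0: "\<And>b. b \<in> Basis \<Longrightarrow> D b \<ge> 0"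
    and D: "\<And>b x. b \<in> Basis \<Longrightarrow> wt x ^ k * norm (dirderiv b f x) \<le> D b" by metis
  define d where "d = real DIM('a)"
  define M where "M = (\<Sum>b\<in>Basis. D b)"
  have M0: "M \<ge> 0" unfolding M_def by (intro sum_nonneg D0)
  have M: "wt x ^ k * norm (dirderiv b f x) \<le> M" if "b \<in> Basis" for b x
    using D[OF that, of x] member_le_sum[OF that, of D] D0 unfolding M_def by fastforce
  have d0: "d \<ge> 0" by (simp add: d_def)
  have bound: "wt y ^ k * norm (f (y - x)) \<le> C * wt x ^ k" for x y
  proof -
    have "wt y ^ k * norm (f (y - x)) \<le> (wt (y - x) ^ k * wt x ^ k) * norm (f (y - x))"
      using weight_submult_power[of "y - x" x k] by (intro mult_right_mono) auto
    also have "\<dots> = wt x ^ k * (wt (y - x) ^ k * norm (f (y - x)))" by simp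
    also have "\<dots> \<le> wt x ^ k * C" by (intro mult_left_mono C) auto
    finally show ?thesis by (simp add: mult.commute)
  qed
  have lip: "wt y ^ k * norm (f (y - z) - f (y - v)) \<le> (M * (1 + d) ^ k * d) * norm (z - v) * (1 + norm z + norm v) ^ k" for z v y
  proof -
    let ?h = "z - v" and ?a = "y - z"
    \<comment> \<open>For \<open>norm w \<le> d * norm (z - v)\<close> one has
      \<open>wt (z - w) \<le> ?W\<close>. Since \<open>y = (?a + w) + (z - w)\<close>, this converts
      the weight at \<open>y\<close> into one at the point where the derivative is
      evaluated.\<close>
    let ?Y = "wt y ^ k" and ?W = "(1 + d) * (1 + norm z + norm v)"
    have Y: "?Y > 0" by (intro zero_less_power) (smt (verit) norm_ge_zero)
    have sum_le: "(\<Sum>b\<in>Basis. \<bar>?h \<bullet> b\<bar>) \<le> d * norm ?h"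
      unfolding d_def using sum_bounded_above[of Basis "\<lambda>b. \<bar>?h \<bullet> b\<bar>" "norm ?h"] Basis_le_norm by auto
    have "norm (f (?a + (\<Sum>b\<in>Basis. (?h \<bullet> b) *\<^sub>R b)) - f ?a) \<le> (M * ?W ^ k / ?Y) * (\<Sum>b\<in>Basis. \<bar>?h \<bullet> b\<bar>)"
    proof (rule schwartz_increment_bound[OF f _ _ _ sum_le])
      fix b w :: 'a assume b: "b \<in> Basis" and w: "norm w \<le> d * norm ?h"
      have "norm (z - w) \<le> norm z + d * (norm z + norm v)"
        using norm_triangle_ineq4[of z w] w mult_left_mono[OF norm_triangle_ineq4[of z v] d0] by linarith
      then have "1 + norm (z - w) \<le> ?W" using d0 by (simp add: algebra_simps) (smt (verit) norm_ge_zero)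
      then have "wt (z - w) ^ k \<le> ?W ^ k" by (intro power_mono) auto
      moreover have "?Y \<le> wt (?a + w) ^ k * wt (z - w) ^ k"
        using weight_submult_power[of "?a + w" "z - w" k] by (simp add: algebra_simps)
      ultimately have "?Y \<le> wt (?a + w) ^ k * ?W ^ k"
        by (meson mult_left_mono order_trans zero_le_power add_nonneg_nonneg norm_ge_zero zero_le_one)
      then have "?Y * norm (dirderiv b f (?a + w)) \<le> (wt (?a + w) ^ k * ?W ^ k) * norm (dirderiv b f (?a + w))"
        by (intro mult_right_mono) auto
      also have "\<dots> = ?W ^ k * (wt (?a + w) ^ k * norm (dirderiv b f (?a + w)))" by simp
      also have "\<dots> \<le> ?W ^ k * M" using d0 by (intro mult_left_mono M b zero_le_power mult_nonneg_nonneg) auto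
      finally show "norm (dirderiv b f (?a + w)) \<le> M * ?W ^ k / ?Y" using Y by (simp add: field_simps)
    qed auto
    also have "\<dots> \<le> (M * ?W ^ k / ?Y) * (d * norm ?h)"
      using Y M0 d0 by (intro mult_left_mono sum_le divide_nonneg_pos mult_nonneg_nonneg zero_le_power) auto
    also have "?a + (\<Sum>b\<in>Basis. (?h \<bullet> b) *\<^sub>R b) = y - v" by (simp only: euclidean_representation) simp
    finally have "norm (f (y - v) - f (y - z)) \<le> (M * ?W ^ k / ?Y) * (d * norm ?h)" .
    then have "?Y * norm (f (y - z) - f (y - v)) \<le> M * ?W ^ k * (d * norm ?h)"
      using Y by (simp add: field_simps norm_minus_commute)
    then show ?thesis unfolding power_mult_distrib by (simp add: mult_ac)
  qed
  let ?A = "C + M * (1 + d) ^ k * d"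
  have N0: "0 \<le> M * (1 + d) ^ k * d" using M0 d0 by simp
  show "\<exists>C K. C \<ge> 0 \<and> (\<forall>z y. wt y ^ k * norm (f (y - z)) \<le> C * wt z ^ K) \<and>
     (\<forall>z v y. wt y ^ k * norm (f (y - z) - f (y - v)) \<le> C * norm (z - v) * (1 + norm z + norm v) ^ K)"
  proof (intro exI[of _ ?A] exI[of _ k] conjI allI)
    show "0 \<le> ?A" using C0 N0 by simp
    show "wt y ^ k * norm (f (y - z)) \<le> ?A * wt z ^ k" for z y
      by (rule order_trans[OF bound]) (use N0 in \<open>auto intro!: mult_right_mono\<close>)
    show "wt y ^ k * norm (f (y - z) - f (y - v)) \<le> ?A * norm (z - v) * (1 + norm z + norm v) ^ k" for z v y
      by (rule order_trans[OF lip]) (use C0 in \<open>auto intro!: mult_right_mono\<close>)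
  qed
qed

lemma schwartz_family_translate:
  fixes f :: "'a::euclidean_space \<Rightarrow> complex"
  assumes f: "schwartz f"
  shows "schwartz_family (\<lambda>x y. f (y - x))"
proof -
  have p: "pderivs bs (\<lambda>y. f (y - x)) = (\<lambda>y. pderivs bs f (y - x))" for bs x
    using pderivs_translate[of bs f "- x"] by simp
  show ?thesis unfolding schwartz_family_def p
    using schwartz_translate[OF f, of "- _"] tame_translate[OF schwartz_pderivs[OF f]] by simp
qed

lemma tame_add:
  assumes F: "tame F" and G: "tame G" shows "tame (\<lambda>z y. F z y + G z y)"
  unfolding tame_def
proof
  fix k
  obtain C K where C: "C \<ge> 0" "\<And>z y. wt y ^ k * norm (F z y) \<le> C * wt z ^ K"
    "\<And>z v y. wt y ^ k * norm (F z y - F v y) \<le> C * norm (z - v) * (1 + norm z + norm v) ^ K"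
    using F unfolding tame_def by meson
  obtain D L where D: "D \<ge> 0" "\<And>z y. wt y ^ k * norm (G z y) \<le> D * wt z ^ L"
    "\<And>z v y. wt y ^ k * norm (G z y - G v y) \<le> D * norm (z - v) * (1 + norm z + norm v) ^ L"
    using G unfolding tame_def by meson
  have split: "wt y ^ k * norm (a + b) \<le> wt y ^ k * norm a + wt y ^ k * norm b" for y and a b :: complex
    unfolding distrib_left[symmetric] by (intro mult_left_mono norm_triangle_ineq) auto
  have pw: "c * r ^ K + e * r ^ L \<le> (c + e) * r ^ (K + L)" if "c \<ge> 0" "e \<ge> 0" "r \<ge> 1" for c e r :: real
    unfolding distrib_right using that by (intro add_mono mult_left_mono power_increasing) auto
  show "\<exists>C K. C \<ge> 0 \<and> (\<forall>z y. wt y ^ k * norm (F z y + G z y) \<le> C * wt z ^ K) \<and>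
     (\<forall>z v y. wt y ^ k * norm (F z y + G z y - (F v y + G v y)) \<le> C * norm (z - v) * (1 + norm z + norm v) ^ K)"
  proof (intro exI[of _ "C + D"] exI[of _ "K + L"] conjI allI)
    show "0 \<le> C + D" using C D by simp
    show "wt y ^ k * norm (F z y + G z y) \<le> (C + D) * wt z ^ (K + L)" for z y
      using split[of y "F z y" "G z y"] C(2)[of y z] D(2)[of y z] pw[of C D "1 + norm z"] C(1) D(1) by fastforce
    show "wt y ^ k * norm (F z y + G z y - (F v y + G v y)) \<le> (C + D) * norm (z - v) * (1 + norm z + norm v) ^ (K + L)" for z v y
      using split[of y "F z y - F v y" "G z y - G v y"] C(3)[of y z v] D(3)[of y z v]
        pw[of "C * norm (z - v)" "D * norm (z - v)" "1 + norm z + norm v"] C(1) D(1)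
      by (simp add: algebra_simps)
  qed
qed

lemma tame_coord:
  assumes F: "tame F" and b: "norm b \<le> 1" shows "tame (\<lambda>z y. (\<i> * of_real (z \<bullet> b)) * F z y)"
  unfolding tame_def
proof
  fix k
  obtain C K where C: "C \<ge> 0" "\<And>z y. wt y ^ k * norm (F z y) \<le> C * wt z ^ K"
    "\<And>z v y. wt y ^ k * norm (F z y - F v y) \<le> C * norm (z - v) * (1 + norm z + norm v) ^ K"
    using F unfolding tame_def by meson
  have inner_le: "\<bar>x \<bullet> b\<bar> \<le> norm x" for x
    using Cauchy_Schwarz_ineq2[of x b] mult_left_mono[OF b norm_ge_zero[of x]] by linarith
  show "\<exists>C K. C \<ge> 0 \<and> (\<forall>z y. wt y ^ k * norm ((\<i> * of_real (z \<bullet> b)) * F z y) \<le> C * wt z ^ K) \<and>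
     (\<forall>z v y. wt y ^ k * norm ((\<i> * of_real (z \<bullet> b)) * F z y - (\<i> * of_real (v \<bullet> b)) * F v y)
        \<le> C * norm (z - v) * (1 + norm z + norm v) ^ K)"
  proof (intro exI[of _ "C"] exI[of _ "Suc K"] conjI allI)
    show "0 \<le> C" using C by simp
    show "wt y ^ k * norm ((\<i> * of_real (z \<bullet> b)) * F z y) \<le> C * wt z ^ Suc K" for z y
    proof -
      have "wt y ^ k * norm ((\<i> * of_real (z \<bullet> b)) * F z y) = \<bar>z \<bullet> b\<bar> * (wt y ^ k * norm (F z y))"
        by (simp add: norm_mult)
      also have "\<dots> \<le> wt z * (C * wt z ^ K)"
        using inner_le[of z] by (intro mult_mono C) auto
      finally show ?thesis by (simp add: mult_ac)
    qed
    show "wt y ^ k * norm ((\<i> * of_real (z \<bullet> b)) * F z y - (\<i> * of_real (v \<bullet> b)) * F v y)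
        \<le> C * norm (z - v) * (1 + norm z + norm v) ^ Suc K" for z v y
    proof -
      let ?Y = "wt y ^ k" and ?r = "1 + norm z + norm v"
      have "(\<i> * of_real (z \<bullet> b)) * F z y - (\<i> * of_real (v \<bullet> b)) * F v y =
          \<i> * (of_real ((z - v) \<bullet> b) * F z y + of_real (v \<bullet> b) * (F z y - F v y))"
        by (simp add: algebra_simps inner_diff_left)
      also have "norm \<dots> \<le> \<bar>(z - v) \<bullet> b\<bar> * norm (F z y) + \<bar>v \<bullet> b\<bar> * norm (F z y - F v y)"
        by (simp only: norm_mult norm_ii) (rule order_trans[OF _ norm_triangle_ineq[THEN order_trans]], auto simp: norm_mult)
      finally have "?Y * norm ((\<i> * of_real (z \<bullet> b)) * F z y - (\<i> * of_real (v \<bullet> b)) * F v y)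
          \<le> ?Y * (\<bar>(z - v) \<bullet> b\<bar> * norm (F z y) + \<bar>v \<bullet> b\<bar> * norm (F z y - F v y))"
        by (intro mult_left_mono) auto
      also have "\<dots> = \<bar>(z - v) \<bullet> b\<bar> * (?Y * norm (F z y)) + \<bar>v \<bullet> b\<bar> * (?Y * norm (F z y - F v y))"
        by (simp add: algebra_simps)
      also have "\<dots> \<le> norm (z - v) * (C * wt z ^ K) + norm v * (C * norm (z - v) * ?r ^ K)"
        by (intro add_mono mult_mono C inner_le) auto
      also have "\<dots> \<le> norm (z - v) * (C * ?r ^ K) + norm v * (C * norm (z - v) * ?r ^ K)"
        using C(1) by (intro add_right_mono mult_left_mono power_mono) auto
      also have "\<dots> = C * norm (z - v) * ?r ^ K * wt v" by (simp add: algebra_simps)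
      also have "\<dots> \<le> C * norm (z - v) * ?r ^ K * ?r" using C(1) by (intro mult_left_mono mult_nonneg_nonneg) auto
      finally show ?thesis by (simp add: mult_ac)
    qed
  qed
qed

text \<open>A character is Lipschitz in \<open>z\<close> with constant \<open>norm y\<close>, which
  one additional power of the weight on \<open>f\<close> absorbs.\<close>

lemma tame_modulate:
  fixes f :: "'a::euclidean_space \<Rightarrow> complex"
  assumes f: "schwartz f"
  shows "tame (\<lambda>z y. iexp (y \<bullet> z) * f y)"
  unfolding tame_def
proof
  fix k
  obtain C where C: "C \<ge> 0" "\<And>x. wt x ^ k * norm (f x) \<le> C" using schwartz_decay[OF f] by blast
  obtain D where D: "D \<ge> 0" "\<And>x. wt x ^ Suc k * norm (f x) \<le> D" using schwartz_decay[OF f] by blast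
  have lip: "norm (exp (\<i> * of_real s) - exp (\<i> * of_real t)) \<le> \<bar>s - t\<bar>" for s t :: real
  proof -
    have "exp (\<i> * of_real s) - exp (\<i> * of_real t) = exp (\<i> * of_real t) * (exp (\<i> * of_real (s - t)) - 1)"
    proof -
      have "exp (\<i> * of_real s) = exp (\<i> * of_real t) * exp (\<i> * of_real (s - t))"
        unfolding exp_add[symmetric] by (simp add: algebra_simps)
      then show ?thesis by (simp add: right_diff_distrib)
    qed
    also have "norm \<dots> = norm (exp (\<i> * of_real (s - t)) - 1)" by (simp add: norm_mult)
    also have "\<dots> \<le> \<bar>s - t\<bar>" using iexp_approx1[of "s - t" 0] by simp
    finally show ?thesis .
  qed
  show "\<exists>C K. C \<ge> 0 \<and> (\<forall>z y. wt y ^ k * norm (iexp (y \<bullet> z) * f y) \<le> C * wt z ^ K) \<and>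
     (\<forall>z v y. wt y ^ k * norm (iexp (y \<bullet> z) * f y - iexp (y \<bullet> v) * f y)
       \<le> C * norm (z - v) * (1 + norm z + norm v) ^ K)"
  proof (intro exI[of _ "C + D"] exI[of _ "0::nat"] conjI allI)
    show "0 \<le> C + D" using C D by simp
    show "wt y ^ k * norm (iexp (y \<bullet> z) * f y) \<le> (C + D) * wt z ^ 0" for z y
      using C(2)[of y] D(1) by (simp add: norm_mult)
    show "wt y ^ k * norm (iexp (y \<bullet> z) * f y - iexp (y \<bullet> v) * f y)
       \<le> (C + D) * norm (z - v) * (1 + norm z + norm v) ^ 0" for z v y
    proof -
      have "\<bar>y \<bullet> z - y \<bullet> v\<bar> \<le> norm y * norm (z - v)"
        using Cauchy_Schwarz_ineq2[of y "z - v"] by (simp add: inner_diff_right)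
      also have "\<dots> \<le> wt y * norm (z - v)" by (intro mult_right_mono) auto
      finally have 1: "norm (iexp (y \<bullet> z) - iexp (y \<bullet> v)) \<le> wt y * norm (z - v)"
        by (rule order_trans[OF lip])
      have "wt y ^ k * norm (iexp (y \<bullet> z) * f y - iexp (y \<bullet> v) * f y)
        = (wt y ^ k * norm (f y)) * norm (iexp (y \<bullet> z) - iexp (y \<bullet> v))"
        unfolding left_diff_distrib[symmetric] norm_mult by simp
      also have "\<dots> \<le> (wt y ^ k * norm (f y)) * (wt y * norm (z - v))"
        by (intro mult_left_mono 1) auto
      also have "\<dots> = (wt y ^ Suc k * norm (f y)) * norm (z - v)" by simp
      also have "\<dots> \<le> (C + D) * norm (z - v)" using C(1) D(2)[of y] by (intro mult_right_mono) auto
      finally show ?thesis by simp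
    qed
  qed
qed

text \<open>By the product rule, a partial derivative of \<open>iexp (y \<bullet> z) * f y\<close>
  is a coordinate of \<open>z\<close> times \<open>\<i>\<close> times the same modulate, plus a
  modulated derivative of \<open>f\<close>. The rules generate what such derivatives produce and
  preserve tameness.\<close>

inductive modfam :: "('a::euclidean_space \<Rightarrow> 'a \<Rightarrow> complex) \<Rightarrow> bool" where
  base: "schwartz f \<Longrightarrow> modfam (\<lambda>z y. iexp (y \<bullet> z) * f y)"
| coord: "modfam F \<Longrightarrow> b \<in> Basis \<Longrightarrow> modfam (\<lambda>z y. (\<i> * of_real (z \<bullet> b)) * F z y)"
| add: "modfam F \<Longrightarrow> modfam G \<Longrightarrow> modfam (\<lambda>z y. F z y + G z y)"

lemma modfam_tame: "modfam F \<Longrightarrow> tame F"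
  by (induction rule: modfam.induct) (auto intro: tame_modulate tame_add tame_coord)

lemma modfam_continuous: "modfam F \<Longrightarrow> continuous_on UNIV (F z)"
  by (induction rule: modfam.induct) (auto intro!: continuous_intros dest: schwartz_continuous)

lemma modfam_deriv:
  assumes "modfam F" and b: "b \<in> Basis"
  shows "\<exists>F'. modfam F' \<and> (\<forall>z x. ((\<lambda>t::real. F z (x + t *\<^sub>R b)) has_vector_derivative F' z x) (at 0))"
  using assms(1)
proof (induction rule: modfam.induct)
  case (base f)
  let ?F' = "\<lambda>z y. (\<i> * of_real (z \<bullet> b)) * (iexp (y \<bullet> z) * f y) + iexp (y \<bullet> z) * dirderiv b f y"
  have "modfam ?F'" by (intro modfam.intros base schwartz_dirderiv b)
  moreover have "((\<lambda>t::real. exp (\<i> * of_real ((x + t *\<^sub>R b) \<bullet> z)) * f (x + t *\<^sub>R b)) has_vector_derivative ?F' z x) (at 0)" for z x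
  proof -
    have "((\<lambda>t::real. exp (\<i> * of_real ((x + t *\<^sub>R b) \<bullet> z))) has_vector_derivative (\<i> * of_real (b \<bullet> z)) * iexp (x \<bullet> z)) (at 0)"
    proof -
      have "((\<lambda>u::complex. exp (\<i> * (of_real (x \<bullet> z) + u * of_real (b \<bullet> z)))) has_field_derivative
          (\<i> * of_real (b \<bullet> z)) * exp (\<i> * (of_real (x \<bullet> z) + of_real 0 * of_real (b \<bullet> z)))) (at (of_real 0))"
        by (auto intro!: derivative_eq_intros)
      from has_vector_derivative_real_field[OF this] show ?thesis
        by (simp add: inner_add_left)
    qed
    from has_vector_derivative_mult[OF this schwartz_has_dirderiv0[OF base b, of x]]
    show ?thesis by (simp add: inner_commute add_ac mult_ac)
  qed
  ultimately show ?case by blast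
next
  case (coord F c)
  then obtain F' where F': "modfam F'" "\<And>z x. ((\<lambda>t::real. F z (x + t *\<^sub>R b)) has_vector_derivative F' z x) (at 0)" by blast
  show ?case
    by (rule exI[of _ "\<lambda>z y. (\<i> * of_real (z \<bullet> c)) * F' z y"])
      (use F' coord in \<open>auto intro!: modfam.intros has_vector_derivative_mult_right\<close>)
next
  case (add F G)
  then obtain F' G' where "modfam F'" "\<And>z x. ((\<lambda>t::real. F z (x + t *\<^sub>R b)) has_vector_derivative F' z x) (at 0)"
    and "modfam G'" "\<And>z x. ((\<lambda>t::real. G z (x + t *\<^sub>R b)) has_vector_derivative G' z x) (at 0)" by blast
  then show ?case
    by (intro exI[of _ "\<lambda>z y. F' z y + G' z y"]) (auto intro!: modfam.intros has_vector_derivative_add)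
qed

lemma modfam_schwartz:
  assumes "modfam F" shows "schwartz (F z)"
proof (rule schwartz_coinduct[where F="\<lambda>F. F z"])
  fix F :: "'a \<Rightarrow> 'a \<Rightarrow> complex" assume F: "modfam F"
  show "continuous_on UNIV (F z)" by (rule modfam_continuous[OF F])
  show "\<exists>C. \<forall>x. wt x ^ k * norm (F z x) \<le> C" for k
    using modfam_tame[OF F] unfolding tame_def by meson
  show "\<exists>G. modfam G \<and> (\<forall>x. ((\<lambda>t::real. F z (x + t *\<^sub>R b)) has_vector_derivative G z x) (at 0))" if b: "b \<in> Basis" for b
    using modfam_deriv[OF F b] by blast
qed (rule assms)

lemma modfam_pderivs:
  assumes "modfam F" "bs \<in> lists Basis"
  shows "\<exists>G. modfam G \<and> (\<forall>z. pderivs bs (F z) = G z)"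
  using assms(2)
proof (induction bs)
  case Nil then show ?case using assms(1) by auto
next
  case (Cons b bs)
  then obtain G where G: "modfam G" "\<And>z. pderivs bs (F z) = G z" by auto
  have b: "b \<in> Basis" using Cons by simp
  obtain G' where "modfam G'" "\<And>z x. ((\<lambda>t::real. G z (x + t *\<^sub>R b)) has_vector_derivative G' z x) (at 0)"
    using modfam_deriv[OF G(1) b] by blast
  then show ?case using G(2) dirderiv_eqI[of "G _" b "G' _"] by (intro exI[of _ G']) auto
qed

lemma schwartz_family_modulate:
  fixes f :: "'a::euclidean_space \<Rightarrow> complex"
  assumes f: "schwartz f"
  shows "schwartz_family (\<lambda>z y. iexp (y \<bullet> z) * f y)"
  unfolding schwartz_family_def
proof (intro conjI allI ballI)
  note m = modfam.base[OF f]
  show "schwartz (\<lambda>y. iexp (y \<bullet> z) * f y)" for z by (rule modfam_schwartz[OF m])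
  fix bs :: "'a list" assume "bs \<in> lists Basis"
  from modfam_pderivs[OF m this] show "tame (\<lambda>z. pderivs bs (\<lambda>y. iexp (y \<bullet> z) * f y))"
    using modfam_tame by auto
qed

lemma schwartz_modulate:
  "schwartz f \<Longrightarrow> schwartz (\<lambda>y. iexp (y \<bullet> z) * f y)"
  using schwartz_family_modulate unfolding schwartz_family_def by blast

section \<open>Gaussians\<close>

lemma integrable_inverse_1_plus_square_real: "integrable lborel (\<lambda>x::real. inverse (1 + x\<^sup>2))"
  using integrable_inverse_1_plus_square by (simp add: set_integrable_def einterval_eq(4))

text \<open>The power of the weight dominates the product over the coordinates of
  \<open>1 + (x \<bullet> b)\<^sup>2\<close>, so the integral is at most a product of finite
  one-dimensional integrals.\<close>

lemma integrable_inverse_weight: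
  "integrable lborel (\<lambda>x::'a::euclidean_space. inverse (wt x ^ (2 * DIM('a))))"
proof (rule integrableI_bounded)
  show "(\<lambda>x::'a. inverse (wt x ^ (2 * DIM('a)))) \<in> borel_measurable lborel" by measurable
  have le: "inverse (wt x ^ (2 * DIM('a))) \<le> (\<Prod>b\<in>Basis. inverse (1 + (x \<bullet> b)\<^sup>2))" for x :: 'a
  proof -
    have "(\<Prod>b\<in>(Basis::'a set). 1 + (x \<bullet> b)\<^sup>2) \<le> (\<Prod>b\<in>(Basis::'a set). (1 + norm x)\<^sup>2)"
    proof (rule prod_mono, safe)
      fix b :: 'a assume b: "b \<in> Basis"
      have "(x \<bullet> b)\<^sup>2 \<le> (norm x)\<^sup>2" using Basis_le_norm[OF b, of x] by (metis abs_le_square_iff abs_norm_cancel)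
      then show "1 + (x \<bullet> b)\<^sup>2 \<le> (1 + norm x)\<^sup>2" by (simp add: power2_sum add_increasing2)
    qed simp
    moreover have "0 < (\<Prod>b\<in>(Basis::'a set). 1 + (x \<bullet> b)\<^sup>2)"
      by (intro prod_pos) (simp add: add_pos_nonneg)
    ultimately have "inverse (wt x ^ (2 * DIM('a))) \<le> inverse (\<Prod>b\<in>(Basis::'a set). 1 + (x \<bullet> b)\<^sup>2)"
      by (intro le_imp_inverse_le) (simp_all add: power_mult)
    then show ?thesis by (simp add: prod_inversef[symmetric] o_def)
  qed
  have "(\<integral>\<^sup>+x. ennreal (norm (inverse (wt x ^ (2 * DIM('a))))) \<partial>(lborel::'a measure))
      \<le> (\<integral>\<^sup>+x. ennreal (\<Prod>b\<in>Basis. inverse (1 + (x \<bullet> b)\<^sup>2)) \<partial>(lborel::'a measure))"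
    using le by (intro nn_integral_mono ennreal_leI) simp
  also have "\<dots> = (\<integral>\<^sup>+x. (\<Prod>b\<in>Basis. ennreal (inverse (1 + (x \<bullet> b)\<^sup>2))) \<partial>(lborel::'a measure))"
    by (intro nn_integral_cong) (simp add: prod_ennreal add_nonneg_nonneg)
  also have "\<dots> = (\<Prod>b\<in>(Basis::'a set). \<integral>\<^sup>+x. ennreal (inverse (1 + x\<^sup>2)) \<partial>lborel)"
    by (rule nn_integral_lborel_prod) auto
  also have "\<dots> < \<infinity>"
    using integrable_inverse_1_plus_square_real
    by (simp add: integrable_iff_bounded less_top[symmetric] power_eq_top_ennreal add_nonneg_nonneg abs_of_nonneg)
  finally show "(\<integral>\<^sup>+x. ennreal (norm (inverse (wt x ^ (2 * DIM('a))))) \<partial>(lborel::'a measure)) < \<infinity>" .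
qed

lemma rapid_decay_integrable:
  fixes f :: "'a::euclidean_space \<Rightarrow> real"
  assumes m: "f \<in> borel_measurable borel" and C: "\<And>x. wt x ^ (2 * DIM('a)) * \<bar>f x\<bar> \<le> C"
  shows "integrable lborel f"
proof (rule Bochner_Integration.integrable_bound)
  show "integrable lborel (\<lambda>x::'a. C * inverse (wt x ^ (2 * DIM('a))))"
    by (intro integrable_mult_right integrable_inverse_weight)
  show "AE x in lborel. norm (f x) \<le> norm (C * inverse (wt x ^ (2 * DIM('a))))"
  proof (rule AE_I2)
    fix x :: 'a
    have "0 < wt x ^ (2 * DIM('a))" by (intro zero_less_power) (simp add: add_pos_nonneg)
    then have "\<bar>f x\<bar> \<le> C * inverse (wt x ^ (2 * DIM('a)))" using C[of x] by (simp add: field_simps)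
    then show "norm (f x) \<le> norm (C * inverse (wt x ^ (2 * DIM('a))))"
      by (metis abs_ge_self order_trans real_norm_def)
  qed
qed (use m in simp)

lemma rapidI:
  fixes f :: "'a::euclidean_space \<Rightarrow> complex"
  assumes m: "f \<in> borel_measurable borel" and C: "\<And>k. \<exists>C. \<forall>x. wt x ^ k * norm (f x) \<le> C"
  shows "rapid f"
  unfolding rapid_def
proof (intro conjI allI)
  fix K
  obtain C where "\<And>x. wt x ^ (2 * DIM('a) + K) * norm (f x) \<le> C" using C by blast
  then show "integrable lborel (\<lambda>x. wt x ^ K * norm (f x))"
    using m by (intro rapid_decay_integrable[where C=C]) (auto simp: power_add mult_ac)
qed (rule m)

lemma schwartz_rapid: "schwartz f \<Longrightarrow> rapid f"
  by (rule rapidI, erule schwartz_measurable) (metis schwartz_decay)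

lemma rapid_cmult: "rapid f \<Longrightarrow> rapid (\<lambda>x. c * f x)"
  unfolding rapid_def by (auto simp: norm_mult mult.left_commute[of _ "norm c"])

definition gauss :: "real \<Rightarrow> 'a::euclidean_space \<Rightarrow> 'a \<Rightarrow> complex" where
  "gauss s b x = of_real (exp (- s * (x \<bullet> x) + b \<bullet> x))"

lemma gauss_mult: "gauss s b x * gauss t c x = gauss (s + t) (b + c) x"
  unfolding gauss_def of_real_mult[symmetric] exp_add[symmetric] by (simp add: algebra_simps inner_add_left)

text \<open>A power of the weight is at most \<open>fact k\<close> times its exponential, and the
  quadratic term beats the resulting linear exponent; \<open>(1 + norm b)\<^sup>2 / (4 * s)\<close>
  is the maximum of \<open>wt b * r - s * r\<^sup>2\<close> over \<open>r\<close>.\<close>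

lemma gauss_decay:
  fixes b :: "'a::euclidean_space"
  assumes s: "s > 0"
  shows "\<exists>C. \<forall>x. wt x ^ k * exp (- s * (x \<bullet> x) + b \<bullet> x) \<le> C"
proof -
  have "wt x ^ k * exp (- s * (x \<bullet> x) + b \<bullet> x) \<le> fact k * exp (1 + (1 + norm b)\<^sup>2 / (4 * s))" for x
  proof -
    let ?r = "norm x"
    have "(1 + ?r) ^ k / fact k \<le> exp (1 + ?r)"
      using sum_le_suminf[OF summable_exp_generic[of "1 + ?r"], of "{k}"]
      by (simp add: exp_def divide_inverse mult.commute)
    then have "(1 + ?r) ^ k \<le> fact k * exp (1 + ?r)" by (simp add: field_simps)
    then have "(1 + ?r) ^ k * exp (- s * (x \<bullet> x) + b \<bullet> x) \<le> fact k * exp (1 + ?r) * exp (- s * (x \<bullet> x) + b \<bullet> x)"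
      by (intro mult_right_mono) auto
    also have "\<dots> = fact k * exp (1 + ?r - s * (x \<bullet> x) + b \<bullet> x)" by (simp add: exp_add[symmetric] algebra_simps)
    also have "1 + ?r - s * (x \<bullet> x) + b \<bullet> x \<le> 1 + (1 + norm b)\<^sup>2 / (4 * s)"
    proof -
      have "b \<bullet> x \<le> norm b * ?r" by (rule norm_cauchy_schwarz)
      moreover have "wt b * ?r - s * ?r\<^sup>2 \<le> (1 + norm b)\<^sup>2 / (4 * s)"
      proof -
        have "0 \<le> (2 * s * ?r - wt b)\<^sup>2" by simp
        then show ?thesis using s by (simp add: field_simps power2_eq_square)
      qed
      ultimately show ?thesis by (simp add: algebra_simps power2_norm_eq_inner)
    qed
    finally show ?thesis by simp
  qed
  then show ?thesis by blast
qed

lemma real_polynomial_growth: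
  "real_polynomial_function p \<Longrightarrow> \<exists>C K. C \<ge> 0 \<and> (\<forall>x. \<bar>p x\<bar> \<le> C * wt x ^ K)"
proof (induction rule: real_polynomial_function.induct)
  case (linear f)
  then obtain C where C: "\<And>x. norm (f x) \<le> norm x * C" "C > 0" using bounded_linear.pos_bounded by blast
  have "\<bar>f x\<bar> \<le> C * wt x ^ 1" for x using C(1)[of x] C(2) by (simp add: algebra_simps)
  then show ?case using C(2) less_imp_le by blast
next
  case (const c)
  have "\<bar>c\<bar> \<le> \<bar>c\<bar> * wt x ^ 0" for x :: 'a by simp
  then show ?case using abs_ge_zero by blast
next
  case (add f g)
  then obtain C K D L where C: "C \<ge> 0" "\<And>x. \<bar>f x\<bar> \<le> C * wt x ^ K"
    and D: "D \<ge> 0" "\<And>x. \<bar>g x\<bar> \<le> D * wt x ^ L" by blast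
  have "\<bar>f x + g x\<bar> \<le> (C + D) * wt x ^ (K + L)" for x
  proof -
    have "C * wt x ^ K \<le> C * wt x ^ (K + L)" "D * wt x ^ L \<le> D * wt x ^ (K + L)"
      using C(1) D(1) by (auto intro!: mult_left_mono power_increasing)
    then show ?thesis using C(2)[of x] D(2)[of x] unfolding distrib_right by linarith
  qed
  then show ?case using C(1) D(1) add_nonneg_nonneg by blast
next
  case (mult f g)
  then obtain C K D L where C: "C \<ge> 0" "\<And>x. \<bar>f x\<bar> \<le> C * wt x ^ K"
    and D: "D \<ge> 0" "\<And>x. \<bar>g x\<bar> \<le> D * wt x ^ L" by blast
  have "\<bar>f x * g x\<bar> \<le> (C * D) * wt x ^ (K + L)" for x
  proof -
    have "\<bar>f x * g x\<bar> \<le> (C * wt x ^ K) * (D * wt x ^ L)"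
      unfolding abs_mult using C D by (intro mult_mono) auto
    then show ?thesis by (simp add: power_add mult_ac)
  qed
  then show ?case using C(1) D(1) mult_nonneg_nonneg by blast
qed

lemma real_polynomial_dirderiv:
  "real_polynomial_function p \<Longrightarrow> \<exists>q. real_polynomial_function q \<and>
    (\<forall>x. ((\<lambda>t::real. p (x + t *\<^sub>R b)) has_real_derivative q x) (at 0))"
proof (induction rule: real_polynomial_function.induct)
  case (linear f)
  then interpret bounded_linear f .
  have "((\<lambda>t::real. f (x + t *\<^sub>R b)) has_real_derivative f b) (at 0)" for x
    unfolding add scaleR by (auto intro!: derivative_eq_intros)
  then show ?case by (intro exI[of _ "\<lambda>_. f b"]) auto
next
  case (const c)
  then show ?case by (intro exI[of _ "\<lambda>_. 0"]) auto
next
  case (add f g)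
  then obtain f' g' where "real_polynomial_function f'" "\<And>x. ((\<lambda>t::real. f (x + t *\<^sub>R b)) has_real_derivative f' x) (at 0)"
    "real_polynomial_function g'" "\<And>x. ((\<lambda>t::real. g (x + t *\<^sub>R b)) has_real_derivative g' x) (at 0)" by blast
  then show ?case by (intro exI[of _ "\<lambda>x. f' x + g' x"]) (auto intro!: derivative_eq_intros)
next
  case (mult f g)
  then obtain f' g' where *: "real_polynomial_function f'" "\<And>x. ((\<lambda>t::real. f (x + t *\<^sub>R b)) has_real_derivative f' x) (at 0)"
    "real_polynomial_function g'" "\<And>x. ((\<lambda>t::real. g (x + t *\<^sub>R b)) has_real_derivative g' x) (at 0)" by blast
  have "((\<lambda>t::real. f (x + t *\<^sub>R b) * g (x + t *\<^sub>R b)) has_real_derivative f' x * g x + g' x * f x) (at 0)" for x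
    using DERIV_mult[OF *(2)[of x] *(4)[of x]] by simp
  then show ?case using * mult by (intro exI[of _ "\<lambda>x. f' x * g x + g' x * f x"]) auto
qed

text \<open>The class used for \<open>schwartz_coinduct\<close> consists of real polynomials times
  the fixed Gaussian; differentiation changes only the polynomial.\<close>

lemma schwartz_gauss:
  fixes b :: "'a::euclidean_space"
  assumes s: "s > 0" shows "schwartz (gauss s b)"
proof -
  let ?e = "\<lambda>x. exp (- s * (x \<bullet> x) + b \<bullet> x)"
  have "schwartz (\<lambda>x. complex_of_real (1 * ?e x))"
  proof (rule schwartz_coinduct[where F="\<lambda>p x. of_real (p x * ?e x)" and i="\<lambda>_. 1"])
    fix p :: "'a \<Rightarrow> real" assume p: "real_polynomial_function p"
    show "continuous_on UNIV (\<lambda>x. complex_of_real (p x * ?e x))"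
      by (intro continuous_intros continuous_on_polymonial_function) (use p in \<open>auto simp: real_polynomial_function_eq\<close>)
    show "\<exists>C. \<forall>x. wt x ^ k * norm (complex_of_real (p x * ?e x)) \<le> C" for k
    proof -
      obtain C K where C: "C \<ge> 0" "\<And>x. \<bar>p x\<bar> \<le> C * wt x ^ K" using real_polynomial_growth[OF p] by blast
      obtain D where D: "\<And>x. wt x ^ (k + K) * ?e x \<le> D" using gauss_decay[OF s] by blast
      have "wt x ^ k * norm (complex_of_real (p x * ?e x)) \<le> C * D" for x
      proof -
        have "wt x ^ k * norm (complex_of_real (p x * ?e x)) = wt x ^ k * (\<bar>p x\<bar> * ?e x)"
          by (simp add: abs_mult del: of_real_mult)
        also have "\<dots> \<le> wt x ^ k * ((C * wt x ^ K) * ?e x)"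
          by (intro mult_left_mono mult_right_mono C) auto
        also have "\<dots> = C * (wt x ^ (k + K) * ?e x)" by (simp add: power_add mult_ac)
        also have "\<dots> \<le> C * D" by (intro mult_left_mono D C)
        finally show ?thesis .
      qed
      then show ?thesis by blast
    qed
    show "\<exists>r. real_polynomial_function r \<and> (\<forall>x. ((\<lambda>t::real. complex_of_real (p (x + t *\<^sub>R c) * ?e (x + t *\<^sub>R c)))
        has_vector_derivative of_real (r x * ?e x)) (at 0))" if "c \<in> Basis" for c
    proof -
      obtain q where q: "real_polynomial_function q" "\<And>x. ((\<lambda>t::real. p (x + t *\<^sub>R c)) has_real_derivative q x) (at 0)"
        using real_polynomial_dirderiv[OF p] by blast
      let ?r = "\<lambda>x. q x + p x * (b \<bullet> c + (-2 * s) * (x \<bullet> c))"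
      have "real_polynomial_function ?r"
        by (intro real_polynomial_function.intros q p bounded_linear_inner_left)
      moreover have "((\<lambda>t::real. complex_of_real (p (x + t *\<^sub>R c) * ?e (x + t *\<^sub>R c))) has_vector_derivative of_real (?r x * ?e x)) (at 0)" for x
      proof -
        have "((\<lambda>t. ?e (x + t *\<^sub>R c)) has_real_derivative (b \<bullet> c + (-2 * s) * (x \<bullet> c)) * ?e x) (at 0)"
          by (auto intro!: derivative_eq_intros simp: inner_add_left inner_add_right inner_commute algebra_simps)
        from DERIV_mult[OF q(2)[of x] this] have "((\<lambda>t. p (x + t *\<^sub>R c) * ?e (x + t *\<^sub>R c)) has_real_derivative ?r x * ?e x) (at 0)"
          by (simp add: algebra_simps)
        then show ?thesis by (rule has_vector_derivative_of_real)
      qed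
      ultimately show ?thesis by blast
    qed
  qed (rule real_polynomial_function.intros(2))
  moreover have "gauss s b = (\<lambda>x. complex_of_real (1 * ?e x))" by (simp add: gauss_def fun_eq_iff)
  ultimately show ?thesis by simp
qed

section \<open>Changes of variable and Gaussian integrals\<close>

lemma lborel_integral_affine:
  fixes f :: "'a::euclidean_space \<Rightarrow> 'b::{banach, second_countable_topology}"
  assumes f: "f \<in> borel_measurable borel" and c: "c \<noteq> 0"
  shows "(\<integral>x. f x \<partial>lborel) = \<bar>c\<bar> ^ DIM('a) *\<^sub>R (\<integral>x. f (t + c *\<^sub>R x) \<partial>lborel)"
proof -
  have "(\<integral>x. f x \<partial>lborel) = (\<integral>x. f x \<partial>density (distr lborel borel (\<lambda>x. t + c *\<^sub>R x)) (\<lambda>_. ennreal (\<bar>c\<bar> ^ DIM('a))))"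
    using lborel_affine[OF c, of t] by (simp add: ennreal_power)
  also have "\<dots> = (\<integral>x. \<bar>c\<bar> ^ DIM('a) *\<^sub>R f x \<partial>distr lborel borel (\<lambda>x. t + c *\<^sub>R x))"
    using f by (subst integral_density) auto
  also have "\<dots> = (\<integral>x. \<bar>c\<bar> ^ DIM('a) *\<^sub>R f (t + c *\<^sub>R x) \<partial>lborel)"
    using f by (subst integral_distr) auto
  finally show ?thesis by simp
qed

lemma lborel_integral_shift:
  fixes f :: "'a::euclidean_space \<Rightarrow> 'b::{banach, second_countable_topology}"
  assumes "f \<in> borel_measurable borel"
  shows "(\<integral>x. f (t + x) \<partial>lborel) = (\<integral>x. f x \<partial>lborel)"
  using lborel_integral_affine[OF assms, of 1 t] by simp

lemma lborel_integral_reflect: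
  fixes f :: "'a::euclidean_space \<Rightarrow> 'b::{banach, second_countable_topology}"
  assumes "f \<in> borel_measurable borel"
  shows "(\<integral>x. f (t - x) \<partial>lborel) = (\<integral>x. f x \<partial>lborel)"
  using lborel_integral_affine[OF assms, of "-1" t] by simp

lemma lborel_integral_scale:
  fixes f :: "'a::euclidean_space \<Rightarrow> 'b::{banach, second_countable_topology}"
  assumes "f \<in> borel_measurable borel" "c > 0"
  shows "(\<integral>x. f (c *\<^sub>R x) \<partial>lborel) = (1 / c) ^ DIM('a) *\<^sub>R (\<integral>x. f x \<partial>lborel)"
  using lborel_integral_affine[OF assms(1), of c 0] assms(2) by (simp add: power_one_over)

lemma gauss_measurable [measurable]: "gauss s b \<in> borel_measurable borel"
  unfolding gauss_def by measurable

lemma gauss_integrable: "s > 0 \<Longrightarrow> integrable lborel (gauss s b)"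
  by (intro rapid_integrable schwartz_rapid schwartz_gauss)

lemma gauss_eq_real: "gauss s 0 x = of_real (exp (- s * (x \<bullet> x)))"
  by (simp add: gauss_def)

text \<open>For \<open>s > 0\<close> the classical value is pi / s to the power of half the
  dimension; the argument draws only on positivity and scaling in \<open>s\<close>. The
  \<open>itself\<close> argument carries the dimension.\<close>

definition gauss_mass :: "'a::euclidean_space itself \<Rightarrow> real \<Rightarrow> real" where
  "gauss_mass _ s = (\<integral>x. exp (- s * (x \<bullet> x)) \<partial>(lborel :: 'a measure))"

lemma gauss_real_integrable: "s > 0 \<Longrightarrow> integrable lborel (\<lambda>x::'a::euclidean_space. exp (- s * (x \<bullet> x)))"
  using integrable_Re[OF gauss_integrable[of s "0::'a"]] by (simp add: gauss_def)

lemma gauss_integral_0: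
  "(\<integral>x. gauss s 0 x \<partial>(lborel :: 'a::euclidean_space measure)) = of_real (gauss_mass TYPE('a) s)"
  unfolding gauss_mass_def gauss_eq_real by simp

lemma gauss_mass_pos:
  assumes "s > 0" shows "gauss_mass TYPE('a::euclidean_space) s > 0"
proof -
  have i: "integrable lborel (\<lambda>x::'a. exp (- s * (x \<bullet> x)))" by (rule gauss_real_integrable[OF assms])
  have "gauss_mass TYPE('a) s \<noteq> 0"
  proof
    assume "gauss_mass TYPE('a) s = 0"
    then have "AE x in (lborel :: 'a measure). exp (- s * (x \<bullet> x)) = 0"
      unfolding gauss_mass_def using integral_nonneg_eq_0_iff_AE[OF i] by simp
    then have "AE x in (lborel :: 'a measure). False" by simp
    then have "UNIV \<in> null_sets (lborel :: 'a measure)"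
      using AE_iff_null[of "lborel :: 'a measure" "\<lambda>_. False"] by simp
    then show False by (simp add: null_sets_def)
  qed
  moreover have "gauss_mass TYPE('a) s \<ge> 0" unfolding gauss_mass_def by simp
  ultimately show ?thesis by simp
qed

lemma gauss_mass_scale:
  assumes s: "s > 0"
  shows "gauss_mass TYPE('a::euclidean_space) s = (1 / sqrt s) ^ DIM('a) * gauss_mass TYPE('a) 1"
proof -
  have "gauss_mass TYPE('a) s = (\<integral>x. exp (- 1 * ((sqrt s *\<^sub>R x) \<bullet> (sqrt s *\<^sub>R x))) \<partial>(lborel :: 'a measure))"
    unfolding gauss_mass_def using s by (simp add: mult.assoc[symmetric])
  also have "\<dots> = (1 / sqrt s) ^ DIM('a) *\<^sub>R (\<integral>x. exp (- 1 * (x \<bullet> x)) \<partial>(lborel :: 'a measure))"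
    using s by (intro lborel_integral_scale) auto
  finally show ?thesis by (simp add: gauss_mass_def)
qed

lemma gauss_translate:
  "gauss s b (y - x) = of_real (exp (- s * (x \<bullet> x) - b \<bullet> x)) * gauss s (b + (2 * s) *\<^sub>R x) y"
  unfolding gauss_def of_real_mult[symmetric] exp_add[symmetric]
  by (simp add: inner_diff_left inner_diff_right inner_add_left inner_commute algebra_simps)

text \<open>Completing the square about the centre \<open>?t\<close> of the Gaussian reduces this to
  a translate of the centred case.\<close>

lemma gauss_integral:
  fixes b :: "'a::euclidean_space"
  assumes s: "s > 0"
  shows "(\<integral>x. gauss s b x \<partial>lborel) = of_real (exp ((b \<bullet> b) / (4 * s)) * gauss_mass TYPE('a) s)"
proof -
  let ?t = "(1 / (2 * s)) *\<^sub>R b"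
  have "gauss s b x = of_real (exp ((b \<bullet> b) / (4 * s))) * gauss s 0 (- ?t + x)" for x
    using gauss_translate[of s 0 x ?t] s
    by (simp add: of_real_mult[symmetric] exp_minus power2_eq_square del: of_real_mult)
  then have "(\<integral>x. gauss s b x \<partial>lborel) = of_real (exp ((b \<bullet> b) / (4 * s))) * (\<integral>x. gauss s 0 (- ?t + x) \<partial>lborel)"
    by simp
  also have "(\<integral>x. gauss s 0 (- ?t + x) \<partial>lborel) = (\<integral>x. gauss s 0 x \<partial>(lborel::'a measure))"
    by (rule lborel_integral_shift) simp
  finally show ?thesis by (simp add: gauss_integral_0)
qed

section \<open>Gaussians as superpositions of characters\<close>

text \<open>This is the characteristic function of the standard normal distribution with the
  normalisation removed.\<close>

lemma gauss_fourier_real: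
  shows "integrable lborel (\<lambda>x::real. of_real (exp (- x\<^sup>2 / 2)) * iexp (t * x))"
    and "(\<integral>x. of_real (exp (- x\<^sup>2 / 2)) * iexp (t * x) \<partial>lborel) = of_real (sqrt (2 * pi)) * of_real (exp (- t\<^sup>2 / 2))"
proof -
  have eq: "of_real (exp (- x\<^sup>2 / 2)) * iexp (t * x) = of_real (sqrt (2 * pi)) * (std_normal_density x *\<^sub>R iexp (t * x))" for x
    by (simp add: std_normal_density_def scaleR_conv_of_real)
  have "integrable lborel (\<lambda>x. std_normal_density x *\<^sub>R iexp (t * x))"
    by (rule Bochner_Integration.integrable_bound[of _ std_normal_density]) auto
  then show "integrable lborel (\<lambda>x::real. of_real (exp (- x\<^sup>2 / 2)) * iexp (t * x))"
    unfolding eq by (intro integrable_mult_right)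
  have "char std_normal_distribution t = (\<integral>x. std_normal_density x *\<^sub>R iexp (t * x) \<partial>lborel)"
    unfolding char_def by (subst integral_density) auto
  then have "(\<integral>x. std_normal_density x *\<^sub>R iexp (t * x) \<partial>lborel) = of_real (exp (- t\<^sup>2 / 2))"
    by (simp add: char_std_normal_distribution)
  then show "(\<integral>x. of_real (exp (- x\<^sup>2 / 2)) * iexp (t * x) \<partial>lborel) = of_real (sqrt (2 * pi)) * of_real (exp (- t\<^sup>2 / 2))"
    by (simp only: eq integral_mult_right_zero)
qed

text \<open>Gaussian and character both factor over the coordinates, which leaves a product of
  one-dimensional integrals. At width 1/2 the Gaussian is its own transform up to a
  constant.\<close>

lemma gauss_fourier_half:
  fixes y :: "'a::euclidean_space"
  shows "(\<integral>x. gauss (1/2) 0 x * iexp (y \<bullet> x) \<partial>lborel) = of_real (sqrt (2 * pi) ^ DIM('a)) * gauss (1/2) 0 y"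
proof -
  interpret product_sigma_finite "\<lambda>b::'a. lborel :: real measure" by standard
  let ?g = "\<lambda>b x. complex_of_real (exp (- x\<^sup>2 / 2)) * iexp ((y \<bullet> b) * x)"
  have g1: "gauss (1/2) 0 x = (\<Prod>b\<in>Basis. of_real (exp (- (x \<bullet> b)\<^sup>2 / 2)))" for x :: 'a
    unfolding gauss_def of_real_prod[symmetric] exp_sum[OF finite_Basis, symmetric]
    by (subst euclidean_inner) (simp add: sum_negf sum_divide_distrib power2_eq_square)
  have g2: "iexp (y \<bullet> x) = (\<Prod>b\<in>Basis. iexp ((y \<bullet> b) * (x \<bullet> b)))" for x :: 'a
    unfolding exp_sum[OF finite_Basis, symmetric]
    by (subst euclidean_inner) (simp add: sum_distrib_left)
  have eq: "gauss (1/2) 0 x * iexp (y \<bullet> x) = (\<Prod>b\<in>Basis. ?g b (x \<bullet> b))" for x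
    unfolding g1 g2 prod.distrib ..
  have "(\<integral>x. gauss (1/2) 0 x * iexp (y \<bullet> x) \<partial>lborel)
    = (\<integral>x. (\<Prod>b\<in>Basis. ?g b (x \<bullet> b)) \<partial>distr (\<Pi>\<^sub>M b\<in>(Basis::'a set). lborel) borel (\<lambda>f. \<Sum>b\<in>Basis. f b *\<^sub>R b))"
    unfolding eq by (rule arg_cong[OF lborel_eq, where f="\<lambda>M. \<integral>x. (\<Prod>b\<in>Basis. ?g b (x \<bullet> b)) \<partial>M"])
  also have "\<dots> = (\<integral>f. (\<Prod>b\<in>Basis. ?g b ((\<Sum>c\<in>Basis. f c *\<^sub>R c) \<bullet> b)) \<partial>(\<Pi>\<^sub>M b\<in>(Basis::'a set). lborel))"
    by (rule integral_distr) measurable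
  also have "\<dots> = (\<integral>f. (\<Prod>b\<in>Basis. ?g b (f b)) \<partial>(\<Pi>\<^sub>M b\<in>(Basis::'a set). lborel))"
    by (intro Bochner_Integration.integral_cong prod.cong refl) (simp add: inner_sum_left_Basis)
  also have "\<dots> = (\<Prod>b\<in>Basis. \<integral>x. ?g b x \<partial>lborel)"
    by (rule product_integral_prod[OF finite_Basis]) (rule gauss_fourier_real(1))
  also have "\<dots> = (\<Prod>b\<in>(Basis::'a set). of_real (sqrt (2 * pi)) * of_real (exp (- (y \<bullet> b)\<^sup>2 / 2)))"
    unfolding gauss_fourier_real ..
  also have "\<dots> = of_real (sqrt (2 * pi) ^ DIM('a)) * gauss (1/2) 0 y"
    unfolding prod.distrib g1 by simp
  finally show ?thesis .
qed

text \<open>The symmetry of \<open>w\<close> reflects that the Gaussian is real valued; it is what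
  lets the Gaussian pass unconjugated to the antilinear argument of the form.\<close>

lemma gauss_fourier:
  fixes b :: "'a::euclidean_space"
  assumes s: "s > 0"
  obtains w :: "'a \<Rightarrow> complex" where "rapid w"
    "\<And>x. gauss s b x = (\<integral>z. w z * iexp (x \<bullet> z) \<partial>lborel)"
    "\<And>z. w (- z) = cnj (w z)"
proof -
  \<comment> \<open>Scaling by \<open>r\<close> turns width 1/2 into width \<open>s\<close>, and on
    the dual side into \<open>1 / (4 * s)\<close>.\<close>
  define r where "r = sqrt (2 * s)"
  have r: "r > 0" "r * r = 2 * s" using s by (auto simp: r_def)
  let ?t = "(1 / (2 * s)) *\<^sub>R b"
  have base: "(\<integral>z. gauss (1 / (4 * s)) 0 z * iexp (y \<bullet> z) \<partial>lborel) = of_real (r ^ DIM('a) * sqrt (2 * pi) ^ DIM('a)) * gauss s 0 y" for y :: 'a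
  proof -
    have "(\<integral>z. gauss (1 / (4 * s)) 0 z * iexp (y \<bullet> z) \<partial>lborel)
        = (\<integral>z. gauss (1/2) 0 ((1 / r) *\<^sub>R z) * iexp ((r *\<^sub>R y) \<bullet> ((1 / r) *\<^sub>R z)) \<partial>lborel)"
      using r s by (intro Bochner_Integration.integral_cong refl) (simp add: gauss_def)
    also have "\<dots> = (1 / (1 / r)) ^ DIM('a) *\<^sub>R (\<integral>z. gauss (1/2) 0 z * iexp ((r *\<^sub>R y) \<bullet> z) \<partial>lborel)"
      using r by (intro lborel_integral_scale) auto
    also have "\<dots> = of_real (r ^ DIM('a) * sqrt (2 * pi) ^ DIM('a)) * gauss (1/2) 0 (r *\<^sub>R y)"
      unfolding gauss_fourier_half by (simp add: scaleR_conv_of_real)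
    also have "gauss (1/2) 0 (r *\<^sub>R y) = gauss s 0 y" using r by (simp add: gauss_def mult.assoc[symmetric])
    finally show ?thesis .
  qed
  define k where "k = r ^ DIM('a) * sqrt (2 * pi) ^ DIM('a)"
  have k: "k \<noteq> 0" using r by (simp add: k_def)
  \<comment> \<open>The shift of the centre to \<open>?t\<close> becomes a character, the
    exponential factor comes from completing the square, and \<open>k\<close> normalises the
    transform.\<close>
  define w where "w z = of_real (exp ((b \<bullet> b) / (4 * s)) / k) * (iexp (z \<bullet> (- ?t)) * gauss (1 / (4 * s)) 0 z)" for z
  show ?thesis
  proof
    show "rapid w" unfolding w_def
      using s by (intro rapid_cmult schwartz_rapid schwartz_modulate schwartz_gauss) auto
    show "w (- z) = cnj (w z)" for z by (simp add: w_def gauss_def exp_cnj)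
    fix x
    have "(\<integral>z. w z * iexp (x \<bullet> z) \<partial>lborel) =
        (\<integral>z. of_real (exp ((b \<bullet> b) / (4 * s)) / k) * (gauss (1 / (4 * s)) 0 z * iexp ((x - ?t) \<bullet> z)) \<partial>lborel)"
      unfolding w_def
    proof (intro Bochner_Integration.integral_cong refl)
      fix z
      have "iexp (z \<bullet> (- ?t)) * iexp (x \<bullet> z) = iexp ((x - ?t) \<bullet> z)"
        unfolding exp_add[symmetric] by (simp add: inner_diff_left inner_commute[of z] right_diff_distrib)
      then show "of_real (exp ((b \<bullet> b) / (4 * s)) / k) * (iexp (z \<bullet> (- ?t)) * gauss (1 / (4 * s)) 0 z) * iexp (x \<bullet> z)
        = of_real (exp ((b \<bullet> b) / (4 * s)) / k) * (gauss (1 / (4 * s)) 0 z * iexp ((x - ?t) \<bullet> z))"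
        by (simp only: mult.assoc mult.left_commute[of _ "gauss _ _ _"])
    qed
    also have "\<dots> = of_real (exp ((b \<bullet> b) / (4 * s)) / k) * (of_real k * gauss s 0 (x - ?t))"
      unfolding integral_mult_right_zero base k_def ..
    also have "\<dots> = of_real (exp ((b \<bullet> b) / (4 * s))) * gauss s 0 (x - ?t)" using k by simp
    also have "\<dots> = gauss s b x"
      using gauss_translate[of s 0 x ?t] s
      by (simp add: of_real_mult[symmetric] exp_minus power2_eq_square del: of_real_mult)
    finally show "gauss s b x = (\<integral>z. w z * iexp (x \<bullet> z) \<partial>lborel)" by simp
  qed
qed

text \<open>The product is a superposition of modulates of \<open>\<phi>\<close> with rapid weight,
  so \<open>schwartz_family_integral\<close> does the work of a Leibniz formula.\<close>

lemma schwartz_gauss_mult: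
  assumes s: "s > 0" and \<phi>: "schwartz \<phi>"
  shows "schwartz (\<lambda>y. gauss s b y * \<phi> y)"
proof -
  obtain w where w: "rapid w" "\<And>x. gauss s b x = (\<integral>z. w z * iexp (x \<bullet> z) \<partial>lborel)"
    using gauss_fourier[OF s] by metis
  have "(\<lambda>y. \<integral>z. w z * (iexp (y \<bullet> z) * \<phi> y) \<partial>lborel) = (\<lambda>y. gauss s b y * \<phi> y)"
    unfolding w(2) by (simp add: mult.assoc[symmetric])
  with schwartz_family_integral[OF w(1) schwartz_family_modulate[OF \<phi>]] show ?thesis by simp
qed

section \<open>Square-integrable functions\<close>

lemma square_integrable_measurable: "square_integrable f \<Longrightarrow> f \<in> borel_measurable lebesgue"
  by (simp add: square_integrable_def)

lemma square_integrableI_bound: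
  assumes m: "f \<in> borel_measurable lebesgue" and g: "integrable lebesgue g" and le: "\<And>x. (cmod (f x))\<^sup>2 \<le> g x"
  shows "square_integrable f"
  unfolding square_integrable_def
proof
  have "(\<lambda>x. (cmod (f x))\<^sup>2) \<in> borel_measurable lebesgue" using m by measurable
  from Bochner_Integration.integrable_bound[OF g this] show "integrable lebesgue (\<lambda>x. (cmod (f x))\<^sup>2)"
    using le by (auto intro!: AE_I2 order_trans[OF le abs_ge_self])
qed (rule m)

lemma cmod_add_sq: "(cmod (a + b))\<^sup>2 \<le> 2 * (cmod a)\<^sup>2 + 2 * (cmod b)\<^sup>2"
proof -
  have "(cmod (a + b))\<^sup>2 \<le> (cmod a + cmod b)\<^sup>2" by (intro power_mono norm_triangle_ineq) auto
  also have "\<dots> \<le> 2 * (cmod a)\<^sup>2 + 2 * (cmod b)\<^sup>2"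
    using sum_squares_bound[of "cmod a" "cmod b"] by (simp add: power2_sum)
  finally show ?thesis .
qed

lemma square_integrable_add:
  assumes f: "square_integrable f" and g: "square_integrable g"
  shows "square_integrable (\<lambda>x. f x + g x)"
proof (rule square_integrableI_bound)
  show "integrable lebesgue (\<lambda>x. 2 * (cmod (f x))\<^sup>2 + 2 * (cmod (g x))\<^sup>2)"
    using f g by (auto simp: square_integrable_def)
  show "(\<lambda>x. f x + g x) \<in> borel_measurable lebesgue" using f g by (auto simp: square_integrable_def)
qed (rule cmod_add_sq)

lemma square_integrable_cmult: "square_integrable f \<Longrightarrow> square_integrable (\<lambda>x. c * f x)"
  by (auto simp: square_integrable_def norm_mult power_mult_distrib)

lemma square_integrable_diff:
  "square_integrable f \<Longrightarrow> square_integrable g \<Longrightarrow> square_integrable (\<lambda>x. f x - g x)"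
  using square_integrable_add[of f "\<lambda>x. (-1) * g x"] square_integrable_cmult[of g "-1"] by simp

lemma square_integrable_cnj: "square_integrable f \<Longrightarrow> square_integrable (\<lambda>x. cnj (f x))"
  unfolding square_integrable_def complex_mod_cnj
  by (auto intro!: borel_measurable_continuous_on[of cnj] continuous_intros)

lemma L2_norm_fun_nonneg: "0 \<le> L2_norm_fun f"
  by (simp add: L2_norm_fun_def)

lemma L2_norm_fun_sq: "(L2_norm_fun f)\<^sup>2 = (\<integral>x. (cmod (f x))\<^sup>2 \<partial>lebesgue)"
  by (simp add: L2_norm_fun_def)

lemma L2_norm_fun_cmult: "L2_norm_fun (\<lambda>x. c * f x) = cmod c * L2_norm_fun f"
  by (simp add: L2_norm_fun_def norm_mult power_mult_distrib real_sqrt_mult)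

lemma L2_norm_fun_minus_commute: "L2_norm_fun (\<lambda>x. f x - g x) = L2_norm_fun (\<lambda>x. g x - f x)"
  by (simp add: L2_norm_fun_def norm_minus_commute)

lemma L2_norm_fun_cnj: "L2_norm_fun (\<lambda>x. cnj (f x)) = L2_norm_fun f"
  by (simp add: L2_norm_fun_def)

lemma square_integrable_mult:
  assumes f: "square_integrable f" and g: "square_integrable g"
  shows "integrable lebesgue (\<lambda>x. f x * g x)"
proof (rule Bochner_Integration.integrable_bound)
  show "integrable lebesgue (\<lambda>x. (cmod (f x))\<^sup>2 + (cmod (g x))\<^sup>2)"
    using f g by (auto simp: square_integrable_def)
  show "(\<lambda>x. f x * g x) \<in> borel_measurable lebesgue" using f g by (auto simp: square_integrable_def)
  have "norm (f x * g x) \<le> norm ((cmod (f x))\<^sup>2 + (cmod (g x))\<^sup>2)" for x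
  proof -
    have "norm (f x * g x) \<le> 2 * cmod (f x) * cmod (g x)" by (simp add: norm_mult)
    also have "\<dots> \<le> (cmod (f x))\<^sup>2 + (cmod (g x))\<^sup>2" by (rule sum_squares_bound)
    finally show ?thesis by simp
  qed
  then show "AE x in lebesgue. norm (f x * g x) \<le> norm ((cmod (f x))\<^sup>2 + (cmod (g x))\<^sup>2)" by simp
qed

lemma L2_cauchy_schwarz:
  assumes f: "square_integrable f" and g: "square_integrable g"
  shows "(\<integral>x. cmod (f x) * cmod (g x) \<partial>lebesgue) \<le> L2_norm_fun f * L2_norm_fun g"
proof -
  let ?c = "\<integral>x. cmod (f x) * cmod (g x) \<partial>lebesgue"
  have i: "integrable lebesgue (\<lambda>x. cmod (f x) * cmod (g x))"
    using integrable_norm[OF square_integrable_mult[OF f g]] by (simp add: norm_mult)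
  have if': "integrable lebesgue (\<lambda>x. (cmod (f x))\<^sup>2)" and ig: "integrable lebesgue (\<lambda>x. (cmod (g x))\<^sup>2)"
    using f g by (auto simp: square_integrable_def)
  have [measurable]: "f \<in> borel_measurable lebesgue" "g \<in> borel_measurable lebesgue"
    using f g by (auto simp: square_integrable_def)
  have nn: "(\<integral>\<^sup>+x. ennreal (cmod (f x)) * ennreal (cmod (g x)) \<partial>lebesgue)\<^sup>2
      \<le> (\<integral>\<^sup>+x. ennreal (cmod (f x)) ^ 2 \<partial>lebesgue) * (\<integral>\<^sup>+x. ennreal (cmod (g x)) ^ 2 \<partial>lebesgue)"
    by (rule Cauchy_Schwarz_nn_integral) measurable
  have "(\<integral>\<^sup>+x. ennreal (cmod (f x)) * ennreal (cmod (g x)) \<partial>lebesgue) = ennreal ?c"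
    unfolding ennreal_mult[symmetric, OF norm_ge_zero norm_ge_zero] by (rule nn_integral_eq_integral[OF i]) simp
  moreover have "(\<integral>\<^sup>+x. ennreal (cmod (h x)) ^ 2 \<partial>lebesgue) = ennreal ((L2_norm_fun h)\<^sup>2)"
    if "integrable lebesgue (\<lambda>x. (cmod (h x))\<^sup>2)" for h :: "'a \<Rightarrow> complex"
    unfolding L2_norm_fun_sq using that by (simp add: ennreal_power nn_integral_eq_integral)
  ultimately have "ennreal (?c\<^sup>2) \<le> ennreal ((L2_norm_fun f)\<^sup>2 * (L2_norm_fun g)\<^sup>2)"
    using nn if' ig by (simp add: ennreal_power ennreal_mult)
  then have "?c\<^sup>2 \<le> (L2_norm_fun f * L2_norm_fun g)\<^sup>2" by (simp add: power_mult_distrib)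
  then show ?thesis by (rule power2_le_imp_le) (simp add: L2_norm_fun_nonneg)
qed

lemma L2_pairing_bound:
  assumes f: "square_integrable f" and g: "square_integrable g"
  shows "cmod (\<integral>x. f x * g x \<partial>lebesgue) \<le> L2_norm_fun f * L2_norm_fun g"
  using integral_norm_bound[of lebesgue "\<lambda>x. f x * g x"] L2_cauchy_schwarz[OF f g] by (simp add: norm_mult)

lemma L2_triangle:
  assumes f: "square_integrable f" and g: "square_integrable g"
  shows "L2_norm_fun (\<lambda>x. f x + g x) \<le> L2_norm_fun f + L2_norm_fun g"
proof (rule power2_le_imp_le)
  have if': "integrable lebesgue (\<lambda>x. (cmod (f x))\<^sup>2)" and ig: "integrable lebesgue (\<lambda>x. (cmod (g x))\<^sup>2)"
    using f g by (auto simp: square_integrable_def)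
  have i: "integrable lebesgue (\<lambda>x. cmod (f x) * cmod (g x))"
    using integrable_norm[OF square_integrable_mult[OF f g]] by (simp add: norm_mult)
  have "(L2_norm_fun (\<lambda>x. f x + g x))\<^sup>2 \<le> (\<integral>x. (cmod (f x))\<^sup>2 + (cmod (g x))\<^sup>2 + 2 * (cmod (f x) * cmod (g x)) \<partial>lebesgue)"
    unfolding L2_norm_fun_sq
  proof (rule integral_mono)
    show "integrable lebesgue (\<lambda>x. (cmod (f x + g x))\<^sup>2)" using square_integrable_add[OF f g] by (simp add: square_integrable_def)
    show "integrable lebesgue (\<lambda>x. (cmod (f x))\<^sup>2 + (cmod (g x))\<^sup>2 + 2 * (cmod (f x) * cmod (g x)))"
      using if' ig i by auto
    show "(cmod (f x + g x))\<^sup>2 \<le> (cmod (f x))\<^sup>2 + (cmod (g x))\<^sup>2 + 2 * (cmod (f x) * cmod (g x))" for x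
      using power_mono[OF norm_triangle_ineq[of "f x" "g x"] norm_ge_zero, of 2] by (simp add: power2_sum mult.assoc)
  qed
  also have "\<dots> = (L2_norm_fun f)\<^sup>2 + (L2_norm_fun g)\<^sup>2 + 2 * (\<integral>x. cmod (f x) * cmod (g x) \<partial>lebesgue)"
    using if' ig i by (simp add: L2_norm_fun_sq)
  also have "\<dots> \<le> (L2_norm_fun f + L2_norm_fun g)\<^sup>2"
    using L2_cauchy_schwarz[OF f g] by (simp add: power2_sum)
  finally show "(L2_norm_fun (\<lambda>x. f x + g x))\<^sup>2 \<le> (L2_norm_fun f + L2_norm_fun g)\<^sup>2" .
qed (simp add: L2_norm_fun_nonneg)

lemma L2_norm_fun_tendsto:
  assumes f: "\<And>n. square_integrable (f n)" and g: "square_integrable g"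
    and lim: "(\<lambda>n. L2_norm_fun (\<lambda>x. f n x - g x)) \<longlonglongrightarrow> 0"
  shows "(\<lambda>n. L2_norm_fun (f n)) \<longlonglongrightarrow> L2_norm_fun g"
proof -
  have "(\<lambda>n. L2_norm_fun (f n) - L2_norm_fun g) \<longlonglongrightarrow> 0"
  proof (rule Lim_null_comparison[OF _ lim], intro always_eventually allI)
    fix n
    show "norm (L2_norm_fun (f n) - L2_norm_fun g) \<le> L2_norm_fun (\<lambda>x. f n x - g x)"
      using L2_triangle[OF square_integrable_diff[OF f g] g, of n] L2_triangle[OF square_integrable_diff[OF g f] f, of n n]
        L2_norm_fun_minus_commute[of "f n" g] by (simp add: abs_le_iff)
  qed
  then show ?thesis by (rule LIM_zero_cancel)
qed

lemma L2_norm_le_of_nn_integral: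
  assumes m: "f \<in> borel_measurable lebesgue" and le: "(\<integral>\<^sup>+x. ennreal ((cmod (f x))\<^sup>2) \<partial>lebesgue) \<le> ennreal (e\<^sup>2)" and e: "e \<ge> 0"
  shows "square_integrable f" "L2_norm_fun f \<le> e"
proof -
  have m2: "(\<lambda>x. (cmod (f x))\<^sup>2) \<in> borel_measurable lebesgue" using m by measurable
  have "(\<integral>\<^sup>+x. ennreal (norm ((cmod (f x))\<^sup>2)) \<partial>lebesgue) < \<infinity>"
    using order_le_less_trans[OF le ennreal_less_top] by simp
  with m2 have i: "integrable lebesgue (\<lambda>x. (cmod (f x))\<^sup>2)" by (rule integrableI_bounded)
  with m show "square_integrable f" by (simp add: square_integrable_def)
  have "ennreal ((L2_norm_fun f)\<^sup>2) \<le> ennreal (e\<^sup>2)"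
    unfolding L2_norm_fun_sq using le nn_integral_eq_integral[OF i] by simp
  then have "(L2_norm_fun f)\<^sup>2 \<le> e\<^sup>2" by simp
  then show "L2_norm_fun f \<le> e" using e by (rule power2_le_imp_le)
qed

lemma L2_nn_integral:
  assumes "square_integrable f"
  shows "(\<integral>\<^sup>+x. ennreal ((cmod (f x))\<^sup>2) \<partial>lebesgue) = ennreal ((L2_norm_fun f)\<^sup>2)"
  unfolding L2_norm_fun_sq using assms by (intro nn_integral_eq_integral) (auto simp: square_integrable_def)

text \<open>The increments are bounded by a geometric sequence of ratio \<open>sqrt (1 / 2)\<close>,
  so their series converges absolutely.\<close>

lemma convergent_of_geometric_increments:
  fixes a :: "nat \<Rightarrow> complex"
  assumes "\<And>k. 2 ^ k * (cmod (a (Suc k) - a k))\<^sup>2 \<le> S"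
  shows "convergent a"
proof -
  let ?q = "sqrt (1 / 2)"
  have "cmod (a (Suc k) - a k) \<le> sqrt S * ?q ^ k" for k
  proof -
    have "(cmod (a (Suc k) - a k))\<^sup>2 \<le> S * (1 / 2) ^ k" using assms[of k] by (simp add: field_simps power_one_over)
    then have "cmod (a (Suc k) - a k) \<le> sqrt (S * (1 / 2) ^ k)" by (rule real_le_rsqrt)
    then show ?thesis by (simp add: real_sqrt_mult real_sqrt_power)
  qed
  moreover have "summable (\<lambda>k. sqrt S * ?q ^ k)"
    by (intro summable_mult summable_geometric) (simp add: real_sqrt_lt_1_iff)
  ultimately have "summable (\<lambda>k. a (Suc k) - a k)"
    by (rule_tac summable_comparison_test[of _ "\<lambda>k. sqrt S * ?q ^ k"]) auto
  then have "convergent (\<lambda>n. a n - a 0)"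
    unfolding summable_iff_convergent sum_lessThan_telescope .
  then show ?thesis using convergent_diff_const_right_iff by blast
qed

text \<open>Riesz-Fischer: a subsequence converges almost everywhere, and Fatou's lemma shows that
  its pointwise limit is also the limit in norm.\<close>

lemma L2_complete:
  fixes f :: "nat \<Rightarrow> 'a::euclidean_space \<Rightarrow> complex"
  assumes f: "\<And>n. square_integrable (f n)"
    and cauchy: "\<And>e. e > 0 \<Longrightarrow> \<exists>M. \<forall>m\<ge>M. \<forall>n\<ge>M. L2_norm_fun (\<lambda>x. f m x - f n x) < e"
  obtains g where "square_integrable g" "(\<lambda>n. L2_norm_fun (\<lambda>x. f n x - g x)) \<longlonglongrightarrow> 0"
proof -
  have [measurable]: "f n \<in> borel_measurable lebesgue" for n using f by (simp add: square_integrable_def)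
  have "\<forall>k. \<exists>M. \<forall>m\<ge>M. \<forall>n\<ge>M. L2_norm_fun (\<lambda>x. f m x - f n x) < (1/2) ^ k" using cauchy by simp
  then obtain M where M: "\<And>k m n. m \<ge> M k \<Longrightarrow> n \<ge> M k \<Longrightarrow> L2_norm_fun (\<lambda>x. f m x - f n x) < (1/2) ^ k" by metis
  \<comment> \<open>The partial sums of \<open>M\<close> make \<open>r\<close> monotone and at least
    \<open>M k\<close>; the summand \<open>k\<close> makes it unbounded.\<close>
  define r where "r k = k + (\<Sum>i\<le>k. M i)" for k
  have r1: "r k \<ge> M k" for k unfolding r_def by (simp add: trans_le_add2 member_le_sum[of k "{..k}" M])
  have r2: "r (Suc k) \<ge> r k" for k unfolding r_def by simp
  have r3: "r k \<ge> k" for k unfolding r_def by simp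
  define D where "D k x = f (r (Suc k)) x - f (r k) x" for k x
  have Dsq: "square_integrable (D k)" for k unfolding D_def by (intro square_integrable_diff f)
  have [measurable]: "D k \<in> borel_measurable lebesgue" for k unfolding D_def by measurable
  have D_le: "(L2_norm_fun (D k))\<^sup>2 \<le> (1/4) ^ k" for k
  proof -
    have "L2_norm_fun (D k) \<le> (1/2) ^ k"
      unfolding D_def using M[of k "r (Suc k)" "r k"] r1[of k] r2[of k] by simp
    then have "(L2_norm_fun (D k))\<^sup>2 \<le> ((1/2) ^ k)\<^sup>2" by (intro power_mono L2_norm_fun_nonneg)
    also have "\<dots> = ((1/2)\<^sup>2) ^ k" by (simp only: power_mult[symmetric] mult.commute)
    finally show ?thesis by (simp add: power2_eq_square)
  qed
  \<comment> \<open>The factor \<open>2 ^ k\<close> against squared norms at most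
    \<open>(1/4) ^ k\<close> leaves a convergent sum, and finiteness of the series at a point forces
    geometric decay of the increments there.\<close>
  have "(\<integral>\<^sup>+x. (\<Sum>k. ennreal (2 ^ k * (cmod (D k x))\<^sup>2)) \<partial>lebesgue) = (\<Sum>k. \<integral>\<^sup>+x. ennreal (2 ^ k * (cmod (D k x))\<^sup>2) \<partial>lebesgue)"
    by (rule nn_integral_suminf) measurable
  also have "\<dots> \<le> (\<Sum>k. ennreal ((1/2) ^ k))"
  proof (intro suminf_le summableI)
    fix k
    have "(\<integral>\<^sup>+x. ennreal (2 ^ k * (cmod (D k x))\<^sup>2) \<partial>lebesgue) = ennreal (2 ^ k) * (\<integral>\<^sup>+x. ennreal ((cmod (D k x))\<^sup>2) \<partial>lebesgue)"
      by (subst nn_integral_cmult[symmetric]) (auto simp: ennreal_mult)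
    also have "\<dots> = ennreal (2 ^ k * (L2_norm_fun (D k))\<^sup>2)"
      unfolding L2_nn_integral[OF Dsq] by (rule ennreal_mult[symmetric]) auto
    also have "\<dots> \<le> ennreal (2 ^ k * (1/4) ^ k)" by (intro ennreal_leI mult_left_mono D_le) auto
    also have "2 ^ k * (1/4) ^ k = ((1/2) ^ k :: real)" unfolding power_mult_distrib[symmetric] by simp
    finally show "(\<integral>\<^sup>+x. ennreal (2 ^ k * (cmod (D k x))\<^sup>2) \<partial>lebesgue) \<le> ennreal ((1/2) ^ k)" .
  qed
  also have "\<dots> = ennreal (\<Sum>k. (1/2) ^ k)" by (rule suminf_ennreal2) (auto intro: summable_geometric)
  finally have "(\<integral>\<^sup>+x. (\<Sum>k. ennreal (2 ^ k * (cmod (D k x))\<^sup>2)) \<partial>lebesgue) < \<infinity>"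
    by (rule order_le_less_trans) simp
  then have "(\<integral>\<^sup>+x. (\<Sum>k. ennreal (2 ^ k * (cmod (D k x))\<^sup>2)) \<partial>lebesgue) \<noteq> \<infinity>" by simp
  then have "AE x in lebesgue. (\<Sum>k. ennreal (2 ^ k * (cmod (D k x))\<^sup>2)) \<noteq> \<infinity>"
    by (intro nn_integral_noteq_infinite) auto
  then have conv: "AE x in lebesgue. convergent (\<lambda>k. f (r k) x)"
  proof (eventually_elim)
    case (elim x)
    define S where "S = (\<Sum>k. ennreal (2 ^ k * (cmod (D k x))\<^sup>2))"
    have S: "S < \<infinity>" using elim by (simp add: S_def less_top)
    have "2 ^ k * (cmod (D k x))\<^sup>2 \<le> enn2real S" for k
    proof -
      have "(\<Sum>i\<in>{k}. ennreal (2 ^ i * (cmod (D i x))\<^sup>2)) \<le> S"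
        unfolding S_def by (rule sum_le_suminf[OF summableI]) auto
      then have "ennreal (2 ^ k * (cmod (D k x))\<^sup>2) \<le> S"
        by (simp only: sum.insert_if sum.empty finite.emptyI empty_iff if_False add_0_right)
      also have "S = ennreal (enn2real S)" by (rule ennreal_enn2real[symmetric]) (use S in simp)
      finally show ?thesis by (subst (asm) ennreal_le_iff) auto
    qed
    then show ?case unfolding D_def by (intro convergent_of_geometric_increments)
  qed
  define g where "g x = lim (\<lambda>k. f (r k) x)" for x
  have gm [measurable]: "g \<in> borel_measurable lebesgue" unfolding g_def by measurable
  have gl: "AE x in lebesgue. (\<lambda>k. f (r k) x) \<longlonglongrightarrow> g x"
    using conv by eventually_elim (simp add: g_def convergent_LIMSEQ_iff)
  have close: "square_integrable (\<lambda>x. f n x - g x) \<and> L2_norm_fun (\<lambda>x. f n x - g x) \<le> e"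
    if e: "e > 0" and K: "\<And>m n. m \<ge> K \<Longrightarrow> n \<ge> K \<Longrightarrow> L2_norm_fun (\<lambda>x. f m x - f n x) < e" and n: "n \<ge> K" for e K n
  proof -
    have "(\<integral>\<^sup>+x. ennreal ((cmod (f n x - g x))\<^sup>2) \<partial>lebesgue) \<le> (\<integral>\<^sup>+x. liminf (\<lambda>k. ennreal ((cmod (f n x - f (r k) x))\<^sup>2)) \<partial>lebesgue)"
    proof (rule nn_integral_mono_AE)
      show "AE x in lebesgue. ennreal ((cmod (f n x - g x))\<^sup>2) \<le> liminf (\<lambda>k. ennreal ((cmod (f n x - f (r k) x))\<^sup>2))"
        using gl
      proof eventually_elim
        case (elim x)
        have "(\<lambda>k. ennreal ((cmod (f n x - f (r k) x))\<^sup>2)) \<longlonglongrightarrow> ennreal ((cmod (f n x - g x))\<^sup>2)"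
          by (intro tendsto_ennrealI tendsto_intros elim)
        then have "liminf (\<lambda>k. ennreal ((cmod (f n x - f (r k) x))\<^sup>2)) = ennreal ((cmod (f n x - g x))\<^sup>2)"
          by (intro lim_imp_Liminf) auto
        then show ?case by simp
      qed
    qed
    also have "\<dots> \<le> liminf (\<lambda>k. \<integral>\<^sup>+x. ennreal ((cmod (f n x - f (r k) x))\<^sup>2) \<partial>lebesgue)"
      by (rule nn_integral_liminf) measurable
    also have "\<dots> \<le> ennreal (e\<^sup>2)"
    proof (rule Liminf_le)
      show "\<forall>\<^sub>F k in sequentially. (\<integral>\<^sup>+x. ennreal ((cmod (f n x - f (r k) x))\<^sup>2) \<partial>lebesgue) \<le> ennreal (e\<^sup>2)"
      proof (rule eventually_sequentiallyI[of K])
        fix k assume "K \<le> k"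
        then have "L2_norm_fun (\<lambda>x. f n x - f (r k) x) \<le> e" using K[OF n, of "r k"] r3[of k] by simp
        then show "(\<integral>\<^sup>+x. ennreal ((cmod (f n x - f (r k) x))\<^sup>2) \<partial>lebesgue) \<le> ennreal (e\<^sup>2)"
          unfolding L2_nn_integral[OF square_integrable_diff[OF f f]]
          by (intro ennreal_leI power_mono L2_norm_fun_nonneg)
      qed
    qed simp
    finally show ?thesis using e by (intro conjI L2_norm_le_of_nn_integral) auto
  qed
  obtain K where K: "\<And>m n. m \<ge> K \<Longrightarrow> n \<ge> K \<Longrightarrow> L2_norm_fun (\<lambda>x. f m x - f n x) < 1" using cauchy[of 1] by auto
  have "square_integrable (\<lambda>x. f K x - g x)" using close[of 1 K K] K by auto
  from square_integrable_diff[OF f[of K] this] have "square_integrable g" by simp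
  moreover have "(\<lambda>n. L2_norm_fun (\<lambda>x. f n x - g x)) \<longlonglongrightarrow> 0"
  proof (rule LIMSEQ_I)
    fix e :: real assume e: "e > 0"
    obtain K where "\<And>m n. m \<ge> K \<Longrightarrow> n \<ge> K \<Longrightarrow> L2_norm_fun (\<lambda>x. f m x - f n x) < e / 2" using cauchy[of "e / 2"] e by auto
    then have le: "L2_norm_fun (\<lambda>x. f n x - g x) \<le> e / 2" if "n \<ge> K" for n using close[of "e / 2" K n] e that by auto
    have "norm (L2_norm_fun (\<lambda>x. f n x - g x) - 0) < e" if "n \<ge> K" for n
      using le[OF that] L2_norm_fun_nonneg[of "\<lambda>x. f n x - g x"] e by simp
    then show "\<exists>no. \<forall>n\<ge>no. norm (L2_norm_fun (\<lambda>x. f n x - g x) - 0) < e" by blast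
  qed
  ultimately show ?thesis by (rule that)
qed

section \<open>Gaussian mollification\<close>

lemma gauss_rescale:
  fixes h :: "'a::euclidean_space \<Rightarrow> complex"
  assumes h: "h \<in> borel_measurable borel" and m: "m > 0"
  shows "of_real (m ^ DIM('a)) * (\<integral>x. gauss (m\<^sup>2) 0 x * h x \<partial>lborel) = (\<integral>x. gauss 1 0 x * h ((1 / m) *\<^sub>R x) \<partial>lborel)"
proof -
  let ?f = "\<lambda>x. gauss 1 0 x * h ((1 / m) *\<^sub>R x)"
  have hm: "(\<lambda>x. h ((1 / m) *\<^sub>R x)) \<in> borel_measurable borel"
    using h by (intro measurable_compose[OF _ h]) measurable
  have fm: "?f \<in> borel_measurable borel" using hm by measurable
  have "(\<integral>x. gauss (m\<^sup>2) 0 x * h x \<partial>lborel) = (\<integral>x. ?f (m *\<^sub>R x) \<partial>lborel)"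
    using m by (simp add: gauss_def power2_eq_square mult.assoc)
  also have "\<dots> = (1 / m) ^ DIM('a) *\<^sub>R (\<integral>x. ?f x \<partial>lborel)"
    by (rule lborel_integral_scale[OF fm m])
  finally show ?thesis using m by (simp add: scaleR_conv_of_real power_one_over)
qed

text \<open>Rescaling moves \<open>n\<close> from the kernel into the argument of \<open>h\<close>,
  where the fixed kernel \<open>gauss 1 0\<close> dominates polynomial growth. Such growth is
  allowed because \<open>h\<close> will also be a distribution evaluated at translates of a test
  function.\<close>

lemma gauss_approx_identity:
  fixes h :: "'a::euclidean_space \<Rightarrow> complex"
  assumes h: "h \<in> borel_measurable borel" and bd: "\<And>x. norm (h x) \<le> C * wt x ^ K" and C: "C \<ge> 0" and c: "isCont h 0"
  shows "(\<lambda>n. of_real (real (Suc n) ^ DIM('a)) * (\<integral>x. gauss ((real (Suc n))\<^sup>2) 0 x * h x \<partial>lborel))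
    \<longlonglongrightarrow> of_real (gauss_mass TYPE('a) 1) * h 0"
proof -
  have hm: "(\<lambda>x. h (r *\<^sub>R x)) \<in> borel_measurable borel" for r
    by (intro measurable_compose[OF _ h]) measurable
  have R: "rapid (gauss 1 (0::'a))" by (intro schwartz_rapid schwartz_gauss) simp
  have "(\<lambda>n. \<integral>x. gauss 1 0 x * h ((1 / real (Suc n)) *\<^sub>R x) \<partial>lborel) \<longlonglongrightarrow> (\<integral>x. gauss 1 0 x * h 0 \<partial>(lborel::'a measure))"
  proof (rule integral_dominated_convergence[where w="\<lambda>x. C * (wt x ^ K * norm (gauss 1 0 x))"])
    show "(\<lambda>x. gauss 1 0 x * h ((1 / real (Suc n)) *\<^sub>R x)) \<in> borel_measurable lborel" for n
      using hm[of "1 / real (Suc n)"] by measurable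
    show "integrable lborel (\<lambda>x::'a. C * (wt x ^ K * norm (gauss 1 0 x)))"
      using R unfolding rapid_def by (intro integrable_mult_right) blast
    show "AE x in lborel. (\<lambda>n. gauss 1 0 x * h ((1 / real (Suc n)) *\<^sub>R x)) \<longlonglongrightarrow> gauss 1 0 x * h 0"
    proof (intro AE_I2 tendsto_mult tendsto_const)
      fix x :: 'a
      have "(\<lambda>n. (1 / real (Suc n)) *\<^sub>R x) \<longlonglongrightarrow> 0 *\<^sub>R x"
        using LIMSEQ_inverse_real_of_nat by (intro tendsto_scaleR tendsto_const) (simp add: inverse_eq_divide)
      then have "(\<lambda>n. (1 / real (Suc n)) *\<^sub>R x) \<longlonglongrightarrow> 0" by simp
      then show "(\<lambda>n. h ((1 / real (Suc n)) *\<^sub>R x)) \<longlonglongrightarrow> h 0" by (rule isCont_tendsto_compose[OF c])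
    qed
    show "AE x in lborel. norm (gauss 1 0 x * h ((1 / real (Suc n)) *\<^sub>R x)) \<le> C * (wt x ^ K * norm (gauss 1 0 x))" for n
    proof (rule AE_I2)
      fix x :: 'a
      have "norm ((1 / real (Suc n)) *\<^sub>R x) \<le> 1 * norm x"
        unfolding norm_scaleR by (intro mult_right_mono) (auto simp: field_simps)
      then have "wt ((1 / real (Suc n)) *\<^sub>R x) ^ K \<le> wt x ^ K" by (intro power_mono) auto
      then have "norm (h ((1 / real (Suc n)) *\<^sub>R x)) \<le> C * wt x ^ K"
        by (intro order_trans[OF bd] mult_left_mono C)
      then have "norm (gauss 1 0 x) * norm (h ((1 / real (Suc n)) *\<^sub>R x)) \<le> norm (gauss 1 0 x) * (C * wt x ^ K)"
        by (intro mult_left_mono) auto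
      then show "norm (gauss 1 0 x * h ((1 / real (Suc n)) *\<^sub>R x)) \<le> C * (wt x ^ K * norm (gauss 1 0 x))"
        by (simp add: norm_mult mult_ac)
    qed
  qed measurable
  moreover have "(\<integral>x. gauss 1 0 x * h 0 \<partial>(lborel::'a measure)) = of_real (gauss_mass TYPE('a) 1) * h 0"
    by (simp add: gauss_integral_0)
  moreover have "of_real (real (Suc n) ^ DIM('a)) * (\<integral>x. gauss ((real (Suc n))\<^sup>2) 0 x * h x \<partial>lborel)
      = (\<integral>x. gauss 1 0 x * h ((1 / real (Suc n)) *\<^sub>R x) \<partial>lborel)" for n
    by (rule gauss_rescale[OF h]) simp
  ultimately show ?thesis by (simp only:)
qed

lemma convolution_commute:
  fixes f g :: "'a::euclidean_space \<Rightarrow> complex"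
  assumes [measurable]: "f \<in> borel_measurable borel" "g \<in> borel_measurable borel"
  shows "(\<integral>x. f x * g (y - x) \<partial>lborel) = (\<integral>x. g x * f (y - x) \<partial>lborel)"
proof -
  have "(\<lambda>x. g x * f (y - x)) \<in> borel_measurable borel" by measurable
  from lborel_integral_reflect[OF this, of y] show ?thesis by (simp add: mult.commute)
qed

text \<open>The convolution of \<open>\<phi>\<close> with a Gaussian is read in two ways: as a
  superposition of translates of \<open>\<phi>\<close>, which passes to the limit, and as one of
  translated Gaussians, on which \<open>T1\<close> and \<open>T2\<close> agree.\<close>

lemma tempered_eq_of_gauss:
  fixes T1 T2 :: "('a::euclidean_space \<Rightarrow> complex) \<Rightarrow> complex"
  assumes T1: "tempered T1" and T2: "tempered T2"
    and eq: "\<And>s b. s > 0 \<Longrightarrow> T1 (gauss s b) = T2 (gauss s b)"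
  shows "T1 = T2"
proof
  fix \<phi> :: "'a \<Rightarrow> complex"
  show "T1 \<phi> = T2 \<phi>"
  proof (cases "schwartz \<phi>")
    case False
    then show ?thesis using tempered_outside T1 T2 by metis
  next
    case S: True
    define a where "a n T = of_real (real (Suc n) ^ DIM('a)) * T (\<lambda>y. \<integral>x. gauss ((real (Suc n))\<^sup>2) 0 x * \<phi> (y - x) \<partial>lborel)"
      for n and T :: "('a \<Rightarrow> complex) \<Rightarrow> complex"
    note F = schwartz_family_translate[OF S]
    have Sg: "schwartz (gauss ((real (Suc n))\<^sup>2) (b::'a))" for n b by (intro schwartz_gauss) simp
    have lim: "(\<lambda>n. a n T) \<longlonglongrightarrow> of_real (gauss_mass TYPE('a) 1) * T \<phi>" if T: "tempered T" for T
    proof -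
      obtain C K where C: "C \<ge> 0" "\<And>x. norm (T (\<lambda>y. \<phi> (y - x))) \<le> C * wt x ^ K"
        using tempered_family_growth[OF T F] by blast
      note cont = tempered_family_continuous[OF T F]
      have "(\<lambda>n. of_real (real (Suc n) ^ DIM('a)) * (\<integral>x. gauss ((real (Suc n))\<^sup>2) 0 x * T (\<lambda>y. \<phi> (y - x)) \<partial>lborel))
        \<longlonglongrightarrow> of_real (gauss_mass TYPE('a) 1) * T (\<lambda>y. \<phi> (y - 0))"
        by (rule gauss_approx_identity[where h="\<lambda>x. T (\<lambda>y. \<phi> (y - x))", OF borel_measurable_continuous_onI[OF cont] C(2,1)])
          (use cont in \<open>simp add: continuous_on_eq_continuous_at\<close>)
      then show ?thesis
        unfolding a_def tempered_integral_exchange[OF T schwartz_rapid[OF Sg] F] by simp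
    qed
    have "a n T1 = a n T2" for n
    proof -
      let ?s = "(real (Suc n))\<^sup>2"
      have conv: "(\<lambda>y. \<integral>x. gauss ?s 0 x * \<phi> (y - x) \<partial>lborel) = (\<lambda>y. \<integral>x. \<phi> x * gauss ?s 0 (y - x) \<partial>lborel)"
        by (intro ext convolution_commute schwartz_measurable S Sg)
      have "T1 (\<lambda>y. gauss ?s 0 (y - x)) = T2 (\<lambda>y. gauss ?s 0 (y - x))" for x
        unfolding gauss_translate tempered_cmult[OF T1 Sg] tempered_cmult[OF T2 Sg] by (simp add: eq)
      then show ?thesis unfolding a_def conv
        tempered_integral_exchange[OF T1 schwartz_rapid[OF S] schwartz_family_translate[OF Sg]]
        tempered_integral_exchange[OF T2 schwartz_rapid[OF S] schwartz_family_translate[OF Sg]] by simp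
    qed
    with lim[OF T1] have "(\<lambda>n. a n T2) \<longlonglongrightarrow> of_real (gauss_mass TYPE('a) 1) * T1 \<phi>" by simp
    from LIMSEQ_unique[OF this lim[OF T2]]
    have "of_real (gauss_mass TYPE('a) 1) * T1 \<phi> = of_real (gauss_mass TYPE('a) 1) * T2 \<phi>" .
    then show ?thesis using gauss_mass_pos[of 1, where 'a='a] by simp
  qed
qed

section \<open>Square-integrable functions as tempered distributions\<close>

lemma integrable_inverse_weight_lebesgue:
  "integrable lebesgue (\<lambda>x::'a::euclidean_space. inverse (wt x ^ (2 * DIM('a))))"
  using integrable_inverse_weight by (subst integrable_completion) measurable

text \<open>The norm bound by a single weighted sup norm is what later bounds
  \<open>dist_of f\<close> by Schwartz seminorms.\<close>

lemma square_integrable_decay: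
  fixes f :: "'a::euclidean_space \<Rightarrow> complex"
  assumes m: "f \<in> borel_measurable borel" and bd: "\<And>x. wt x ^ DIM('a) * norm (f x) \<le> C"
  shows "square_integrable f"
    and "L2_norm_fun f \<le> C * sqrt (\<integral>x. inverse (wt x ^ (2 * DIM('a))) \<partial>(lebesgue :: 'a measure))"
proof -
  let ?w = "\<lambda>x::'a. inverse (wt x ^ (2 * DIM('a)))"
  have "norm (f 0) \<le> C" using bd[of 0] by simp
  then have C: "C \<ge> 0" using norm_ge_zero order_trans by blast
  have le: "(cmod (f x))\<^sup>2 \<le> C\<^sup>2 * ?w x" for x
  proof -
    have p: "0 < wt x ^ DIM('a)" by (intro zero_less_power) (simp add: add_pos_nonneg)
    have "cmod (f x) \<le> C * inverse (wt x ^ DIM('a))" using bd[of x] p by (simp add: field_simps)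
    then have "(cmod (f x))\<^sup>2 \<le> (C * inverse (wt x ^ DIM('a)))\<^sup>2" by (intro power_mono) auto
    also have "\<dots> = C\<^sup>2 * ?w x"
      by (simp add: power_mult_distrib power_inverse power_mult[symmetric] mult.commute)
    finally show ?thesis .
  qed
  have wi: "integrable lebesgue (\<lambda>x. C\<^sup>2 * ?w x)" by (intro integrable_mult_right integrable_inverse_weight_lebesgue)
  show sq: "square_integrable f"
    by (rule square_integrableI_bound[OF _ wi le]) (use m in \<open>auto intro: measurable_completion\<close>)
  have "(L2_norm_fun f)\<^sup>2 \<le> (\<integral>x. C\<^sup>2 * ?w x \<partial>lebesgue)"
    unfolding L2_norm_fun_sq using sq by (intro integral_mono wi le) (simp add: square_integrable_def)
  also have "\<dots> = (C * sqrt (\<integral>x. ?w x \<partial>lebesgue))\<^sup>2" by (simp add: power_mult_distrib)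
  finally show "L2_norm_fun f \<le> C * sqrt (\<integral>x. ?w x \<partial>lebesgue)"
    by (rule power2_le_imp_le) (use C in simp)
qed

lemma schwartz_square_integrable: "schwartz f \<Longrightarrow> square_integrable f"
  by (metis schwartz_decay square_integrable_decay(1) schwartz_measurable)

lemma dist_of_apply: "schwartz \<phi> \<Longrightarrow> dist_of f \<phi> = (\<integral>x. f x * \<phi> x \<partial>lebesgue)"
  by (simp add: dist_of_def)

lemma dist_of_bound:
  "square_integrable f \<Longrightarrow> schwartz \<phi> \<Longrightarrow> cmod (dist_of f \<phi>) \<le> L2_norm_fun f * L2_norm_fun \<phi>"
  by (simp add: dist_of_apply L2_pairing_bound schwartz_square_integrable)

lemma dist_of_diff:
  assumes "square_integrable f" "square_integrable g"
  shows "dist_of (\<lambda>x. f x - g x) = (\<lambda>\<phi>. dist_of f \<phi> - dist_of g \<phi>)"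
  using square_integrable_mult[OF assms(1) schwartz_square_integrable] square_integrable_mult[OF assms(2) schwartz_square_integrable]
  by (auto simp: dist_of_def fun_eq_iff left_diff_distrib)

lemma dist_of_tempered:
  fixes f :: "'a::euclidean_space \<Rightarrow> complex"
  assumes f: "square_integrable f"
  shows "tempered (dist_of f)"
  unfolding tempered_def
proof (intro conjI allI impI)
  note i = square_integrable_mult[OF f schwartz_square_integrable]
  show "dist_of f (\<lambda>x. \<phi> x + \<psi> x) = dist_of f \<phi> + dist_of f \<psi>" if "schwartz \<phi>" "schwartz \<psi>" for \<phi> \<psi>
    using that i by (simp add: dist_of_apply schwartz_add distrib_left)
  show "dist_of f (\<lambda>x. c * \<phi> x) = c * dist_of f \<phi>" if "schwartz \<phi>" for c \<phi>
    using that by (simp add: dist_of_apply schwartz_cmult mult.left_commute[of _ c])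
  show "dist_of f \<phi> = 0" if "\<not> schwartz \<phi>" for \<phi> using that by (simp add: dist_of_def)
  let ?d = "DIM('a)" and ?A = "sqrt (\<integral>x. inverse (wt x ^ (2 * DIM('a))) \<partial>(lebesgue :: 'a measure))"
  show "\<exists>C M. \<forall>\<phi>. schwartz \<phi> \<longrightarrow> norm (dist_of f \<phi>) \<le>
      C * (\<Sum>k\<le>M. \<Sum>bs\<in>{bs. set bs \<subseteq> Basis \<and> length bs \<le> M}. schwartz_seminorm k bs \<phi>)"
  proof (intro exI[of _ "L2_norm_fun f * ?A"] exI[of _ ?d] allI impI)
    fix \<phi> :: "'a \<Rightarrow> complex" assume S: "schwartz \<phi>"
    let ?p = "\<lambda>k bs. schwartz_seminorm k bs \<phi>" and ?B = "{bs. set bs \<subseteq> (Basis :: 'a set) \<and> length bs \<le> ?d}"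
    have bdd: "bdd_above (range (\<lambda>x. wt x ^ ?d * norm (pderivs [] \<phi> x)))"
      using S unfolding schwartz_def by (intro bounded_imp_bdd_above) blast
    have pd: "wt x ^ ?d * norm (\<phi> x) \<le> ?p ?d []" for x
      unfolding schwartz_seminorm_def using cSUP_upper[OF UNIV_I bdd, of x] by simp
    have "?p ?d [] \<le> (\<Sum>bs\<in>?B. ?p ?d bs)"
      by (rule member_le_sum[of "[]"]) (auto intro!: schwartz_seminorm_nonneg S finite_multiindices)
    also have "\<dots> \<le> (\<Sum>k\<le>?d. \<Sum>bs\<in>?B. ?p k bs)"
      by (rule member_le_sum[of ?d "{..?d}" "\<lambda>k. \<Sum>bs\<in>?B. ?p k bs"]) (auto intro!: sum_nonneg schwartz_seminorm_nonneg S)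
    finally have ps: "?p ?d [] \<le> (\<Sum>k\<le>?d. \<Sum>bs\<in>?B. ?p k bs)" .
    have "norm (dist_of f \<phi>) \<le> L2_norm_fun f * L2_norm_fun \<phi>" by (rule dist_of_bound[OF f S])
    also have "\<dots> \<le> L2_norm_fun f * (?p ?d [] * ?A)"
      by (intro mult_left_mono square_integrable_decay(2) schwartz_measurable S pd L2_norm_fun_nonneg)
    also have "\<dots> \<le> L2_norm_fun f * ((\<Sum>k\<le>?d. \<Sum>bs\<in>?B. ?p k bs) * ?A)"
      by (intro mult_left_mono mult_right_mono ps L2_norm_fun_nonneg) simp
    finally show "norm (dist_of f \<phi>) \<le> L2_norm_fun f * ?A * (\<Sum>k\<le>?d. \<Sum>bs\<in>?B. ?p k bs)"
      by (simp add: mult_ac)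
  qed
qed

text \<open>Mollifying \<open>h\<close> by Gaussians turns it into a Schwartz function.\<close>

lemma dist_of_eq_0_continuous:
  fixes f h :: "'a::euclidean_space \<Rightarrow> complex"
  assumes f: "square_integrable f" and 0: "\<And>\<phi>. schwartz \<phi> \<Longrightarrow> (\<integral>x. f x * \<phi> x \<partial>lebesgue) = 0"
    and h: "continuous_on UNIV h" and dec: "\<And>k. \<exists>C. \<forall>x. wt x ^ k * norm (h x) \<le> C"
  shows "(\<integral>x. f x * h x \<partial>lebesgue) = 0"
proof -
  have hm [measurable]: "h \<in> borel_measurable borel" by (rule borel_measurable_continuous_onI[OF h])
  have R: "rapid h" by (rule rapidI[OF hm dec])
  have Rg: "rapid (gauss 1 (0::'a))" by (intro schwartz_rapid schwartz_gauss) simp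
  let ?d = "DIM('a)" and ?c = "\<lambda>n. complex_of_real (real (Suc n) ^ DIM('a))" and ?s = "\<lambda>n. (real (Suc n))\<^sup>2"
  obtain C where C: "\<And>x. wt x ^ ?d * norm (h x) \<le> C" using dec by blast
  have "norm (h 0) \<le> C" using C[of 0] by simp
  then have C0: "C \<ge> 0" using norm_ge_zero order_trans by blast
  define J where "J n y = ?c n * (\<integral>x. h x * gauss (?s n) 0 (y - x) \<partial>lborel)" for n y
  have JS: "schwartz (J n)" for n
    unfolding J_def by (intro schwartz_cmult schwartz_family_integral[OF R] schwartz_family_translate schwartz_gauss) simp
  have Jm [measurable]: "J n \<in> borel_measurable lebesgue" for n
    using schwartz_measurable[OF JS[of n]] by (auto intro: measurable_completion)
  have J2: "J n y = ?c n * (\<integral>x. gauss (?s n) 0 x * h (y - x) \<partial>lborel)" for n y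
    unfolding J_def by (subst convolution_commute) auto
  have hy: "(\<lambda>x. h (y - x)) \<in> borel_measurable borel" for y by measurable
  \<comment> \<open>In this form the kernel does not depend on \<open>n\<close>, which makes the
    decay bound on \<open>J n\<close> uniform in \<open>n\<close>.\<close>
  have J3: "J n y = (\<integral>x. gauss 1 0 x * h (y - (1 / real (Suc n)) *\<^sub>R x) \<partial>lborel)" for n y
    unfolding J2 by (rule gauss_rescale[OF hy]) simp
  define W where "W = (\<integral>x. C * (wt x ^ ?d * norm (gauss 1 (0::'a) x)) \<partial>lborel)"
  have Wi: "integrable lborel (\<lambda>x. C * (wt x ^ ?d * norm (gauss 1 (0::'a) x)))"
    using Rg unfolding rapid_def by (intro integrable_mult_right) blast
  have J_bd: "wt y ^ ?d * norm (J n y) \<le> W" for n y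
    unfolding J3 W_def
  proof (rule integral_family_decay[OF Wi])
    show "wt y ^ ?d * norm (gauss 1 0 x * h (y - (1 / real (Suc n)) *\<^sub>R x)) \<le> C * (wt x ^ ?d * norm (gauss 1 (0::'a) x))" for x y
    proof -
      let ?u = "(1 / real (Suc n)) *\<^sub>R x"
      have "norm ?u \<le> 1 * norm x" unfolding norm_scaleR by (intro mult_right_mono) (auto simp: field_simps)
      then have u: "wt ?u ^ ?d \<le> wt x ^ ?d" by (intro power_mono) auto
      have "wt y ^ ?d * norm (h (y - ?u)) \<le> (wt (y - ?u) ^ ?d * wt ?u ^ ?d) * norm (h (y - ?u))"
        using weight_submult_power[of "y - ?u" ?u ?d] by (intro mult_right_mono) auto
      also have "\<dots> = wt ?u ^ ?d * (wt (y - ?u) ^ ?d * norm (h (y - ?u)))" by simp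
      also have "\<dots> \<le> wt x ^ ?d * C" by (intro mult_mono u C) auto
      finally have "norm (gauss 1 0 x) * (wt y ^ ?d * norm (h (y - ?u))) \<le> norm (gauss 1 0 x) * (wt x ^ ?d * C)"
        by (intro mult_left_mono) auto
      then show ?thesis by (simp add: norm_mult mult_ac)
    qed
    show "integrable lborel (\<lambda>x. gauss 1 0 x * h (y - (1 / real (Suc n)) *\<^sub>R x))"
    proof (rule rapid_mult_integrable[OF Rg, where C=C and K=0])
      show "(\<lambda>x. h (y - (1 / real (Suc n)) *\<^sub>R x)) \<in> borel_measurable borel" by measurable
      show "norm (h (y - (1 / real (Suc n)) *\<^sub>R x)) \<le> C * wt x ^ 0" for x
      proof -
        let ?v = "y - (1 / real (Suc n)) *\<^sub>R x"
        have "1 * norm (h ?v) \<le> wt ?v ^ ?d * norm (h ?v)" by (intro mult_right_mono one_le_power) auto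
        then show ?thesis using C[of ?v] by simp
      qed
    qed
  qed
  have J_lim: "(\<lambda>n. J n y) \<longlonglongrightarrow> of_real (gauss_mass TYPE('a) 1) * h y" for y
  proof -
    have "(\<lambda>n. ?c n * (\<integral>x. gauss (?s n) 0 x * h (y - x) \<partial>lborel)) \<longlonglongrightarrow> of_real (gauss_mass TYPE('a) 1) * h (y - 0)"
    proof (rule gauss_approx_identity[OF hy, where C=C and K=0])
      show "norm (h (y - x)) \<le> C * wt x ^ 0" for x
      proof -
        have "1 * norm (h (y - x)) \<le> wt (y - x) ^ ?d * norm (h (y - x))" by (intro mult_right_mono one_le_power) auto
        then show ?thesis using C[of "y - x"] by simp
      qed
      have "continuous_on UNIV (\<lambda>x. h (y - x))"
        by (intro continuous_on_compose2[OF h] continuous_intros) auto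
      then show "isCont (\<lambda>x. h (y - x)) 0" by (simp add: continuous_on_eq_continuous_at)
    qed (rule C0)
    then show ?thesis by (simp add: J2)
  qed
  let ?w = "\<lambda>x::'a. complex_of_real (inverse (wt x ^ ?d))"
  have wsq: "square_integrable ?w"
  proof (rule square_integrable_decay(1))
    show "?w \<in> borel_measurable borel" by measurable
    show "wt x ^ ?d * norm (?w x) \<le> 1" for x :: 'a
    proof -
      have p: "0 < wt x ^ ?d" by (intro zero_less_power) (simp add: add_pos_nonneg)
      then have "norm (?w x) = inverse (wt x ^ ?d)" unfolding norm_of_real by simp
      then show ?thesis using right_inverse[OF less_imp_neq[OF p, symmetric]] by (simp only: order.refl)
    qed
  qed
  have [measurable]: "f \<in> borel_measurable lebesgue" by (rule square_integrable_measurable[OF f])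
  have hml: "h \<in> borel_measurable lebesgue" using hm by (auto intro: measurable_completion)
  have "(\<lambda>n. \<integral>x. f x * J n x \<partial>lebesgue) \<longlonglongrightarrow> (\<integral>x. f x * (of_real (gauss_mass TYPE('a) 1) * h x) \<partial>lebesgue)"
  proof (rule integral_dominated_convergence[where w="\<lambda>x. W * norm (f x * ?w x)"])
    show "(\<lambda>x. f x * (of_real (gauss_mass TYPE('a) 1) * h x)) \<in> borel_measurable lebesgue" using hml by measurable
    show "(\<lambda>x. f x * J n x) \<in> borel_measurable lebesgue" for n by measurable
    show "integrable lebesgue (\<lambda>x. W * norm (f x * ?w x))"
      by (intro integrable_mult_right integrable_norm square_integrable_mult f wsq)
    show "AE x in lebesgue. (\<lambda>n. f x * J n x) \<longlonglongrightarrow> f x * (of_real (gauss_mass TYPE('a) 1) * h x)"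
      by (intro AE_I2 tendsto_mult tendsto_const J_lim)
    show "AE x in lebesgue. norm (f x * J n x) \<le> W * norm (f x * ?w x)" for n
    proof (rule AE_I2)
      fix x :: 'a
      have p: "0 < wt x ^ ?d" by (intro zero_less_power) (simp add: add_pos_nonneg)
      have "norm (J n x) \<le> W * inverse (wt x ^ ?d)" using J_bd[of x n] p by (simp add: field_simps)
      then have "norm (f x) * norm (J n x) \<le> norm (f x) * (W * inverse (wt x ^ ?d))" by (intro mult_left_mono) auto
      then show "norm (f x * J n x) \<le> W * norm (f x * ?w x)"
        using p by (simp only: norm_mult norm_of_real) (simp add: mult_ac)
    qed
  qed
  then have "(\<integral>x. f x * (of_real (gauss_mass TYPE('a) 1) * h x) \<partial>lebesgue) = 0"
    using 0[OF JS] by (simp add: LIMSEQ_const_iff)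
  moreover have "(\<integral>x. f x * (of_real (gauss_mass TYPE('a) 1) * h x) \<partial>lebesgue) = of_real (gauss_mass TYPE('a) 1) * (\<integral>x. f x * h x \<partial>lebesgue)"
    by (simp add: mult.left_commute[of "f _"])
  ultimately show ?thesis using gauss_mass_pos[of 1, where 'a='a] by simp
qed

text \<open>Testing against the conjugate phase of \<open>f\<close> times a Gaussian would give the
  integral of the modulus of \<open>f\<close> times that Gaussian. The phase is merely measurable,
  so it is approximated by continuous functions.\<close>

lemma dist_of_eq_0_imp_AE:
  fixes f :: "'a::euclidean_space \<Rightarrow> complex"
  assumes f: "square_integrable f" and 0: "\<And>\<phi>. schwartz \<phi> \<Longrightarrow> (\<integral>x. f x * \<phi> x \<partial>lebesgue) = 0"
  shows "AE x in lebesgue. f x = 0"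
proof -
  have fm [measurable]: "f \<in> borel_measurable lebesgue" by (rule square_integrable_measurable[OF f])
  \<comment> \<open>At zeros of \<open>f\<close> the convention \<open>inverse 0 = 0\<close> gives
    \<open>u x = 0\<close>.\<close>
  define u where "u x = inverse (norm (f x)) *\<^sub>R cnj (f x)" for x
  have cm: "(\<lambda>x. cnj (f x)) \<in> borel_measurable lebesgue"
    using square_integrable_measurable[OF square_integrable_cnj[OF f]] .
  have um: "u \<in> borel_measurable lebesgue" unfolding u_def using cm by measurable
  have u1: "norm (u x) \<le> 1" for x by (cases "f x = 0") (simp_all add: u_def)
  have fu: "f x * u x = of_real (norm (f x))" for x
    by (cases "f x = 0") (simp_all add: u_def complex_norm_square[symmetric] scaleR_conv_of_real power2_eq_square field_simps del: of_real_power)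
  obtain M g where M: "negligible M" and g: "\<And>n::nat. continuous_on UNIV (g n)" and lim: "\<And>x. x \<notin> M \<Longrightarrow> (\<lambda>n. g n x) \<longlonglongrightarrow> u x"
    using lebesgue_measurable_imp_measurable_on[OF um, of UNIV] unfolding measurable_on_def by auto
  have AEM: "AE x in lebesgue. x \<notin> M"
    using M by (auto simp: negligible_iff_null_sets intro: AE_not_in)
  let ?e = "\<lambda>x::'a. gauss 1 0 x"
  have eS: "schwartz ?e" by (intro schwartz_gauss) simp
  have eL: "square_integrable ?e" by (rule schwartz_square_integrable[OF eS])
  have em [measurable]: "?e \<in> borel_measurable lebesgue" by (rule square_integrable_measurable[OF eL])
  \<comment> \<open>Dividing by the maximum truncates to modulus at most 1 while preserving
    continuity, and also the limit, since \<open>u\<close> has modulus at most 1. The Gaussian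
    factor supplies the decay.\<close>
  define h where "h n x = ?e x * (g n x / of_real (max 1 (norm (g n x))))" for n x
  have h_le: "norm (h n x) \<le> norm (?e x)" for n x
  proof -
    have "norm (g n x / of_real (max 1 (norm (g n x)))) \<le> 1" by (simp add: norm_divide divide_le_eq_1 less_max_iff_disj)
    then show ?thesis unfolding h_def norm_mult by (rule mult_right_le_one_le[rotated 2]) auto
  qed
  have hc: "continuous_on UNIV (h n)" for n
    unfolding h_def by (intro continuous_intros schwartz_continuous[OF eS] g) (auto simp: max_def)
  have hd: "\<exists>C. \<forall>x. wt x ^ k * norm (h n x) \<le> C" for n k
  proof -
    obtain C where C: "\<And>x. wt x ^ k * norm (?e x) \<le> C" using schwartz_decay[OF eS] by blast
    have "wt x ^ k * norm (h n x) \<le> C" for x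
      by (rule order_trans[OF mult_left_mono[OF h_le] C]) simp
    then show ?thesis by blast
  qed
  have z: "(\<integral>x. f x * h n x \<partial>lebesgue) = 0" for n by (rule dist_of_eq_0_continuous[OF f 0 hc hd])
  have hm: "h n \<in> borel_measurable lebesgue" for n
    using borel_measurable_continuous_onI[OF hc] by (auto intro: measurable_completion)
  have "(\<lambda>n. \<integral>x. f x * h n x \<partial>lebesgue) \<longlonglongrightarrow> (\<integral>x. f x * (?e x * u x) \<partial>lebesgue)"
  proof (rule integral_dominated_convergence[where w="\<lambda>x. norm (f x * ?e x)"])
    show "(\<lambda>x. f x * (?e x * u x)) \<in> borel_measurable lebesgue" using um by measurable
    show "(\<lambda>x. f x * h n x) \<in> borel_measurable lebesgue" for n using hm by measurable
    show "integrable lebesgue (\<lambda>x. norm (f x * ?e x))" by (intro integrable_norm square_integrable_mult f eL)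
    show "AE x in lebesgue. norm (f x * h n x) \<le> norm (f x * ?e x)" for n
      unfolding norm_mult by (intro AE_I2 mult_left_mono h_le) auto
    show "AE x in lebesgue. (\<lambda>n. f x * h n x) \<longlonglongrightarrow> f x * (?e x * u x)"
      using AEM
    proof eventually_elim
      case (elim x)
      have "(\<lambda>n. f x * h n x) \<longlonglongrightarrow> f x * (?e x * (u x / of_real (max 1 (norm (u x)))))"
        unfolding h_def by (intro tendsto_intros lim elim) auto
      moreover have "max 1 (norm (u x)) = 1" using u1[of x] by simp
      ultimately show ?case by simp
    qed
  qed
  then have i0: "(\<integral>x. f x * (?e x * u x) \<partial>lebesgue) = 0" by (simp add: z LIMSEQ_const_iff)
  have eq: "f x * (?e x * u x) = of_real (norm (f x * ?e x))" for x
  proof -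
    have "f x * (?e x * u x) = ?e x * (f x * u x)" by simp
    also have "\<dots> = of_real (norm (f x * ?e x))" unfolding fu by (simp add: norm_mult gauss_def)
    finally show ?thesis .
  qed
  have "(\<integral>x. norm (f x * ?e x) \<partial>lebesgue) = 0" using i0 unfolding eq integral_of_real by simp
  then have "AE x in lebesgue. norm (f x * ?e x) = 0"
    using integral_nonneg_eq_0_iff_AE[OF integrable_norm[OF square_integrable_mult[OF f eL]]] by simp
  then show ?thesis by eventually_elim (simp add: gauss_def)
qed

lemma dist_of_eq_imp_L2_norm_eq:
  assumes f: "square_integrable f" and g: "square_integrable g" and eq: "dist_of f = dist_of g"
  shows "L2_norm_fun f = L2_norm_fun g"
proof -
  have "AE x in lebesgue. f x - g x = 0"
  proof (rule dist_of_eq_0_imp_AE[OF square_integrable_diff[OF f g]])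
    fix \<phi> :: "'a \<Rightarrow> complex" assume "schwartz \<phi>"
    then show "(\<integral>x. (f x - g x) * \<phi> x \<partial>lebesgue) = 0"
      using fun_cong[OF dist_of_diff[OF f g], of \<phi>] eq by (simp add: dist_of_apply)
  qed
  then have ae: "AE x in lebesgue. (cmod (f x))\<^sup>2 = (cmod (g x))\<^sup>2" by eventually_elim simp
  show ?thesis unfolding L2_norm_fun_def
    using f g by (intro arg_cong[where f=sqrt] integral_cong_AE ae) (auto simp: square_integrable_def)
qed

section \<open>The invariant form\<close>

lemma hilbert_in_S'_carrier:
  assumes H: "hilbert_in_S' V N"
  shows "hilbert_carrier (\<lambda>c T \<phi>. c * T \<phi>) V N"
proof unfold_locales
  show "(\<lambda>\<phi>. a * (x + y) \<phi>) = (\<lambda>\<phi>. a * x \<phi>) + (\<lambda>\<phi>. a * y \<phi>)" for a :: complex and x y :: "('a \<Rightarrow> complex) \<Rightarrow> complex"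
    by (simp add: fun_eq_iff distrib_left)
  show "(\<lambda>\<phi>. (a + b) * x \<phi>) = (\<lambda>\<phi>. a * x \<phi>) + (\<lambda>\<phi>. b * x \<phi>)" for a b :: complex and x :: "('a \<Rightarrow> complex) \<Rightarrow> complex"
    by (simp add: fun_eq_iff distrib_right)
qed (use H in \<open>unfold hilbert_in_S'_def plus_fun_def zero_fun_def fun_diff_def, auto simp: mult.assoc\<close>)

locale time_frequency_invariant =
  fixes V :: "(('a::euclidean_space \<Rightarrow> complex) \<Rightarrow> complex) set"
    and N :: "(('a \<Rightarrow> complex) \<Rightarrow> complex) \<Rightarrow> real"
  assumes H: "hilbert_in_S' V N"
    and tr: "\<And>T x. T \<in> V \<Longrightarrow> dtranslate x T \<in> V \<and> N (dtranslate x T) = N T"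
    and md: "\<And>T z. T \<in> V \<Longrightarrow> dmodulate z T \<in> V \<and> N (dmodulate z T) = N T"
begin

sublocale hilbert_carrier "\<lambda>c T \<phi>. c * T \<phi>" V N
  by (rule hilbert_in_S'_carrier[OF H])

section \<open>Representers of evaluations and their transformation rules\<close>

lemma V_tempered: "T \<in> V \<Longrightarrow> tempered T"
  using H unfolding hilbert_in_S'_def by blast

lemma evaluation_bounded:
  assumes "schwartz \<phi>"
  obtains C where "\<And>T. T \<in> V \<Longrightarrow> cmod (T \<phi>) \<le> C * N T"
  using H assms unfolding hilbert_in_S'_def by metis

lemma representer_exists:
  assumes \<phi>: "schwartz \<phi>"
  shows "\<exists>K. K \<in> V \<and> (\<forall>T\<in>V. R T K = Re (T \<phi>))"
proof -
  obtain C where C: "\<And>T. T \<in> V \<Longrightarrow> cmod (T \<phi>) \<le> C * N T" using evaluation_bounded[OF \<phi>] by blast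
  obtain K u where K: "K \<in> V" "\<And>P. P \<in> V \<Longrightarrow> R K P = Re (P \<phi>)"
  proof (rule riesz_dense[of V "\<lambda>T. Re (T \<phi>)" C])
    show "Re (P \<phi>) \<le> C * N P" if "P \<in> V" for P
      using C[OF that] complex_Re_le_cmod order_trans by blast
  qed (use zero_V add_V sc_V in auto)
  then show ?thesis using R_commute by auto
qed

text \<open>The reproducing kernel of the space: \<open>rep \<psi> \<phi>\<close> is the inner
  product of \<open>rep \<psi>\<close> with \<open>rep \<phi>\<close>, antilinear in
  \<open>\<psi>\<close> and linear in \<open>\<phi>\<close>.\<close>

definition rep :: "('a \<Rightarrow> complex) \<Rightarrow> ('a \<Rightarrow> complex) \<Rightarrow> complex" where
  "rep \<phi> = (SOME K. K \<in> V \<and> (\<forall>T\<in>V. R T K = Re (T \<phi>)))"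

lemma rep_V: "schwartz \<phi> \<Longrightarrow> rep \<phi> \<in> V"
  and R_rep: "schwartz \<phi> \<Longrightarrow> T \<in> V \<Longrightarrow> R T (rep \<phi>) = Re (T \<phi>)"
  using someI_ex[OF representer_exists, of \<phi>] unfolding rep_def by auto

lemma rep_unique:
  assumes \<phi>: "schwartz \<phi>" and K: "K \<in> V" and eq: "\<And>T. T \<in> V \<Longrightarrow> R T K = Re (T \<phi>)"
  shows "K = rep \<phi>"
proof -
  note k = rep_V[OF \<phi>]
  note d = diff_V[OF K k]
  have "R (K - rep \<phi>) (K - rep \<phi>) = R K (K - rep \<phi>) - R (rep \<phi>) (K - rep \<phi>)"
    by (rule R_diff_left[OF K k d])
  also have "\<dots> = R (K - rep \<phi>) K - R (K - rep \<phi>) (rep \<phi>)"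
    using R_commute[OF K d] R_commute[OF k d] by simp
  also have "\<dots> = 0" using eq[OF d] R_rep[OF \<phi> d] by simp
  finally have "K - rep \<phi> = 0" by (rule R_eq_0_imp[OF d])
  then show ?thesis by simp
qed

lemma rep_tempered: "schwartz \<phi> \<Longrightarrow> tempered (rep \<phi>)"
  by (intro V_tempered rep_V)

lemma R_add_right: "S \<in> V \<Longrightarrow> T \<in> V \<Longrightarrow> T' \<in> V \<Longrightarrow> R S (T + T') = R S T + R S T'"
  using R_add_left[of T T' S] R_commute add_V by simp

lemma rep_add:
  assumes \<phi>: "schwartz \<phi>" and \<psi>: "schwartz \<psi>"
  shows "rep (\<lambda>x. \<phi> x + \<psi> x) = rep \<phi> + rep \<psi>"
proof (rule rep_unique[symmetric])
  show "R T (rep \<phi> + rep \<psi>) = Re (T (\<lambda>x. \<phi> x + \<psi> x))" if T: "T \<in> V" for T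
    using R_add_right[OF T rep_V[OF \<phi>] rep_V[OF \<psi>]] R_rep[OF \<phi> T] R_rep[OF \<psi> T] tempered_add[OF V_tempered[OF T] \<phi> \<psi>]
    by simp
qed (intro schwartz_add add_V rep_V \<phi> \<psi>)+

lemma rep_scaled:
  assumes \<phi>: "schwartz \<phi>"
  shows "rep (\<lambda>x. of_real t * \<phi> x) = (\<lambda>\<theta>. of_real t * rep \<phi> \<theta>)"
proof (rule rep_unique[symmetric])
  show "R T (\<lambda>\<theta>. of_real t * rep \<phi> \<theta>) = Re (T (\<lambda>x. of_real t * \<phi> x))" if T: "T \<in> V" for T
    using R_scale_left[OF rep_V[OF \<phi>] T, of t] R_commute[OF T sc_V[OF rep_V[OF \<phi>]]] R_commute[OF T rep_V[OF \<phi>]]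
      R_rep[OF \<phi> T] tempered_cmult[OF V_tempered[OF T] \<phi>] by simp
qed (intro schwartz_cmult sc_V rep_V \<phi>)+

lemma rep_diff:
  assumes \<phi>: "schwartz \<phi>" and \<psi>: "schwartz \<psi>"
  shows "rep (\<lambda>x. \<phi> x - \<psi> x) = rep \<phi> - rep \<psi>"
  using rep_add[OF schwartz_diff[OF \<phi> \<psi>] \<psi>] by simp

text \<open>The real part is the symmetry of \<open>R\<close>; the imaginary part follows by
  multiplying one argument by \<open>\<i>\<close> and using \<open>R_ii_left\<close>.\<close>

lemma rep_hermitian:
  assumes \<phi>: "schwartz \<phi>" and \<psi>: "schwartz \<psi>"
  shows "rep \<phi> \<psi> = cnj (rep \<psi> \<phi>)"
proof (rule complex_eqI)
  note V = rep_V[OF \<phi>] rep_V[OF \<psi>]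
  show "Re (rep \<phi> \<psi>) = Re (cnj (rep \<psi> \<phi>))"
    using R_rep[OF \<phi> V(2)] R_rep[OF \<psi> V(1)] R_commute[OF V] by simp
  have "R (\<lambda>\<theta>. \<i> * rep \<psi> \<theta>) (rep \<phi>) = - R (\<lambda>\<theta>. \<i> * rep \<phi> \<theta>) (rep \<psi>)"
    using R_ii_left[OF V(2,1)] R_commute[OF V(2) sc_V[OF V(1)]] by simp
  then have "Re (\<i> * rep \<psi> \<phi>) = - Re (\<i> * rep \<phi> \<psi>)"
    using R_rep[OF \<phi> sc_V[OF V(2)]] R_rep[OF \<psi> sc_V[OF V(1)]] by simp
  then show "Im (rep \<phi> \<psi>) = Im (cnj (rep \<psi> \<phi>))" by simp
qed

lemma rep_cmult:
  assumes \<phi>: "schwartz \<phi>" and \<psi>: "schwartz \<psi>"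
  shows "rep (\<lambda>x. c * \<phi> x) \<psi> = cnj c * rep \<phi> \<psi>"
  using rep_hermitian[OF schwartz_cmult[OF \<phi>] \<psi>, of c] rep_hermitian[OF \<phi> \<psi>]
    tempered_cmult[OF rep_tempered[OF \<psi>] \<phi>] by simp

text \<open>Pairing \<open>T = U (U' T)\<close> with \<open>U (rep \<phi>)\<close>, and using that
  \<open>U\<close> preserves \<open>R\<close>, leaves the evaluation of \<open>U' T\<close> at
  \<open>\<phi>\<close>, which is \<open>T \<phi>'\<close>. Translations and modulations are the two
  instances.\<close>

lemma rep_isometry:
  assumes \<phi>: "schwartz \<phi>" and \<phi>': "schwartz \<phi>'"
    and U: "\<And>T. T \<in> V \<Longrightarrow> U T \<in> V \<and> N (U T) = N T" and U_V': "\<And>T. T \<in> V \<Longrightarrow> U' T \<in> V"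
    and U_add: "\<And>S T. U (S + T) = U S + U T" and U_diff: "\<And>S T. U (S - T) = U S - U T"
    and U_inv: "\<And>T. T \<in> V \<Longrightarrow> U (U' T) = T" and eval: "\<And>T. T \<in> V \<Longrightarrow> U' T \<phi> = T \<phi>'"
  shows "U (rep \<phi>) = rep \<phi>'"
proof (rule rep_unique[OF \<phi>'])
  note k = rep_V[OF \<phi>]
  show "U (rep \<phi>) \<in> V" using U k by blast
  show "R T (U (rep \<phi>)) = Re (T \<phi>')" if T: "T \<in> V" for T
  proof -
    have "R T (U (rep \<phi>)) = R (U (U' T)) (U (rep \<phi>))" by (simp add: U_inv T)
    also have "\<dots> = R (U' T) (rep \<phi>)"
      unfolding R_def U_add[symmetric] U_diff[symmetric] using U add_V diff_V U_V'[OF T] k by simp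
    also have "\<dots> = Re (T \<phi>')" using R_rep[OF \<phi> U_V'[OF T]] eval[OF T] by simp
    finally show ?thesis .
  qed
qed

lemma rep_translate:
  assumes \<phi>: "schwartz \<phi>"
  shows "dtranslate x (rep \<phi>) = rep (\<lambda>y. \<phi> (y - x))"
proof (rule rep_isometry[where U'="dtranslate (- x)"])
  show "schwartz (\<lambda>y. \<phi> (y - x))" using schwartz_translate[OF \<phi>, of "- x"] by simp
  show "dtranslate x T \<in> V \<and> N (dtranslate x T) = N T" "dtranslate (- x) T \<in> V" if "T \<in> V" for T
    using tr[OF that] by blast+
qed (use \<phi> in \<open>auto simp: dtranslate_def fun_eq_iff\<close>)

lemma rep_modulate:
  assumes \<phi>: "schwartz \<phi>"
  shows "dmodulate z (rep \<phi>) = rep (\<lambda>y. iexp (y \<bullet> (- z)) * \<phi> y)"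
proof (rule rep_isometry[where U'="dmodulate (- z)"])
  show "schwartz (\<lambda>y. iexp (y \<bullet> (- z)) * \<phi> y)" by (rule schwartz_modulate[OF \<phi>])
  show "dmodulate z T \<in> V \<and> N (dmodulate z T) = N T" "dmodulate (- z) T \<in> V" if "T \<in> V" for T
    using md[OF that] by blast+
  show "dmodulate z (dmodulate (- z) T) = T" for T
    by (simp add: dmodulate_def mult.assoc[symmetric] exp_add[symmetric])
qed (use \<phi> in \<open>auto simp: dmodulate_def fun_eq_iff\<close>)

lemma rep_translate_invariant:
  assumes \<phi>: "schwartz \<phi>"
  shows "rep (\<lambda>y. \<phi> (y - x)) (\<lambda>y. \<psi> (y - x)) = rep \<phi> \<psi>"
  unfolding rep_translate[OF \<phi>, symmetric] by (simp add: dtranslate_def)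

text \<open>A Gaussian is a superposition of characters, so it may be moved from one argument of the form
  to the other just as characters can.\<close>

lemma rep_gauss_mult:
  fixes b :: 'a
  assumes s: "s > 0" and \<phi>: "schwartz \<phi>" and \<psi>: "schwartz \<psi>"
  shows "rep \<psi> (\<lambda>y. gauss s b y * \<phi> y) = rep (\<lambda>y. gauss s b y * \<psi> y) \<phi>"
proof -
  obtain w where w: "rapid w" "\<And>x. gauss s b x = (\<integral>z. w z * iexp (x \<bullet> z) \<partial>lborel)"
    "\<And>z. w (- z) = cnj (w z)"
    using gauss_fourier[OF s] by metis
  have eq: "(\<lambda>y. gauss s b y * f y) = (\<lambda>y. \<integral>z. w z * (iexp (y \<bullet> z) * f y) \<partial>lborel)" for f
    unfolding w(2) by (simp add: mult.assoc[symmetric])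
  let ?g = "\<lambda>z. cnj (w z * rep \<phi> (\<lambda>y. iexp (y \<bullet> z) * \<psi> y))"
  have "rep \<psi> (\<lambda>y. gauss s b y * \<phi> y) = (\<integral>z. w z * rep \<psi> (\<lambda>y. iexp (y \<bullet> z) * \<phi> y) \<partial>lborel)"
    unfolding eq by (rule tempered_integral_exchange[OF rep_tempered[OF \<psi>] w(1) schwartz_family_modulate[OF \<phi>]])
  \<comment> \<open>Hermitian symmetry conjugates and turns the character at \<open>z\<close> into
    the one at \<open>- z\<close>; the symmetry of \<open>w\<close> then makes the integrand a
    function of \<open>- z\<close>, and a reflection removes the sign.\<close>
  also have "\<dots> = (\<integral>z. ?g (0 - z) \<partial>lborel)"
  proof (intro Bochner_Integration.integral_cong refl)
    fix z
    have "rep \<psi> (\<lambda>y. iexp (y \<bullet> z) * \<phi> y) = dmodulate z (rep \<psi>) \<phi>" by (simp add: dmodulate_def)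
    also have "\<dots> = cnj (rep \<phi> (\<lambda>y. iexp (y \<bullet> (- z)) * \<psi> y))"
      unfolding rep_modulate[OF \<psi>] by (rule rep_hermitian[OF schwartz_modulate[OF \<psi>] \<phi>])
    finally show "w z * rep \<psi> (\<lambda>y. iexp (y \<bullet> z) * \<phi> y) = ?g (0 - z)"
      by (simp add: w(3))
  qed
  also have "\<dots> = (\<integral>z. ?g z \<partial>lborel)"
  proof (rule lborel_integral_reflect)
    have "(\<lambda>z. rep \<phi> (\<lambda>y. iexp (y \<bullet> z) * \<psi> y)) \<in> borel_measurable borel"
      by (intro borel_measurable_continuous_onI tempered_family_continuous[OF rep_tempered[OF \<phi>]] schwartz_family_modulate \<psi>)
    then have "(\<lambda>z. w z * rep \<phi> (\<lambda>y. iexp (y \<bullet> z) * \<psi> y)) \<in> borel_measurable borel"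
      using w(1) unfolding rapid_def by (intro borel_measurable_times) auto
    then show "?g \<in> borel_measurable borel"
      by (rule borel_measurable_continuous_on[of cnj, rotated]) (intro continuous_intros)
  qed
  also have "\<dots> = cnj (\<integral>z. w z * rep \<phi> (\<lambda>y. iexp (y \<bullet> z) * \<psi> y) \<partial>lborel)"
    by (rule Bochner_Integration.integral_cnj)
  also have "\<dots> = cnj (rep \<phi> (\<lambda>y. gauss s b y * \<psi> y))"
    unfolding eq tempered_integral_exchange[OF rep_tempered[OF \<phi>] w(1) schwartz_family_modulate[OF \<psi>]] ..
  also have "\<dots> = rep (\<lambda>y. gauss s b y * \<psi> y) \<phi>"
    by (rule rep_hermitian[OF schwartz_gauss_mult[OF s \<psi>] \<phi>, symmetric])
  finally show ?thesis .
qed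

section \<open>The form on pairs of Gaussians\<close>

text \<open>All but a factor of width \<open>m\<close> is moved to the other argument. The
  right-hand side sees only \<open>s + t\<close>, \<open>b + c\<close> and \<open>m\<close>, so two
  pairs with the same product can be compared through a common \<open>m\<close>.\<close>

lemma rep_gauss_split:
  assumes s: "s > 0" and t: "t > 0" and m: "0 < m" "m < s"
  shows "rep (gauss t c) (gauss s b) = rep (gauss (s + t - m) (b + c)) (gauss m (0::'a))"
proof -
  have "rep (gauss t c) (gauss s b) = rep (gauss t c) (\<lambda>y. gauss (s - m) b y * gauss m 0 y)"
    unfolding gauss_mult by simp
  also have "\<dots> = rep (\<lambda>y. gauss (s - m) b y * gauss t c y) (gauss m 0)"
    using m t by (intro rep_gauss_mult schwartz_gauss) auto
  also have "(\<lambda>y. gauss (s - m) b y * gauss t c y) = gauss (s + t - m) (b + c)"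
    by (simp add: gauss_mult fun_eq_iff algebra_simps)
  finally show ?thesis .
qed

text \<open>The centred Gaussian of width \<open>r\<close> is split into two equal factors, giving a
  normal form for the value attached to that product.\<close>

definition diag :: "real \<Rightarrow> complex" where
  "diag r = rep (gauss (r / 2) (0::'a)) (gauss (r / 2) 0)"

lemma rep_gauss_gauss:
  fixes b c :: 'a
  assumes s: "s > 0" and t: "t > 0"
  shows "rep (gauss t c) (gauss s b) = of_real (exp (((b + c) \<bullet> (b + c)) / (4 * (s + t)))) * diag (s + t)"
proof -
  define r where "r = s + t"
  have r: "r > 0" using s t by (simp add: r_def)
  \<comment> \<open>The centre of the product Gaussian: translating the centred pair by
    \<open>x\<close> gives linear terms that add up to \<open>b + c\<close>.\<close>
  define x where "x = (1 / (2 * r)) *\<^sub>R (b + c)"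
  \<comment> \<open>Strictly below both \<open>s\<close> and \<open>r / 2\<close>, as the two
    splittings demand.\<close>
  define m where "m = min s (r / 2) / 2"
  have m: "0 < m" "m < s" "m < r / 2" using s r by (auto simp: m_def min_def)
  have bc: "r *\<^sub>R x + r *\<^sub>R x = b + c" using r by (simp add: x_def scaleR_add_left[symmetric])
  have S: "schwartz (gauss (r / 2) b)" for b :: 'a using r by (intro schwartz_gauss) simp
  have "rep (gauss t c) (gauss s b) = rep (gauss (r / 2) (r *\<^sub>R x)) (gauss (r / 2) (r *\<^sub>R x))"
    using rep_gauss_split[OF s t m(1,2), of c b] rep_gauss_split[of "r / 2" "r / 2" m "r *\<^sub>R x" "r *\<^sub>R x"] m r
    unfolding bc by (simp add: r_def)
  moreover have "diag r = of_real (exp (- r * (x \<bullet> x))) * rep (gauss (r / 2) (r *\<^sub>R x)) (gauss (r / 2) (r *\<^sub>R x))"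
  proof -
    let ?a = "complex_of_real (exp (- (r / 2) * (x \<bullet> x)))"
    have tr: "(\<lambda>y. gauss (r / 2) 0 (y - x)) = (\<lambda>y. ?a * gauss (r / 2) (r *\<^sub>R x) y)"
      unfolding gauss_translate by simp
    have "diag r = rep (\<lambda>y. gauss (r / 2) 0 (y - x)) (\<lambda>y. gauss (r / 2) 0 (y - x))"
      unfolding diag_def by (rule rep_translate_invariant[OF S, symmetric])
    also have "\<dots> = ?a * (?a * rep (gauss (r / 2) (r *\<^sub>R x)) (gauss (r / 2) (r *\<^sub>R x)))"
      unfolding tr tempered_cmult[OF rep_tempered[OF schwartz_cmult[OF S]] S] rep_cmult[OF S S] by simp
    also have "\<dots> = (?a * ?a) * rep (gauss (r / 2) (r *\<^sub>R x)) (gauss (r / 2) (r *\<^sub>R x))" by simp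
    also have "?a * ?a = of_real (exp (- r * (x \<bullet> x)))"
      unfolding of_real_mult[symmetric] exp_add[symmetric] by (simp add: field_simps)
    finally show ?thesis .
  qed
  moreover have "r * (x \<bullet> x) = ((b + c) \<bullet> (b + c)) / (4 * r)"
    using r by (simp add: x_def power2_eq_square divide_simps)
  ultimately show ?thesis
    unfolding r_def[symmetric] by (simp add: exp_minus)
qed

text \<open>Evaluating the form on \<open>gauss s * gauss t\<close> (convolution) against \<open>gauss w\<close> in two ways
  relates \<open>diag (s + w)\<close> to \<open>diag (t + w)\<close>.\<close>

lemma diag_convolution:
  assumes s: "s > 0" and t: "t > 0" and w: "w > 0"
  shows "rep (gauss w 0) (\<lambda>y. \<integral>x. gauss t 0 x * gauss s 0 (y - x) \<partial>lborel)
    = diag (s + w) * of_real (gauss_mass TYPE('a) (t + s * w / (s + w)))"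
proof -
  have S: "schwartz (gauss s b)" "schwartz (gauss t b)" "schwartz (gauss w b)" for b :: 'a
    using assms by (auto intro: schwartz_gauss)
  have "rep (gauss w 0) (\<lambda>y. \<integral>x. gauss t 0 x * gauss s 0 (y - x) \<partial>lborel)
      = (\<integral>x. gauss t 0 x * rep (gauss w 0) (\<lambda>y. gauss s 0 (y - x)) \<partial>lborel)"
    by (rule tempered_integral_exchange[OF rep_tempered[OF S(3)] schwartz_rapid[OF S(2)] schwartz_family_translate[OF S(1)]])
  also have "\<dots> = (\<integral>x. diag (s + w) * gauss (t + s * w / (s + w)) (0::'a) x \<partial>lborel)"
  proof (intro Bochner_Integration.integral_cong refl)
    fix x :: 'a
    let ?X = "x \<bullet> x"
    have "rep (gauss w 0) (\<lambda>y. gauss s 0 (y - x)) = of_real (exp (- s * ?X)) * rep (gauss w 0) (gauss s ((2 * s) *\<^sub>R x))"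
      unfolding gauss_translate tempered_cmult[OF rep_tempered[OF S(3)] S(1)] by simp
    also have "\<dots> = of_real (exp (- s * ?X) * exp (s\<^sup>2 / (s + w) * ?X)) * diag (s + w)"
    proof -
      have "((2 * s) *\<^sub>R x + 0) \<bullet> ((2 * s) *\<^sub>R x + 0) / (4 * (s + w)) = s\<^sup>2 / (s + w) * ?X"
        using s w by (simp add: power2_eq_square divide_simps)
      then show ?thesis unfolding rep_gauss_gauss[OF s w] by (simp only: of_real_mult mult.assoc)
    qed
    \<comment> \<open>The loss from translating and the gain from the displaced centre combine to
      the width \<open>s * w / (s + w)\<close>.\<close>
    also have "exp (- s * ?X) * exp (s\<^sup>2 / (s + w) * ?X) = exp (- (s * w / (s + w)) * ?X)"
    proof -
      have "- s * ?X + s\<^sup>2 / (s + w) * ?X = (- s + s\<^sup>2 / (s + w)) * ?X" by (simp add: algebra_simps)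
      also have "- s + s\<^sup>2 / (s + w) = - (s * w / (s + w))" using s w by (simp add: field_simps power2_eq_square)
      finally show ?thesis unfolding exp_add[symmetric] by simp
    qed
    finally have "rep (gauss w 0) (\<lambda>y. gauss s 0 (y - x)) = gauss (s * w / (s + w)) 0 x * diag (s + w)"
      unfolding gauss_eq_real[of "s * w / (s + w)"] .
    then have "gauss t 0 x * rep (gauss w 0) (\<lambda>y. gauss s 0 (y - x)) = diag (s + w) * (gauss t 0 x * gauss (s * w / (s + w)) 0 x)"
      by simp
    then show "gauss t 0 x * rep (gauss w 0) (\<lambda>y. gauss s 0 (y - x)) = diag (s + w) * gauss (t + s * w / (s + w)) 0 x"
      unfolding gauss_mult by simp
  qed
  also have "\<dots> = diag (s + w) * of_real (gauss_mass TYPE('a) (t + s * w / (s + w)))"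
    by (simp add: gauss_integral_0)
  finally show ?thesis .
qed

text \<open>Convolution is symmetric in \<open>s\<close> and \<open>t\<close>, so
  \<open>diag_convolution\<close> may be read with them exchanged. The widths occurring there are
  \<open>q / (s + w)\<close> and \<open>q / (t + w)\<close> with the same \<open>q\<close>, and
  \<open>gauss_mass_scale\<close> extracts the powers of the square roots.\<close>

lemma diag_ratio:
  assumes s: "s > 0" and t: "t > 0" and w: "w > 0"
  shows "diag (s + w) * of_real (sqrt (s + w) ^ DIM('a)) = diag (t + w) * of_real (sqrt (t + w) ^ DIM('a))"
proof -
  define q where "q = s * t + s * w + t * w"
  have q: "q > 0" using assms by (simp add: q_def add_pos_pos)
  define E where "E = (1 / sqrt q) ^ DIM('a) * gauss_mass TYPE('a) 1"
  have E: "E \<noteq> 0" using q gauss_mass_pos[of 1, where 'a='a] by (simp add: E_def)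
  have mass: "gauss_mass TYPE('a) (t + s * w / (s + w)) = sqrt (s + w) ^ DIM('a) * E" if "s > 0" "t > 0" "q = s * t + s * w + t * w" for s t
  proof -
    have "t + s * w / (s + w) = q / (s + w)" using that w by (simp add: field_simps)
    moreover have "q / (s + w) > 0" using q that w by simp
    ultimately show ?thesis using gauss_mass_scale[of "q / (s + w)", where 'a='a]
      by (simp add: E_def real_sqrt_divide power_divide)
  qed
  have "(\<lambda>y. \<integral>x. gauss t 0 x * gauss s 0 (y - x) \<partial>lborel) = (\<lambda>y. \<integral>x. gauss s 0 x * gauss t 0 (y - x) \<partial>(lborel :: 'a measure))"
    by (intro ext convolution_commute gauss_measurable)
  then have "diag (s + w) * of_real (gauss_mass TYPE('a) (t + s * w / (s + w))) = diag (t + w) * of_real (gauss_mass TYPE('a) (s + t * w / (t + w)))"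
    using diag_convolution[OF s t w] diag_convolution[OF t s w] by metis
  moreover have "q = t * s + t * w + s * w" by (simp add: q_def)
  ultimately show ?thesis
    using mass[OF s t q_def] mass[OF t s] E by simp
qed

text \<open>The quotient of \<open>diag 1\<close> by the Gaussian mass of width 1; the squared norm
  makes it visibly real and nonnegative.\<close>

definition form_const :: real where
  "form_const = (N (rep (gauss (1 / 2) 0)))\<^sup>2 / gauss_mass TYPE('a) 1"

lemma rep_self: "schwartz \<phi> \<Longrightarrow> rep \<phi> \<phi> = of_real ((N (rep \<phi>))\<^sup>2)"
  using R_rep[OF _ rep_V, of \<phi> \<phi>] R_self[OF rep_V, of \<phi>] rep_hermitian[of \<phi> \<phi>]
  by (auto simp: complex_eq_iff)

lemma diag_eq:
  assumes r: "r > 0"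
  shows "diag r = of_real (form_const * gauss_mass TYPE('a) r)"
proof -
  \<comment> \<open>A common \<open>w\<close> below both \<open>r\<close> and 1 makes
    \<open>r - w\<close> and \<open>1 - w\<close> admissible widths, so \<open>diag r\<close> can be
    compared with \<open>diag 1\<close>.\<close>
  define w where "w = min r 1 / 2"
  have w: "0 < w" "w < r" "w < 1" using r by (auto simp: w_def min_def)
  have "diag r * of_real (sqrt r ^ DIM('a)) = diag 1"
    using diag_ratio[of "r - w" "1 - w" w] w by simp
  moreover have "sqrt r ^ DIM('a) \<noteq> 0" using r by simp
  ultimately have "diag r = diag 1 / of_real (sqrt r ^ DIM('a))" by (simp add: field_simps)
  moreover have "diag 1 = of_real ((N (rep (gauss (1 / 2) 0)))\<^sup>2)"
    unfolding diag_def by (rule rep_self) (intro schwartz_gauss, simp)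
  moreover have "gauss_mass TYPE('a) r = gauss_mass TYPE('a) 1 / sqrt r ^ DIM('a)"
    using gauss_mass_scale[OF r, where 'a='a] by (simp add: power_divide)
  moreover have "gauss_mass TYPE('a) 1 \<noteq> 0" using gauss_mass_pos[of 1, where 'a='a] by simp
  ultimately show ?thesis by (simp add: form_const_def)
qed

section \<open>Representers as multiples of conjugated test functions\<close>

text \<open>Both sides are tempered, so agreement on Gaussians suffices; there each equals
  \<open>form_const\<close> times the integral of the product Gaussian.\<close>

lemma rep_gauss:
  assumes t: "t > 0"
  shows "rep (gauss t c) = dist_of (\<lambda>x. of_real form_const * gauss t c x)"
proof (rule tempered_eq_of_gauss)
  have S: "schwartz (gauss t c)" using t by (rule schwartz_gauss)
  show "tempered (rep (gauss t c))" by (rule rep_tempered[OF S])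
  show "tempered (dist_of (\<lambda>x. of_real form_const * gauss t c x))"
    by (intro dist_of_tempered square_integrable_cmult schwartz_square_integrable S)
  fix s :: real and b :: 'a assume s: "s > 0"
  have "dist_of (\<lambda>x. of_real form_const * gauss t c x) (gauss s b) = (\<integral>x. of_real form_const * gauss (s + t) (b + c) x \<partial>lebesgue)"
    unfolding dist_of_apply[OF schwartz_gauss[OF s]]
    by (simp add: mult.assoc gauss_mult add.commute)
  also have "\<dots> = (\<integral>x. of_real form_const * gauss (s + t) (b + c) x \<partial>lborel)"
    by (rule integral_completion) measurable
  also have "\<dots> = of_real form_const * of_real (exp (((b + c) \<bullet> (b + c)) / (4 * (s + t))) * gauss_mass TYPE('a) (s + t))"
    using s t by (simp add: gauss_integral)
  finally show "rep (gauss t c) (gauss s b) = dist_of (\<lambda>x. of_real form_const * gauss t c x) (gauss s b)"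
    using s t by (simp add: rep_gauss_gauss diag_eq)
qed

text \<open>Hermitian symmetry reduces the value at a Gaussian to \<open>rep_gauss\<close>, a
  formula valid on every Schwartz function; the conjugate of \<open>\<phi>\<close> comes from this
  exchange of arguments.\<close>

lemma rep_eq_dist_of:
  assumes \<phi>: "schwartz \<phi>"
  shows "rep \<phi> = dist_of (\<lambda>x. of_real form_const * cnj (\<phi> x))"
proof (rule tempered_eq_of_gauss)
  show "tempered (rep \<phi>)" by (rule rep_tempered[OF \<phi>])
  show "tempered (dist_of (\<lambda>x. of_real form_const * cnj (\<phi> x)))"
    by (intro dist_of_tempered square_integrable_cmult square_integrable_cnj schwartz_square_integrable \<phi>)
  fix s :: real and b :: 'a assume s: "s > 0"
  have S: "schwartz (gauss s b)" using s by (rule schwartz_gauss)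
  have "rep \<phi> (gauss s b) = cnj (\<integral>x. of_real form_const * gauss s b x * \<phi> x \<partial>lebesgue)"
    unfolding rep_hermitian[OF \<phi> S] rep_gauss[OF s] dist_of_apply[OF \<phi>] ..
  also have "\<dots> = (\<integral>x. cnj (of_real form_const * gauss s b x * \<phi> x) \<partial>lebesgue)"
    by (rule Bochner_Integration.integral_cnj[symmetric])
  also have "\<dots> = (\<integral>x. of_real form_const * cnj (\<phi> x) * gauss s b x \<partial>lebesgue)"
    by (intro Bochner_Integration.integral_cong refl) (simp add: gauss_def)
  finally show "rep \<phi> (gauss s b) = dist_of (\<lambda>x. of_real form_const * cnj (\<phi> x)) (gauss s b)"
    by (simp add: dist_of_apply S)
qed

text \<open>The squared norm is \<open>rep \<phi> \<phi>\<close>, which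
  \<open>rep_eq_dist_of\<close> evaluates as an integral.\<close>

lemma N_rep:
  assumes \<phi>: "schwartz \<phi>"
  shows "N (rep \<phi>) = sqrt form_const * L2_norm_fun \<phi>"
proof -
  have "complex_of_real ((N (rep \<phi>))\<^sup>2) = (\<integral>x. of_real form_const * cnj (\<phi> x) * \<phi> x \<partial>lebesgue)"
    unfolding rep_self[OF \<phi>, symmetric] by (subst rep_eq_dist_of[OF \<phi>]) (rule dist_of_apply[OF \<phi>])
  also have "\<dots> = (\<integral>x. of_real (form_const * (cmod (\<phi> x))\<^sup>2) \<partial>lebesgue)"
    by (intro Bochner_Integration.integral_cong refl) (simp add: complex_norm_square mult_ac del: of_real_power)
  also have "\<dots> = of_real (form_const * (L2_norm_fun \<phi>)\<^sup>2)"
    unfolding integral_complex_of_real L2_norm_fun_sq by simp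
  finally have "(N (rep \<phi>))\<^sup>2 = form_const * (L2_norm_fun \<phi>)\<^sup>2" by (simp only: of_real_eq_iff)
  then have "sqrt ((N (rep \<phi>))\<^sup>2) = sqrt (form_const * (L2_norm_fun \<phi>)\<^sup>2)" by simp
  then show ?thesis using N_nonneg[OF rep_V[OF \<phi>]] L2_norm_fun_nonneg[of \<phi>] by (simp add: real_sqrt_mult)
qed

lemma form_const_nonneg: "form_const \<ge> 0"
  unfolding form_const_def using gauss_mass_pos[of 1, where 'a='a] by simp

text \<open>With a zero constant all representers vanish, while pairing with them computes the real
  part of every value of an element of \<open>V\<close>.\<close>

lemma form_const_pos:
  assumes "V \<noteq> {0}" shows "form_const > 0"
proof (rule ccontr)
  assume "\<not> form_const > 0"
  then have c: "form_const = 0" using form_const_nonneg by simp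
  have "T = 0" if T: "T \<in> V" for T
  proof (rule tempered_eq_of_Re_eq[OF V_tempered[OF T] V_tempered[OF zero_V]])
    fix \<phi> :: "'a \<Rightarrow> complex" assume \<phi>: "schwartz \<phi>"
    have "rep \<phi> = 0" using N_eq_0[OF rep_V[OF \<phi>]] N_rep[OF \<phi>] c by simp
    then show "Re (T \<phi>) = Re (0 \<phi>)" using R_rep[OF \<phi> T] R_commute[OF T zero_V] R_zero_left[OF T] by simp
  qed
  then show False using assms zero_V by blast
qed

section \<open>From representers to the whole space\<close>

text \<open>A criterion for membership in \<open>V\<close> that also yields approximation by
  representers. Applied to elements of \<open>V\<close> it shows that representers are dense;
  applied to \<open>dist_of f\<close> it shows that square-integrable functions belong to
  \<open>V\<close>.\<close>

lemma bounded_functional_in_V: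
  assumes T: "tempered T" and bd: "\<And>\<phi>. schwartz \<phi> \<Longrightarrow> \<bar>Re (T \<phi>)\<bar> \<le> M * N (rep \<phi>)"
  obtains \<phi> where "T \<in> V" "\<And>n::nat. schwartz (\<phi> n)" "(\<lambda>n. N (rep (\<phi> n) - T)) \<longlonglongrightarrow> 0"
proof -
  define D where "D = rep ` {\<phi>. schwartz \<phi>}"
  \<comment> \<open>A representer may come from several test functions. The choice is harmless,
    since \<open>bd\<close> forces the real part of \<open>T\<close> to vanish on a difference whose
    representer is 0.\<close>
  define L where "L S = Re (T (SOME \<phi>. schwartz \<phi> \<and> rep \<phi> = S))" for S
  have L: "L (rep \<phi>) = Re (T \<phi>)" if \<phi>: "schwartz \<phi>" for \<phi>
  proof -
    define \<phi>' where "\<phi>' = (SOME \<phi>'. schwartz \<phi>' \<and> rep \<phi>' = rep \<phi>)"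
    have \<phi>': "schwartz \<phi>' \<and> rep \<phi>' = rep \<phi>"
      unfolding \<phi>'_def by (rule someI[of _ \<phi>]) (use \<phi> in simp)
    have "\<bar>Re (T (\<lambda>x. \<phi>' x - \<phi> x))\<bar> \<le> M * N (rep (\<lambda>x. \<phi>' x - \<phi> x))" by (intro bd schwartz_diff) (use \<phi> \<phi>' in auto)
    also have "\<dots> = 0" using rep_diff[of \<phi>' \<phi>] \<phi> \<phi>' by (simp add: N_zero)
    finally show ?thesis using tempered_diff[OF T, of \<phi>' \<phi>] \<phi> \<phi>' unfolding L_def \<phi>'_def[symmetric] by simp
  qed
  obtain S u where S: "S \<in> V" and u: "\<And>n::nat. u n \<in> D" and lim: "(\<lambda>n. N (u n - S)) \<longlonglongrightarrow> 0"
    and RS: "\<And>P. P \<in> D \<Longrightarrow> R S P = L P"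
  proof (rule riesz_dense[of D L M])
    show "D \<subseteq> V" unfolding D_def using rep_V by auto
    show "D \<noteq> {}" unfolding D_def using schwartz_zero by auto
    show "P + Q \<in> D" "L (P + Q) = L P + L Q" if PQ: "P \<in> D" "Q \<in> D" for P Q
    proof -
      obtain \<phi> \<psi> where \<phi>: "schwartz \<phi>" "P = rep \<phi>" and \<psi>: "schwartz \<psi>" "Q = rep \<psi>" using PQ by (auto simp: D_def)
      show "P + Q \<in> D" unfolding D_def \<phi>(2) \<psi>(2) rep_add[OF \<phi>(1) \<psi>(1), symmetric]
        using schwartz_add[OF \<phi>(1) \<psi>(1)] by blast
      show "L (P + Q) = L P + L Q"
        unfolding \<phi>(2) \<psi>(2) rep_add[OF \<phi>(1) \<psi>(1), symmetric] L[OF \<phi>(1)] L[OF \<psi>(1)]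
          L[OF schwartz_add[OF \<phi>(1) \<psi>(1)]] tempered_add[OF T \<phi>(1) \<psi>(1)] by simp
    qed
    show "(\<lambda>\<phi>. of_real t * P \<phi>) \<in> D" "L (\<lambda>\<phi>. of_real t * P \<phi>) = t * L P" if P: "P \<in> D" for P t
    proof -
      obtain \<phi> where \<phi>: "schwartz \<phi>" "P = rep \<phi>" using P by (auto simp: D_def)
      show "(\<lambda>\<phi>. of_real t * P \<phi>) \<in> D" unfolding D_def \<phi>(2) rep_scaled[OF \<phi>(1), symmetric]
        using schwartz_cmult[OF \<phi>(1)] by blast
      show "L (\<lambda>\<phi>. of_real t * P \<phi>) = t * L P"
        unfolding \<phi>(2) rep_scaled[OF \<phi>(1), symmetric] L[OF \<phi>(1)] L[OF schwartz_cmult[OF \<phi>(1)]] tempered_cmult[OF T \<phi>(1)] by simp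
    qed
    show "L P \<le> M * N P" if "P \<in> D" for P using that L bd unfolding D_def by (auto intro: order_trans[OF abs_ge_self])
  qed blast
  \<comment> \<open>\<open>R S (rep \<phi>)\<close> equals \<open>Re (S \<phi>)\<close> by
    representation and \<open>Re (T \<phi>)\<close> by the construction of \<open>S\<close>.\<close>
  have "S = T"
  proof (rule tempered_eq_of_Re_eq[OF V_tempered[OF S] T])
    fix \<phi> :: "'a \<Rightarrow> complex" assume \<phi>: "schwartz \<phi>"
    show "Re (S \<phi>) = Re (T \<phi>)" using R_rep[OF \<phi> S] RS[of "rep \<phi>"] L[OF \<phi>] \<phi> by (simp add: D_def)
  qed
  moreover obtain \<phi> where "\<And>n. schwartz (\<phi> n)" "\<And>n. u n = rep (\<phi> n)"
  proof -
    have "\<forall>n. \<exists>\<phi>. schwartz \<phi> \<and> u n = rep \<phi>" using u unfolding D_def by auto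
    then obtain \<phi> where "\<forall>n. schwartz (\<phi> n) \<and> u n = rep (\<phi> n)" by (rule choice[THEN exE])
    then show thesis by (intro that) auto
  qed
  ultimately show ?thesis using S lim by (intro that[of \<phi>]) auto
qed

text \<open>Representers converging to \<open>T\<close> are given by L2 functions with norms
  proportional to \<open>N\<close>, so these are Cauchy in L2 as well. Evaluation at a test function
  is continuous for both norms, which identifies the two limits.\<close>

lemma V_subset_L2:
  assumes c: "form_const > 0" and T: "T \<in> V"
  obtains f where "square_integrable f" "T = dist_of f" "N T = L2_norm_fun f / sqrt form_const"
proof -
  have bd: "\<bar>Re (T \<psi>)\<bar> \<le> N T * N (rep \<psi>)" if "schwartz \<psi>" for \<psi>
    using R_bound[OF T rep_V[OF that]] R_rep[OF that T] by simp
  obtain \<phi> where \<phi>: "\<And>n::nat. schwartz (\<phi> n)" and lim: "(\<lambda>n. N (rep (\<phi> n) - T)) \<longlonglongrightarrow> 0"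
    by (rule bounded_functional_in_V[OF V_tempered[OF T] bd]) auto
  define f where "f n = (\<lambda>x. of_real form_const * cnj (\<phi> n x))" for n
  have fsq: "square_integrable (f n)" for n
    unfolding f_def by (intro square_integrable_cmult square_integrable_cnj schwartz_square_integrable \<phi>)
  have rep: "rep (\<phi> n) = dist_of (f n)" for n unfolding f_def by (rule rep_eq_dist_of[OF \<phi>])
  have norm_f: "L2_norm_fun (\<lambda>x. of_real form_const * cnj (\<psi> x)) = sqrt form_const * N (rep \<psi>)" if "schwartz \<psi>" for \<psi>
    using c unfolding L2_norm_fun_cmult L2_norm_fun_cnj N_rep[OF that] by simp
  have V: "rep (\<phi> n) \<in> V" for n by (rule rep_V[OF \<phi>])
  have diff_f: "L2_norm_fun (\<lambda>x. f m x - f n x) = sqrt form_const * N (rep (\<phi> m) - rep (\<phi> n))" for m n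
    using norm_f[OF schwartz_diff[OF \<phi> \<phi>], of m n] rep_diff[OF \<phi> \<phi>, of m n] by (simp add: f_def right_diff_distrib)
  have cauchy: "\<exists>M. \<forall>m\<ge>M. \<forall>n\<ge>M. L2_norm_fun (\<lambda>x. f m x - f n x) < e" if e: "e > 0" for e
  proof -
    have e2: "e / (2 * sqrt form_const) > 0" using e c by simp
    obtain M where M: "\<And>n. n \<ge> M \<Longrightarrow> N (rep (\<phi> n) - T) < e / (2 * sqrt form_const)"
      using LIMSEQ_D[OF lim e2] by (metis abs_less_iff diff_zero real_norm_def)
    have "L2_norm_fun (\<lambda>x. f m x - f n x) < e" if "m \<ge> M" "n \<ge> M" for m n
    proof -
      have "N (rep (\<phi> m) - rep (\<phi> n)) \<le> N (rep (\<phi> m) - T) + N (T - rep (\<phi> n))"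
        using N_triangle[OF diff_V[OF V T] diff_V[OF T V], of m n] by simp
      also have "\<dots> < e / sqrt form_const"
        using M[OF that(1)] M[OF that(2)] N_diff_commute[OF T V, of n] by (simp add: field_simps)
      finally show ?thesis unfolding diff_f using c by (simp add: field_simps)
    qed
    then show ?thesis by blast
  qed
  obtain g where g: "square_integrable g" and glim: "(\<lambda>n. L2_norm_fun (\<lambda>x. f n x - g x)) \<longlonglongrightarrow> 0"
    using L2_complete[OF fsq cauchy] by blast
  have "T = dist_of g"
  proof
    fix \<psi>
    show "T \<psi> = dist_of g \<psi>"
    proof (cases "schwartz \<psi>")
      case False
      then show ?thesis using tempered_outside[OF V_tempered[OF T]] by (simp add: dist_of_def)
    next
      case \<psi>: True
      obtain C where C: "\<And>T. T \<in> V \<Longrightarrow> cmod (T \<psi>) \<le> C * N T" using evaluation_bounded[OF \<psi>] by blast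
      have "(\<lambda>n. rep (\<phi> n) \<psi> - T \<psi>) \<longlonglongrightarrow> 0"
      proof (rule Lim_null_comparison)
        show "\<forall>\<^sub>F n in sequentially. norm (rep (\<phi> n) \<psi> - T \<psi>) \<le> C * N (rep (\<phi> n) - T)"
          using C[OF diff_V[OF V T]] by simp
        show "(\<lambda>n. C * N (rep (\<phi> n) - T)) \<longlonglongrightarrow> 0" by (rule tendsto_mult_right_zero[OF lim])
      qed
      then have "(\<lambda>n. rep (\<phi> n) \<psi>) \<longlonglongrightarrow> T \<psi>" by (rule LIM_zero_cancel)
      moreover have "(\<lambda>n. dist_of (f n) \<psi> - dist_of g \<psi>) \<longlonglongrightarrow> 0"
      proof (rule Lim_null_comparison)
        show "\<forall>\<^sub>F n in sequentially. norm (dist_of (f n) \<psi> - dist_of g \<psi>) \<le> L2_norm_fun (\<lambda>x. f n x - g x) * L2_norm_fun \<psi>"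
          using dist_of_bound[OF square_integrable_diff[OF fsq g] \<psi>] by (simp add: dist_of_diff[OF fsq g])
        show "(\<lambda>n. L2_norm_fun (\<lambda>x. f n x - g x) * L2_norm_fun \<psi>) \<longlonglongrightarrow> 0" by (rule tendsto_mult_left_zero[OF glim])
      qed
      then have "(\<lambda>n. rep (\<phi> n) \<psi>) \<longlonglongrightarrow> dist_of g \<psi>" unfolding rep by (rule LIM_zero_cancel)
      ultimately show ?thesis by (rule LIMSEQ_unique)
    qed
  qed
  moreover have "N T = L2_norm_fun g / sqrt form_const"
  proof -
    have "(\<lambda>n. L2_norm_fun (f n)) \<longlonglongrightarrow> L2_norm_fun g" by (rule L2_norm_fun_tendsto[OF fsq g glim])
    moreover have "L2_norm_fun (f n) = sqrt form_const * N (rep (\<phi> n))" for n unfolding f_def by (rule norm_f[OF \<phi>])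
    moreover have "(\<lambda>n. sqrt form_const * N (rep (\<phi> n))) \<longlonglongrightarrow> sqrt form_const * N T"
      by (intro tendsto_mult tendsto_const N_tendsto[OF V T lim])
    ultimately have "L2_norm_fun g = sqrt form_const * N T" using LIMSEQ_unique by simp
    then show ?thesis using c by simp
  qed
  ultimately show ?thesis using g that by blast
qed

lemma L2_subset_V:
  assumes c: "form_const > 0" and f: "square_integrable f"
  shows "dist_of f \<in> V" "N (dist_of f) = L2_norm_fun f / sqrt form_const"
proof -
  show V: "dist_of f \<in> V"
  proof -
    \<comment> \<open>Cauchy-Schwarz bounds the pairing by L2 norms, and \<open>N_rep\<close> turns
      that of \<open>\<phi>\<close> into \<open>N (rep \<phi>)\<close>.\<close>
    have bd: "\<bar>Re (dist_of f \<phi>)\<bar> \<le> L2_norm_fun f / sqrt form_const * N (rep \<phi>)" if \<phi>: "schwartz \<phi>" for \<phi>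
      using order_trans[OF abs_Re_le_cmod dist_of_bound[OF f \<phi>]] c unfolding N_rep[OF \<phi>] by simp
    show ?thesis by (rule bounded_functional_in_V[OF dist_of_tempered[OF f] bd]) auto
  qed
  \<comment> \<open>The function supplied by \<open>V_subset_L2\<close> need not be \<open>f\<close>
    itself; equality of the two distributions is enough to make the L2 norms equal.\<close>
  obtain g where "square_integrable g" "dist_of f = dist_of g" "N (dist_of f) = L2_norm_fun g / sqrt form_const"
    using V_subset_L2[OF c V] by blast
  then show "N (dist_of f) = L2_norm_fun f / sqrt form_const" using dist_of_eq_imp_L2_norm_eq[OF f] by simp
qed

end

theorem theorem1p2:
  fixes V :: "(('a::euclidean_space \<Rightarrow> complex) \<Rightarrow> complex) set"
    and N :: "(('a \<Rightarrow> complex) \<Rightarrow> complex) \<Rightarrow> real"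
  assumes "hilbert_in_S' V N"
    and "\<forall>T\<in>V. \<forall>x. dtranslate x T \<in> V \<and> N (dtranslate x T) = N T"
    and "\<forall>T\<in>V. \<forall>\<xi>. dmodulate \<xi> T \<in> V \<and> N (dmodulate \<xi> T) = N T"
    and "V \<noteq> {\<lambda>\<phi>. 0}"
  shows "V = dist_of ` {f. square_integrable f} \<and>
         (\<exists>C>0. \<forall>f. square_integrable f \<longrightarrow> N (dist_of f) = C * L2_norm_fun f)"
proof -
  interpret time_frequency_invariant V N
    by unfold_locales (use assms in auto)
  have c: "form_const > 0" using form_const_pos assms(4) by (simp add: zero_fun_def)
  have "V = dist_of ` {f. square_integrable f}"
    using V_subset_L2[OF c] L2_subset_V(1)[OF c] by blast
  moreover have "N (dist_of f) = (1 / sqrt form_const) * L2_norm_fun f" if "square_integrable f" for f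
    using L2_subset_V(2)[OF c that] by simp
  ultimately show ?thesis using c by (intro conjI exI[of _ "1 / sqrt form_const"]) auto
qed

end
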